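(* Let $X$ be a separable metric space, $F$ a finite set, $\phi:X\to\mathcal{P}(F)$ a continuous discretization, and let $\mu\in I_d(X)$ be a typical process. Then for every integer $k\ge0$ the process $\nu=\phi*\mu\in I_d(F)$ satisfies $$\mathbb{H}_\nu(B_k(C))-\frac d2\,\mathbb{H}_\nu(B_k(e))\ \ge\ \mathbb{E}_{x\sim\mu_o}\big(\mathbb{H}(\phi(x))\big).$$
   Context: $d\ge3$; $T_d$ is the infinite $d$-regular tree with vertex set $V_d$ and root $o$; $B_k(S)$ is the set of vertices within distance $k$ of $S\subseteq V_d$, $C=B_1(o)$, and $e$ is a fixed edge (set of two vertices). $I_d(Y)$ is the set of Borel probability measures on $Y^{V_d}$ invariant under all automorphisms of $T_d$; $\mu_o$ is the marginal at $o$. $\mathcal{P}(F)$ is the set of probability distributions on $F$ with the total variation topology; a continuous discretization is a continuous map $\phi:X\to\mathcal{P}(F)$. For $\alpha\in X^{V}$, $\phi*\alpha$ is the law on $F^V$ obtained by choosing independently for each $v$ an element with law $\phi(\alpha(v))$; for a law $\mu$ on $X^{V}$, $\phi*\mu$ is obtained by first sampling $\alpha\sim\mu$ and then $\phi*\alpha$. For $\nu\in I_d(F)$ and finite $S\subseteq V_d$, $\mathbb{H}_\nu(S)$ is the Shannon entropy of the marginal of $\nu$ on $F^S$; $\mathbb{H}(\phi(x))$ is the Shannon entropy of the distribution $\phi(x)$. Typical process: $\mu$ on $X^{V_d}$ is typical if there is an increasing sequence $(n_i)$ such that, for independent uniformly random $d$-regular graphs $G_i$ on $n_i$ vertices, almost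 surely there are $f_i:V(G_i)\to X$ with $\mathrm{distr}^*(f_i,G_i)\to\mu$ weakly, where $\mathrm{distr}^*(f,G)$ is the law of $f\circ\phi$ for a random covering map $\phi:V_d\to V(G)$ (neighbors of each vertex mapped bijectively onto neighbors of its image; image of $o$ uniform, then extended uniformly at random ball by ball). *)

theory Defs
  imports "HOL-Probability.Probability"
begin

text \<open>Vertices of T_d: reduced words over the alphabet {0..d-1} (no two consecutive
letters equal), i.e. the Cayley graph of the free product of d copies of Z/2.
The root o is the empty word.\<close>

definition tverts :: "nat \<Rightarrow> nat list set" where
  "tverts d = {w. (\<forall>a\<in>set w. a < d) \<and> (\<forall>i. Suc i < length w \<longrightarrow> w ! i \<noteq> w ! Suc i)}"

definition troot :: "nat list" where
  "troot = []"

definition tadj :: "nat \<Rightarrow> nat list \<Rightarrow> nat list \<Rightarrow> bool" where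
  "tadj d v w \<longleftrightarrow> v \<in> tverts d \<and> w \<in> tverts d \<and> ((\<exists>a. w = v @ [a]) \<or> (\<exists>a. v = w @ [a]))"

definition tnbr :: "nat \<Rightarrow> nat list \<Rightarrow> nat list set" where
  "tnbr d v = {w. tadj d v w}"

primrec tball :: "nat \<Rightarrow> nat \<Rightarrow> nat list set \<Rightarrow> nat list set" where
  "tball d 0 S = S \<inter> tverts d"
| "tball d (Suc k) S = tball d k S \<union> {w. \<exists>u\<in>tball d k S. tadj d u w}"

definition tC :: "nat \<Rightarrow> nat list set" where
  "tC d = tball d 1 {troot}"

definition tedge :: "nat list set" where
  "tedge = {troot, [0]}"

definition tree_aut :: "nat \<Rightarrow> (nat list \<Rightarrow> nat list) \<Rightarrow> bool" where
  "tree_aut d \<sigma> \<longleftrightarrow> bij_betw \<sigma> (tverts d) (tverts d) \<and>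
     (\<forall>v\<in>tverts d. \<forall>w\<in>tverts d. tadj d v w \<longleftrightarrow> tadj d (\<sigma> v) (\<sigma> w))"

definition invariant_process :: "nat \<Rightarrow> 'y measure \<Rightarrow> (nat list \<Rightarrow> 'y) measure \<Rightarrow> bool" where
  "invariant_process d N M \<longleftrightarrow> prob_space M \<and> sets M = sets (PiM (tverts d) (\<lambda>_. N)) \<and>
     (\<forall>\<sigma>. tree_aut d \<sigma> \<longrightarrow> distr M M (\<lambda>\<alpha>. restrict (\<alpha> \<circ> \<sigma>) (tverts d)) = M)"

definition tv_dist :: "'f::finite pmf \<Rightarrow> 'f pmf \<Rightarrow> real" where
  "tv_dist p q = (\<Sum>f\<in>UNIV. \<bar>pmf p f - pmf q f\<bar>) / 2"

definition cont_discretization :: "('x::metric_space \<Rightarrow> 'f::finite pmf) \<Rightarrow> bool" where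
  "cont_discretization \<phi> \<longleftrightarrow>
     (\<forall>x. \<forall>\<epsilon>>0. \<exists>\<delta>>0. \<forall>y. dist y x < \<delta> \<longrightarrow> tv_dist (\<phi> y) (\<phi> x) < \<epsilon>)"

definition discr_conv :: "nat \<Rightarrow> ('x \<Rightarrow> 'f pmf) \<Rightarrow> (nat list \<Rightarrow> 'x) measure \<Rightarrow> (nat list \<Rightarrow> 'f) measure" where
  "discr_conv d \<phi> \<mu> = bind \<mu> (\<lambda>\<alpha>. PiM (tverts d) (\<lambda>v. measure_pmf (\<phi> (\<alpha> v))))"

definition pmf_entropy :: "'f::finite pmf \<Rightarrow> real" where
  "pmf_entropy p = - (\<Sum>f\<in>UNIV. pmf p f * ln (pmf p f))"

definition marg_entropy :: "(nat list \<Rightarrow> 'f::finite) measure \<Rightarrow> nat list set \<Rightarrow> real" where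
  "marg_entropy \<nu> S = - (\<Sum>c\<in>PiE S (\<lambda>_. UNIV).
      measure \<nu> {\<beta>\<in>space \<nu>. \<forall>v\<in>S. \<beta> v = c v} * ln (measure \<nu> {\<beta>\<in>space \<nu>. \<forall>v\<in>S. \<beta> v = c v}))"

definition reg_graphs :: "nat \<Rightarrow> nat \<Rightarrow> (nat \<times> nat) set set" where
  "reg_graphs d n = {E. E \<subseteq> {..<n} \<times> {..<n} \<and> (\<forall>u w. (u, w) \<in> E \<longrightarrow> (w, u) \<in> E) \<and>
      (\<forall>u. (u, u) \<notin> E) \<and> (\<forall>u<n. card {w. (u, w) \<in> E} = d)}"

definition gnbr :: "(nat \<times> nat) set \<Rightarrow> nat \<Rightarrow> nat set" where
  "gnbr G u = {w. (u, w) \<in> G}"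

text \<open>Maps of B_k(o) into G which are covering-like on B_{k-1}(o): these are exactly the
possible restrictions to B_k(o) of covering maps built ball by ball.\<close>
definition local_covs :: "nat \<Rightarrow> nat \<Rightarrow> (nat \<times> nat) set \<Rightarrow> nat \<Rightarrow> (nat list \<Rightarrow> nat) set" where
  "local_covs d n G k = {\<tau> \<in> PiE (tball d k {troot}) (\<lambda>_. {..<n}).
      \<forall>j<k. \<forall>v\<in>tball d j {troot}. bij_betw \<tau> (tnbr d v) (gnbr G (\<tau> v))}"

text \<open>Law of the random covering map: image of o uniform, then extended uniformly at random
ball by ball; equivalently its restriction to every ball B_k(o) is uniform on local_covs.\<close>
definition is_random_cover :: "nat \<Rightarrow> nat \<Rightarrow> (nat \<times> nat) set \<Rightarrow> (nat list \<Rightarrow> nat) measure \<Rightarrow> bool" where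
  "is_random_cover d n G P \<longleftrightarrow> prob_space P \<and>
     sets P = sets (PiM (tverts d) (\<lambda>_. count_space (UNIV :: nat set))) \<and>
     (\<forall>k. \<forall>\<tau>\<in>local_covs d n G k.
        measure P {\<psi>\<in>space P. \<forall>v\<in>tball d k {troot}. \<psi> v = \<tau> v} = 1 / real (card (local_covs d n G k)))"

definition random_cover :: "nat \<Rightarrow> nat \<Rightarrow> (nat \<times> nat) set \<Rightarrow> (nat list \<Rightarrow> nat) measure" where
  "random_cover d n G = (THE P. is_random_cover d n G P)"

definition distr_star :: "nat \<Rightarrow> nat \<Rightarrow> (nat \<times> nat) set \<Rightarrow> (nat \<Rightarrow> 'x::topological_space) \<Rightarrow> (nat list \<Rightarrow> 'x) measure" where
  "distr_star d n G f = distr (random_cover d n G) (PiM (tverts d) (\<lambda>_. borel)) (\<lambda>\<psi>. restrict (f \<circ> \<psi>) (tverts d))"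

definition weak_conv :: "nat \<Rightarrow> (nat \<Rightarrow> (nat list \<Rightarrow> 'x::topological_space) measure) \<Rightarrow> (nat list \<Rightarrow> 'x) measure \<Rightarrow> bool" where
  "weak_conv d P \<mu> \<longleftrightarrow>
     (\<forall>g. continuous_map (product_topology (\<lambda>_. euclidean) (tverts d)) euclideanreal g \<and>
          (\<exists>B. \<forall>\<alpha>\<in>PiE (tverts d) (\<lambda>_. UNIV). \<bar>g \<alpha>\<bar> \<le> B) \<longrightarrow>
        (\<lambda>i. integral\<^sup>L (P i) g) \<longlonglongrightarrow> integral\<^sup>L \<mu> g)"

definition typical :: "nat \<Rightarrow> (nat list \<Rightarrow> 'x::topological_space) measure \<Rightarrow> bool" where
  "typical d \<mu> \<longleftrightarrow> (\<exists>n :: nat \<Rightarrow> nat. strict_mono n \<and> (\<forall>i. reg_graphs d (n i) \<noteq> {}) \<and>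
     (AE Gs in PiM UNIV (\<lambda>i. measure_pmf (pmf_of_set (reg_graphs d (n i)))).
        \<exists>f :: nat \<Rightarrow> nat \<Rightarrow> 'x. weak_conv d (\<lambda>i. distr_star d (n i) (Gs i) (f i)) \<mu>))"

end

theory Submission
  imports Defs
begin

text \<open>
  Let G be a random d-regular graph on n vertices, labelled by f so that its local statistics are
  close to \<mu>, and draw for each vertex v independently a letter with law \<phi>(f(v)) and a uniformly
  random numbering of its d neighbours.  The letters carry entropy n E H(\<phi>(x)) up to o(n), the
  numberings carry n log d!, and with high probability the patterns seen on the (k+1)-balls have
  frequencies close to the marginal of \<nu> on B_{k+1}(o) = B_k(C), because on average all but O(1) vertices
  of G have a tree as (k+1)-ball.  So there are at least
  |graphs| (d!)^n exp(n E H(\<phi>(x)) - o(n)) numbered lettered graphs with such frequencies.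

  Conversely, such an object is determined by the pattern at each vertex together with a perfect
  matching of the nd half-edges, in which matched half-edges see mutually reversed patterns
  on B_k(e).  There are about exp(n H(B_k(C))) families of patterns, and each leaves a
  fraction exp(-(nd/2) H(B_k(e))) of all (nd-1)!! matchings.  Since (nd-1)!! exceeds
  |graphs| (d!)^n by a polynomial factor only, comparing the two counts gives the inequality.
\<close>

section \<open>Automorphisms of the tree\<close>

text \<open>The numberings serve twice. They turn a graph into a perfect matching of half-edges,
  which can be counted by entropies, and they fix at every vertex one covering along which its
  pattern is read, so that each vertex has exactly one pattern and rerooting across an edge just
  reverses the edge pattern. The difficulty is to compare this covering with the random one behind
  typical processes: the latter is realised with a fresh numbering at every tree vertex, the former
  reuses the numbering of a graph vertex at all its preimages. On a ball without repeated vertices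
  the two have the same law, and switching edges bounds the number of exceptional vertices.
  Typicality enters through one consequence: for large i, at least three quarters of the d-regular
  graphs on n_i vertices carry a labelling whose mean pattern probabilities and mean entropy are
  close to those of the limit. Polynomial losses are harmless because all exponents are linear in n;
  this allows crude forms of Stirling's formula and replaces the asymptotic number of regular graphs
  by a switching argument.\<close>

definition tmul :: "nat list \<Rightarrow> nat \<Rightarrow> nat list" where
  "tmul x a = (if x \<noteq> [] \<and> last x = a then butlast x else x @ [a])"

text \<open>The rotation carries the edge {o, [0]} to {o, [i]}; \<open>flip\<close>, left multiplication by
  the generator 0 of the free product, reverses that edge.\<close>

definition rot :: "nat \<Rightarrow> nat \<Rightarrow> nat list \<Rightarrow> nat list" where
  "rot d i x = map (\<lambda>a. (a + i) mod d) x"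

fun flip :: "nat list \<Rightarrow> nat list" where
  "flip [] = [0]"
| "flip (a # x) = (if a = 0 then x else 0 # a # x)"

lemma tverts_eq: "tverts d = {w. set w \<subseteq> {..<d} \<and> distinct_adj w}"
  unfolding tverts_def distinct_adj_conv_nth by (auto simp: less_diff_conv)

lemma Nil_in_tverts [simp]: "[] \<in> tverts d"
  by (simp add: tverts_eq)

lemma Cons_in_tverts: "a # x \<in> tverts d \<longleftrightarrow> a < d \<and> x \<in> tverts d \<and> (x \<noteq> [] \<longrightarrow> hd x \<noteq> a)"
  by (cases x) (auto simp: tverts_eq distinct_adj_Cons)

lemma snoc_in_tverts: "x @ [a] \<in> tverts d \<longleftrightarrow> a < d \<and> x \<in> tverts d \<and> (x \<noteq> [] \<longrightarrow> last x \<noteq> a)"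
  by (auto simp: tverts_eq distinct_adj_append_iff)

lemma butlast_in_tverts: "x \<in> tverts d \<Longrightarrow> butlast x \<in> tverts d"
  by (cases x rule: rev_cases) (auto simp: snoc_in_tverts)

lemma tmul_in_tverts: "x \<in> tverts d \<Longrightarrow> a < d \<Longrightarrow> tmul x a \<in> tverts d"
  by (auto simp: tmul_def snoc_in_tverts butlast_in_tverts)

lemma inj_tmul: "inj (tmul x)"
proof (rule injI)
  fix a b assume "tmul x a = tmul x b"
  then show "a = b"
    by (cases x rule: rev_cases) (auto simp: tmul_def split: if_splits dest: arg_cong[of _ _ length])
qed

lemma tmul_Nil [simp]: "tmul [] a = [a]"
  by (simp add: tmul_def)

lemma length_tmul_le: "length (tmul x a) \<le> Suc (length x)"
  by (auto simp: tmul_def)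

text \<open>Viewing the tree as a Cayley graph lets parent and children be addressed uniformly: the
  neighbours of x are its right multiples by the d generators, and the parent is the one obtained by
  cancelling the last letter.\<close>

lemma tadj_iff: "tadj d x y \<longleftrightarrow> x \<in> tverts d \<and> (\<exists>a<d. y = tmul x a)"
proof
  assume *: "tadj d x y"
  then have xy: "x \<in> tverts d" "y \<in> tverts d" by (auto simp: tadj_def)
  from * consider a where "y = x @ [a]" | a where "x = y @ [a]" by (auto simp: tadj_def)
  then show "x \<in> tverts d \<and> (\<exists>a<d. y = tmul x a)"
  proof cases
    case 1
    then show ?thesis using xy by (intro conjI exI[of _ a]) (auto simp: snoc_in_tverts tmul_def)
  next
    case 2
    then show ?thesis using xy by (intro conjI exI[of _ a]) (auto simp: snoc_in_tverts tmul_def)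
  qed
next
  assume "x \<in> tverts d \<and> (\<exists>a<d. y = tmul x a)"
  then obtain a where a: "x \<in> tverts d" "a < d" "y = tmul x a" by blast
  then have "y \<in> tverts d" by (simp add: tmul_in_tverts)
  moreover have "(\<exists>a. y = x @ [a]) \<or> (\<exists>a. x = y @ [a])"
  proof (cases "x \<noteq> [] \<and> last x = a")
    case True
    then have "x = y @ [a]" using a append_butlast_last_id[of x] by (auto simp: tmul_def)
    then show ?thesis by blast
  qed (auto simp: a tmul_def)
  ultimately show "tadj d x y" using a by (simp add: tadj_def)
qed

lemma tadj_tmul: "x \<in> tverts d \<Longrightarrow> a < d \<Longrightarrow> tadj d x (tmul x a)"
  by (auto simp: tadj_iff)

lemma tnbr_eq: "x \<in> tverts d \<Longrightarrow> tnbr d x = tmul x ` {..<d}"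
  by (auto simp: tnbr_def tadj_iff)

lemma tball_length:
  assumes "S = {x \<in> tverts d. length x \<le> m}"
  shows "tball d k S = {x \<in> tverts d. length x \<le> m + k}"
proof (induction k)
  case 0
  then show ?case using assms by auto
next
  case (Suc k)
  have "y \<in> tverts d \<and> length y \<le> Suc (m + k)" if "x \<in> tverts d" "length x \<le> m + k" "tadj d x y" for x y
  proof -
    from that obtain a where "a < d" "y = tmul x a" by (auto simp: tadj_iff)
    then show ?thesis using that length_tmul_le[of x a] by (simp add: tmul_in_tverts)
  qed
  moreover have "\<exists>x\<in>tverts d. length x \<le> m + k \<and> tadj d x y"
    if "y \<in> tverts d" "length y \<le> Suc (m + k)" "\<not> length y \<le> m + k" for y
  proof -
    from that have "y \<noteq> []" by auto
    then show ?thesis using that butlast_in_tverts[of y d] append_butlast_last_id[of y]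
      by (intro bexI[of _ "butlast y"]) (auto simp: tadj_def intro!: exI[of _ "last y"])
  qed
  ultimately show ?case unfolding tball.simps Suc.IH by auto
qed

lemma tball_root: "tball d k {troot} = {x \<in> tverts d. length x \<le> k}"
  by (subst tball_length[of _ d 0]) (auto simp: troot_def)

lemma tball_tC: "tball d k (tC d) = {x \<in> tverts d. length x \<le> Suc k}"
  using tball_length[of "tC d" d 1 k] by (auto simp: tC_def tball_root)

text \<open>The branch of the tree behind [0] consists of the words starting with 0, and these are
  one step closer to [0] than to the root.\<close>

lemma tball_tedge:
  assumes "0 < d"
  shows "tball d k tedge = {x \<in> tverts d. length x \<le> k \<or> (length x \<le> Suc k \<and> hd x = 0)}"
proof (induction k)
  case 0
  then show ?case using assms
    by (auto simp: tedge_def troot_def Cons_in_tverts le_Suc_eq length_Suc_conv)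
next
  case (Suc k)
  have 1: "y \<in> tverts d \<and> (length y \<le> Suc k \<or> length y \<le> Suc (Suc k) \<and> hd y = 0)"
    if x: "x \<in> tverts d" "length x \<le> k \<or> (length x \<le> Suc k \<and> hd x = 0)" "tadj d x y" for x y
  proof -
    obtain a where a: "a < d" "y = tmul x a" using x by (auto simp: tadj_iff)
    have "length y \<le> Suc k \<or> length y \<le> Suc (Suc k) \<and> hd y = 0"
      using x(2) a by (cases x) (auto simp: tmul_def split: if_splits)
    then show ?thesis using a x by (auto simp: tmul_in_tverts)
  qed
  have 2: "\<exists>x\<in>tverts d. (length x \<le> k \<or> (length x \<le> Suc k \<and> hd x = 0)) \<and> tadj d x y"
    if "y \<in> tverts d" "length y \<le> Suc k \<or> length y \<le> Suc (Suc k) \<and> hd y = 0"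
       "\<not> (length y \<le> k \<or> (length y \<le> Suc k \<and> hd y = 0))" for y
  proof -
    from that have "y \<noteq> []" by auto
    then have *: "butlast y \<in> tverts d" "tadj d (butlast y) y"
      using that butlast_in_tverts[of y d] append_butlast_last_id[of y]
      by (auto simp: tadj_def intro!: exI[of _ "last y"])
    have "length (butlast y) \<le> k \<or> (length (butlast y) \<le> Suc k \<and> hd (butlast y) = 0)"
      using that by (cases y) auto
    then show ?thesis using * by blast
  qed
  show ?case
  proof (rule set_eqI)
    fix y
    show "y \<in> tball d (Suc k) tedge
      \<longleftrightarrow> y \<in> {x \<in> tverts d. length x \<le> Suc k \<or> (length x \<le> Suc (Suc k) \<and> hd x = 0)}"
      (is "_ \<longleftrightarrow> y \<in> ?A")
    proof
      assume "y \<in> tball d (Suc k) tedge"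
      then consider "y \<in> tball d k tedge" | x where "x \<in> tball d k tedge" "tadj d x y" by auto
      then show "y \<in> ?A"
      proof cases
        case 1
        then show ?thesis unfolding Suc.IH by auto
      next
        case 2
        then show ?thesis using 1[of x] unfolding Suc.IH by simp
      qed
    next
      assume *: "y \<in> ?A"
      show "y \<in> tball d (Suc k) tedge"
      proof (cases "y \<in> tball d k tedge")
        case False
        then have "\<exists>x\<in>tball d k tedge. tadj d x y" using * 2[of y] unfolding Suc.IH by (simp add: Bex_def conj_assoc)
        then show ?thesis by simp
      qed simp
    qed
  qed
qed

lemma finite_tverts_length: "finite {x \<in> tverts d. length x \<le> k}"
  by (rule finite_subset[OF _ finite_lists_length_le[of "{..<d}" k]]) (auto simp: tverts_eq)

lemma inj_on_add_mod: "inj_on (\<lambda>a. (a + i) mod d) {..<d::nat}"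
proof (rule linorder_inj_onI)
  fix a b assume *: "a < b" "a \<in> {..<d}" "b \<in> {..<d}"
  show "(a + i) mod d \<noteq> (b + i) mod d"
  proof
    assume "(a + i) mod d = (b + i) mod d"
    then have "d dvd (b + i) - (a + i)" using mod_eq_dvd_iff_nat[of "a + i" "b + i" d] * by simp
    then show False using * by (auto dest: dvd_imp_le)
  qed
qed auto

lemma add_mod_eq_iff: "a < d \<Longrightarrow> b < d \<Longrightarrow> (a + i) mod d = (b + i) mod d \<longleftrightarrow> a = (b::nat)"
  using inj_onD[OF inj_on_add_mod[of i d], of a b] by fastforce

lemma rot_in_tverts:
  assumes "0 < d" "x \<in> tverts d"
  shows "rot d i x \<in> tverts d"
  using assms inj_on_subset[OF inj_on_add_mod, of "set x" d i]
  by (auto simp: tverts_eq rot_def distinct_adj_map_iff)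

lemma rot_Nil [simp]: "rot d i [] = []"
  by (simp add: rot_def)

lemma length_rot [simp]: "length (rot d i x) = length x"
  by (simp add: rot_def)

text \<open>Adding i to every letter is an automorphism of the free product, so it commutes with
  right multiplication up to the same relabelling of the generator.\<close>

lemma rot_tmul:
  assumes "x \<in> tverts d" "a < d"
  shows "rot d i (tmul x a) = tmul (rot d i x) ((a + i) mod d)"
proof (cases x rule: rev_cases)
  case Nil
  then show ?thesis by (simp add: rot_def)
next
  case (snoc y b)
  then have "b < d" using assms by (simp add: snoc_in_tverts)
  then show ?thesis using snoc assms add_mod_eq_iff[of a d b i] 
    by (auto simp: tmul_def rot_def)
qed

lemma rot_rot:
  assumes "x \<in> tverts d" "i < d"
  shows "rot d i (rot d (d - i) x) = x" "rot d (d - i) (rot d i x) = x"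
proof -
  have "((a + i) mod d + (d - i)) mod d = a" "((a + (d - i)) mod d + i) mod d = a" if "a < d" for a
    unfolding mod_add_left_eq using that assms(2) by simp_all
  then show "rot d i (rot d (d - i) x) = x" "rot d (d - i) (rot d i x) = x"
    using assms(1) by (auto simp: tverts_eq rot_def comp_def subset_iff intro!: map_idI)
qed

lemma flip_in_tverts: "0 < d \<Longrightarrow> x \<in> tverts d \<Longrightarrow> flip x \<in> tverts d"
  by (cases x) (auto simp: Cons_in_tverts)

lemma flip_flip: "x \<in> tverts d \<Longrightarrow> flip (flip x) = x"
proof (cases x)
  case (Cons a y)
  assume "x \<in> tverts d"
  then show ?thesis using Cons by (cases y) (auto simp: Cons_in_tverts)
qed auto

text \<open>Left and right multiplications commute. This lets \<open>cov_flip\<close> move the root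
  across an edge without changing the letters along walks.\<close>

lemma flip_tmul:
  assumes "x \<in> tverts d"
  shows "flip (tmul x a) = tmul (flip x) a"
proof (cases x)
  case (Cons b y)
  then show ?thesis using assms
    by (cases y rule: rev_cases) (auto simp: tmul_def)
qed (auto simp: tmul_def)

lemma tree_autI:
  assumes "\<And>x. x \<in> tverts d \<Longrightarrow> \<sigma> x \<in> tverts d" "\<And>x. x \<in> tverts d \<Longrightarrow> \<tau> x \<in> tverts d"
    and "\<And>x. x \<in> tverts d \<Longrightarrow> \<tau> (\<sigma> x) = x" "\<And>x. x \<in> tverts d \<Longrightarrow> \<sigma> (\<tau> x) = x"
    and "\<And>x y. tadj d x y \<Longrightarrow> tadj d (\<sigma> x) (\<sigma> y)" "\<And>x y. tadj d x y \<Longrightarrow> tadj d (\<tau> x) (\<tau> y)"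
  shows "tree_aut d \<sigma>"
  unfolding tree_aut_def
proof (intro conjI ballI iffI)
  show "bij_betw \<sigma> (tverts d) (tverts d)"
    by (rule bij_betw_byWitness[of _ \<tau>]) (use assms in auto)
  fix x y assume xy: "x \<in> tverts d" "y \<in> tverts d"
  show "tadj d (\<sigma> x) (\<sigma> y)" if "tadj d x y" using that assms(5) by blast
  show "tadj d x y" if "tadj d (\<sigma> x) (\<sigma> y)"
    using assms(6)[OF that] xy by (simp add: assms(3))
qed

text \<open>Rotations are the automorphisms through which invariance enters the count: they give the
  d edges at the root the same marginal.\<close>

lemma tree_aut_rot:
  assumes "0 < d" "i < d"
  shows "tree_aut d (rot d i)"
proof (rule tree_autI[of _ _ "rot d (d - i)"])
  show "tadj d (rot d j x) (rot d j y)" if "tadj d x y" for x y j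
  proof -
    from that obtain a where "x \<in> tverts d" "a < d" "y = tmul x a" by (auto simp: tadj_iff)
    then show ?thesis using assms by (simp add: rot_tmul rot_in_tverts tadj_tmul)
  qed
  then show "tadj d (rot d (d - i) x) (rot d (d - i) y)" if "tadj d x y" for x y
    using that by blast
qed (use assms in \<open>auto simp: rot_in_tverts rot_rot\<close>)

lemma flip_ball_edge:
  assumes "0 < d" "x \<in> tball d k tedge"
  shows "flip x \<in> tball d k tedge"
  using assms unfolding tball_tedge[OF assms(1)]
  by (cases x) (auto simp: Cons_in_tverts)

lemma tball_tedge_subset: "0 < d \<Longrightarrow> tball d k tedge \<subseteq> tball d k (tC d)"
  by (auto simp: tball_tedge tball_tC)

section \<open>Numberings and covering maps\<close>

text \<open>Restricting to extensional functions makes each numbering a single object, so a vertex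
  of a regular graph has exactly d! of them.\<close>

definition numb :: "nat \<Rightarrow> (nat \<times> nat) set \<Rightarrow> nat \<Rightarrow> (nat \<Rightarrow> nat) set" where
  "numb d G u = {h \<in> extensional {..<d}. bij_betw h {..<d} (gnbr G u)}"

text \<open>A numbering \<open>N x u\<close> lists the neighbours of the vertex u of G and may depend on the tree vertex
  x lying above u.  The state at x is the image u of x with a shift s: the neighbour \<open>tmul x a\<close> of x
  goes to \<open>N x u ((a + s) mod d)\<close>, and s is forced by the parent of x.  Because children and parent
  are treated alike, moving the root of the tree only changes the initial state.
  The word x is stored in reverse.\<close>

primrec cov_state :: "nat \<Rightarrow> (nat list \<Rightarrow> nat \<Rightarrow> nat \<Rightarrow> nat) \<Rightarrow> nat \<times> nat \<Rightarrow> nat list \<Rightarrow> nat \<times> nat" where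
  "cov_state d N vs [] = vs"
| "cov_state d N vs (a # r) = (let (u, s) = cov_state d N vs r; w = N (rev r) u ((a + s) mod d)
     in (w, SOME t. t < d \<and> N (rev (a # r)) w ((a + t) mod d) = u))"

definition cov where "cov d N v s x = fst (cov_state d N (v, s) (rev x))"
definition shf where "shf d N v s x = snd (cov_state d N (v, s) (rev x))"

text \<open>The numberings h that may have produced the values of \<tau> around x. At the root the
  initial shift is 0; elsewhere the shift is forced by the parent, so h is seen only up to a cyclic
  shift.\<close>

definition shift_compat :: "nat \<Rightarrow> (nat list \<Rightarrow> nat) \<Rightarrow> nat list \<Rightarrow> (nat \<Rightarrow> nat) \<Rightarrow> bool" where
  "shift_compat d \<tau> x h \<longleftrightarrow> (\<exists>s<d. (x = [] \<longrightarrow> s = 0) \<and> (\<forall>a<d. \<tau> (tmul x a) = h ((a + s) mod d)))"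

lemma cov_Nil [simp]: "cov d N v s [] = v" "shf d N v s [] = s"
  by (simp_all add: cov_def shf_def)

lemma cov_snoc: "cov d N v s (x @ [a]) = N x (cov d N v s x) ((a + shf d N v s x) mod d)"
  by (simp add: cov_def shf_def case_prod_beta Let_def)

lemma shf_snoc: "shf d N v s (x @ [a]) =
  (SOME t. t < d \<and> N (x @ [a]) (cov d N v s (x @ [a])) ((a + t) mod d) = cov d N v s x)"
  by (simp add: cov_def shf_def case_prod_beta Let_def)

lemma reg_graphsD:
  assumes "G \<in> reg_graphs d n"
  shows "(u, w) \<in> G \<Longrightarrow> u < n" "(u, w) \<in> G \<Longrightarrow> w < n" "(u, w) \<in> G \<longleftrightarrow> (w, u) \<in> G" "(u, u) \<notin> G"
    "u < n \<Longrightarrow> card (gnbr G u) = d" "finite G" "finite (gnbr G u)" "gnbr G u \<subseteq> {..<n}"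
proof -
  show "finite G"
    by (rule finite_subset[of _ "{..<n} \<times> {..<n}"]) (use assms in \<open>auto simp: reg_graphs_def\<close>)
  show "gnbr G u \<subseteq> {..<n}" using assms by (auto simp: reg_graphs_def gnbr_def)
  then show "finite (gnbr G u)" by (rule finite_subset) auto
qed (use assms in \<open>auto simp: reg_graphs_def gnbr_def\<close>)

lemma finite_reg_graphs: "finite (reg_graphs d n)"
  by (rule finite_subset[of _ "Pow ({..<n} \<times> {..<n})"]) (auto simp: reg_graphs_def)

text \<open>Serves two constructions: a fresh numbering at every tree vertex gives the random
  covering map, and a numbering that ignores x gives the covering attached to a labelled
  graph.\<close>

locale numbering =
  fixes d n :: nat and G :: "(nat \<times> nat) set" and N :: "nat list \<Rightarrow> nat \<Rightarrow> nat \<Rightarrow> nat"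
  assumes d_pos: "0 < d" and G: "G \<in> reg_graphs d n"
    and N: "\<And>x u. x \<in> tverts d \<Longrightarrow> u < n \<Longrightarrow> N x u \<in> numb d G u"
begin

lemma N_bij: "x \<in> tverts d \<Longrightarrow> u < n \<Longrightarrow> bij_betw (N x u) {..<d} (gnbr G u)"
  using N by (simp add: numb_def)

lemma N_in: "x \<in> tverts d \<Longrightarrow> u < n \<Longrightarrow> i < d \<Longrightarrow> (u, N x u i) \<in> G"
  using bij_betwE[OF N_bij] by (auto simp: gnbr_def)

lemma N_less: "x \<in> tverts d \<Longrightarrow> u < n \<Longrightarrow> i < d \<Longrightarrow> N x u i < n"
  using N_in reg_graphsD(2)[OF G] by blast

lemma N_inj: "x \<in> tverts d \<Longrightarrow> u < n \<Longrightarrow> i < d \<Longrightarrow> j < d \<Longrightarrow> N x u i = N x u j \<longleftrightarrow> i = j"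
  using bij_betw_imp_inj_on[OF N_bij] by (auto simp: inj_on_def)

lemma N_shift_inj:
  "x \<in> tverts d \<Longrightarrow> u < n \<Longrightarrow> s < d \<Longrightarrow> t < d \<Longrightarrow> N x u ((a + s) mod d) = N x u ((a + t) mod d) \<longleftrightarrow> s = t"
  using N_inj[of x u "(a + s) mod d" "(a + t) mod d"] d_pos add_mod_eq_iff[of s d t a]
  by (simp add: add.commute)

lemma ex_shift:
  assumes "x \<in> tverts d" "(w, u) \<in> G" "a < d"
  shows "\<exists>t<d. N x w ((a + t) mod d) = u"
proof -
  have "w < n" using assms reg_graphsD(1)[OF G] by blast
  then have "u \<in> N x w ` {..<d}"
    using bij_betw_imp_surj_on[OF N_bij[OF assms(1), of w]] assms by (simp add: gnbr_def)
  then obtain j where j: "j < d" "N x w j = u" by auto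
  then show ?thesis using d_pos assms(3)
    by (intro exI[of _ "(j + (d - a)) mod d"]) (simp add: mod_add_right_eq)
qed

text \<open>The last conjunct says that the shift chosen at x makes the step towards the parent
  consistent; with it the recursion for children becomes one rule for all d neighbours
  (\<open>cov_tmul\<close>).\<close>

lemma cov_props:
  assumes "v < n" "s < d"
  shows "x \<in> tverts d \<Longrightarrow> cov d N v s x < n \<and> shf d N v s x < d \<and>
    (x \<noteq> [] \<longrightarrow> N x (cov d N v s x) ((last x + shf d N v s x) mod d) = cov d N v s (butlast x))"
proof (induction x rule: rev_induct)
  case Nil
  then show ?case using assms by simp
next
  case (snoc a x)
  then have x: "x \<in> tverts d" "a < d" by (auto simp: snoc_in_tverts)
  with snoc have IH: "cov d N v s x < n" "shf d N v s x < d" by auto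
  have e: "(cov d N v s x, cov d N v s (x @ [a])) \<in> G"
    unfolding cov_snoc by (rule N_in) (use x IH d_pos in auto)
  then have "(cov d N v s (x @ [a]), cov d N v s x) \<in> G" using reg_graphsD(3)[OF G] by blast
  from someI_ex[OF ex_shift[OF snoc.prems this \<open>a < d\<close>]]
  show ?case using e reg_graphsD(2)[OF G] by (auto simp: shf_snoc[symmetric])
qed

lemma
  assumes "v < n" "s < d" "x \<in> tverts d"
  shows cov_less: "cov d N v s x < n" and shf_less: "shf d N v s x < d"
  using cov_props[OF assms] by auto

lemma cov_tmul:
  assumes "v < n" "s < d" "x \<in> tverts d"
  shows "cov d N v s (tmul x a) = N x (cov d N v s x) ((a + shf d N v s x) mod d)"
  using cov_props[OF assms] by (auto simp: tmul_def cov_snoc)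

text \<open>Induction on the word: the value at a child is given by the rule at its parent, and the
  shift at the child is the only one for which the rule, applied towards the parent, returns the
  parent's value. About words of length k the rule says nothing, so only their values are
  determined.\<close>

lemma cov_unique:
  assumes v: "v < n" "s < d" and \<psi>: "\<psi> [] = v" "\<sigma> [] = s"
    and \<sigma>: "\<And>x. x \<in> tverts d \<Longrightarrow> length x < k \<Longrightarrow> \<sigma> x < d"
    and step: "\<And>x a. x \<in> tverts d \<Longrightarrow> length x < k \<Longrightarrow> a < d \<Longrightarrow> \<psi> (tmul x a) = N x (\<psi> x) ((a + \<sigma> x) mod d)"
  shows "x \<in> tverts d \<Longrightarrow> length x \<le> k \<Longrightarrow> \<psi> x = cov d N v s x \<and> (length x < k \<longrightarrow> \<sigma> x = shf d N v s x)"
proof (induction x rule: rev_induct)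
  case Nil
  then show ?case using \<psi> by simp
next
  case (snoc a x)
  then have x: "x \<in> tverts d" "a < d" "tmul x a = x @ [a]" "length x < k"
    by (auto simp: snoc_in_tverts tmul_def)
  with snoc have IH: "\<psi> x = cov d N v s x" "\<sigma> x = shf d N v s x" by auto
  have eq: "\<psi> (x @ [a]) = cov d N v s (x @ [a])"
    using step[OF x(1,4,2)] x(3) IH by (simp add: cov_snoc)
  moreover have "\<sigma> (x @ [a]) = shf d N v s (x @ [a])" if l: "length (x @ [a]) < k"
  proof -
    \<comment> \<open>Applying the rule along the last letter leads back to the parent, which pins
      down the shift.\<close>
    have b: "tmul (x @ [a]) a = x" by (simp add: tmul_def)
    have "N (x @ [a]) (cov d N v s (x @ [a])) ((a + \<sigma> (x @ [a])) mod d)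
        = N (x @ [a]) (cov d N v s (x @ [a])) ((a + shf d N v s (x @ [a])) mod d)"
      using step[OF snoc.prems(1) l x(2)] cov_tmul[OF v snoc.prems(1), of a] eq IH b by simp
    then show ?thesis
      using N_shift_inj[OF snoc.prems(1) cov_less[OF v snoc.prems(1)] \<sigma>[OF snoc.prems(1) l] shf_less[OF v snoc.prems(1)]]
      by blast
  qed
  ultimately show ?case by blast
qed

lemma cov_unique':
  assumes v: "v < n" "s < d" and \<psi>: "\<psi> [] = v" "\<sigma> [] = s"
    and \<sigma>: "\<And>x. x \<in> tverts d \<Longrightarrow> \<sigma> x < d"
    and step: "\<And>x a. x \<in> tverts d \<Longrightarrow> a < d \<Longrightarrow> \<psi> (tmul x a) = N x (\<psi> x) ((a + \<sigma> x) mod d)"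
    and x: "x \<in> tverts d"
  shows "\<psi> x = cov d N v s x"
  using cov_unique[of v s \<psi> \<sigma> "length x" x] assms by blast

end

text \<open>The rotated family satisfies the same rule with its shift increased by i, so uniqueness
  applies. A word and its rotation are different tree vertices, hence the requirement that the
  numbering ignore the tree vertex.\<close>

lemma (in numbering) cov_rot:
  assumes "v < n" "i < d" "x \<in> tverts d" and const: "\<And>x y. N x = N y"
  shows "cov d N v 0 (rot d i x) = cov d N v i x"
proof -
  define \<psi> where "\<psi> = (\<lambda>x. cov d N v 0 (rot d i x))"
  define \<sigma> where "\<sigma> = (\<lambda>x. (shf d N v 0 (rot d i x) + i) mod d)"
  have "\<psi> x = cov d N v i x"
  proof (rule cov_unique'[of _ _ _ \<sigma>])
    fix x a assume x: "x \<in> tverts d" "a < d"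
    have "\<psi> (tmul x a) = cov d N v 0 (tmul (rot d i x) ((a + i) mod d))"
      using x by (simp add: \<psi>_def rot_tmul)
    also have "\<dots> = N (rot d i x) (\<psi> x) (((a + i) mod d + shf d N v 0 (rot d i x)) mod d)"
      unfolding \<psi>_def by (rule cov_tmul) (use assms x d_pos in \<open>auto simp: rot_in_tverts\<close>)
    also have "((a + i) mod d + shf d N v 0 (rot d i x)) mod d = (a + \<sigma> x) mod d"
      by (simp add: \<sigma>_def mod_simps add_ac)
    also have "N (rot d i x) = N x" by (rule const)
    finally show "\<psi> (tmul x a) = N x (\<psi> x) ((a + \<sigma> x) mod d)" .
  qed (use assms d_pos in \<open>auto simp: \<psi>_def \<sigma>_def\<close>)
  then show ?thesis by (simp add: \<psi>_def)
qed

text \<open>With shift i the letter 0 leads from v to w, and with shift j it leads from w back to v.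
  So the walk x from the state (w, j) is the walk that first crosses the edge 0 from (v, i), after
  cancellation \<open>flip x\<close>.\<close>

lemma (in numbering) cov_flip:
  assumes "v < n" "i < d" "j < d" "N [] v i = w" "N [] w j = v" "x \<in> tverts d"
    and const: "\<And>x y. N x = N y"
  shows "cov d N v i (flip x) = cov d N w j x"
proof -
  define \<psi> where "\<psi> = (\<lambda>x. cov d N v i (flip x))"
  define \<sigma> where "\<sigma> = (\<lambda>x. shf d N v i (flip x))"
  have 0: "[0] \<in> tverts d" using d_pos by (simp add: Cons_in_tverts)
  have c0: "cov d N v i [0] = w"
    using cov_snoc[of d N v i "[]" 0] assms by simp
  have w: "w < n" using N_less[of "[]" v i] assms by simp
  have "N [0] w ((0 + shf d N v i [0]) mod d) = v"
    using cov_tmul[OF assms(1,2) 0, of 0] c0 by (simp add: tmul_def)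
  then have "N [] w ((0 + shf d N v i [0]) mod d) = N [] w ((0 + j) mod d)"
    using assms const[of "[0]" "[]"] by simp
  \<comment> \<open>Only one shift makes the letter 0 return from w to v, and j is such a
    shift.\<close>
  then have s0: "shf d N v i [0] = j"
    using N_shift_inj[of "[]" w "shf d N v i [0]" j 0] w shf_less[OF assms(1,2) 0] assms(3) by simp
  have "\<psi> x = cov d N w j x"
  proof (rule cov_unique'[of _ _ _ \<sigma>])
    fix x a assume x: "x \<in> tverts d" "a < d"
    have "\<psi> (tmul x a) = cov d N v i (tmul (flip x) a)"
      using x by (simp add: \<psi>_def flip_tmul)
    also have "\<dots> = N (flip x) (\<psi> x) ((a + \<sigma> x) mod d)"
      unfolding \<psi>_def \<sigma>_def by (rule cov_tmul) (use assms x d_pos in \<open>auto simp: flip_in_tverts\<close>)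
    also have "N (flip x) = N x" by (rule const)
    finally show "\<psi> (tmul x a) = N x (\<psi> x) ((a + \<sigma> x) mod d)" .
  next
    fix x assume "x \<in> tverts d"
    then show "\<sigma> x < d" unfolding \<sigma>_def using assms d_pos by (simp add: shf_less flip_in_tverts)
  qed (use assms w c0 s0 in \<open>auto simp: \<psi>_def \<sigma>_def\<close>)
  then show ?thesis by (simp add: \<psi>_def)
qed

section \<open>Local covers and the numberings that produce them\<close>

abbreviation tb :: "nat \<Rightarrow> nat \<Rightarrow> nat list set" where
  "tb d k \<equiv> tball d k {troot}"

lemma local_covs_eq:
  "local_covs d n G k = {\<tau> \<in> PiE (tb d k) (\<lambda>_. {..<n}).
     \<forall>x\<in>tverts d. length x < k \<longrightarrow> bij_betw (\<lambda>a. \<tau> (tmul x a)) {..<d} (gnbr G (\<tau> x))}"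
proof -
  have *: "bij_betw \<tau> (tnbr d x) A \<longleftrightarrow> bij_betw (\<lambda>a. \<tau> (tmul x a)) {..<d} A" if "x \<in> tverts d" for \<tau> x and A :: "nat set"
  proof -
    have "bij_betw (tmul x) {..<d} (tnbr d x)"
      unfolding tnbr_eq[OF that] by (rule inj_on_imp_bij_betw, rule inj_on_subset[OF inj_tmul]) auto
    from bij_betw_comp_iff[OF this, of \<tau> A] show ?thesis by (simp add: comp_def)
  qed
  have **: "(\<forall>j<k. \<forall>v\<in>tb d j. P v) \<longleftrightarrow> (\<forall>x\<in>tverts d. length x < k \<longrightarrow> P x)" for P
    unfolding tball_root by (auto dest: spec[of _ "length _"] )
  show ?thesis unfolding local_covs_def ** using * by blast
qed

lemma finite_tb: "finite (tb d k)"
  by (simp add: tball_root finite_tverts_length)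

lemma finite_local_covs: "finite (local_covs d n G k)"
  by (rule finite_subset[of _ "PiE (tb d k) (\<lambda>_. {..<n})"]) (auto simp: local_covs_def finite_PiE finite_tb)

lemma tmul_in_tb: "x \<in> tverts d \<Longrightarrow> length x < k \<Longrightarrow> a < d \<Longrightarrow> tmul x a \<in> tb d k"
  using length_tmul_le[of x a] by (auto simp: tball_root tmul_in_tverts)

context numbering
begin

lemma bij_betw_shift: "s < d \<Longrightarrow> bij_betw (\<lambda>a. (a + s) mod d) {..<d} {..<d}"
  using inj_on_add_mod[of s d] d_pos
  by (intro bij_betw_imageI endo_inj_surj) auto

lemma cov_in_local_covs:
  assumes "v < n"
  shows "restrict (cov d N v 0) (tb d k) \<in> local_covs d n G k"
proof -
  have "bij_betw (\<lambda>a. restrict (cov d N v 0) (tb d k) (tmul x a)) {..<d} (gnbr G (restrict (cov d N v 0) (tb d k) x))"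
    if x: "x \<in> tverts d" "length x < k" for x
  proof -
    let ?u = "cov d N v 0 x"
    have u: "?u < n" by (rule cov_less) (use assms d_pos x in auto)
    have "bij_betw (N x ?u \<circ> (\<lambda>a. (a + shf d N v 0 x) mod d)) {..<d} (gnbr G ?u)"
      by (rule bij_betw_trans[OF bij_betw_shift N_bij]) (use assms d_pos x u in \<open>auto intro: shf_less\<close>)
    moreover have r: "restrict (cov d N v 0) (tb d k) x = ?u" using x by (simp add: tball_root)
    moreover have "restrict (cov d N v 0) (tb d k) (tmul x a) = N x ?u ((a + shf d N v 0 x) mod d)"
      if "a < d" for a using x d_pos assms that by (simp add: tmul_in_tb cov_tmul)
    ultimately show ?thesis unfolding r
      by (subst bij_betw_cong[where g = "N x ?u \<circ> (\<lambda>a. (a + shf d N v 0 x) mod d)"])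
         (simp_all del: restrict_apply)
  qed
  then show ?thesis unfolding local_covs_eq
    using assms d_pos by (auto simp: tball_root intro: cov_less)
qed

text \<open>Splits the event that the construction yields the local cover \<tau> into conditions at
  single tree vertices, each about the one numbering \<open>N x (\<tau> x)\<close>. All later
  product formulas for probabilities rest on this.\<close>

lemma cov_eq_iff:
  assumes "v < n" and \<tau>: "\<tau> \<in> local_covs d n G k"
  shows "restrict (cov d N v 0) (tb d k) = \<tau> \<longleftrightarrow>
    \<tau> [] = v \<and> (\<forall>x\<in>tverts d. length x < k \<longrightarrow> shift_compat d \<tau> x (N x (\<tau> x)))"
proof
  assume eq: "restrict (cov d N v 0) (tb d k) = \<tau>"
  have t: "\<tau> x = cov d N v 0 x" if "x \<in> tb d k" for x using that by (simp add: eq[symmetric])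
  have "shift_compat d \<tau> x (N x (\<tau> x))" if x: "x \<in> tverts d" "length x < k" for x
    unfolding shift_compat_def
  proof (intro exI[of _ "shf d N v 0 x"] conjI allI impI)
    fix a assume "a < d"
    show "\<tau> (tmul x a) = N x (\<tau> x) ((a + shf d N v 0 x) mod d)"
      using x assms(1) d_pos \<open>a < d\<close> by (subst (1 2) t) (auto simp: tmul_in_tb cov_tmul, simp add: tball_root)
  qed (use x assms(1) d_pos in \<open>auto intro: shf_less\<close>)
  then show "\<tau> [] = v \<and> (\<forall>x\<in>tverts d. length x < k \<longrightarrow> shift_compat d \<tau> x (N x (\<tau> x)))"
    using t[of "[]"] by (auto simp: tball_root)
next
  assume R: "\<tau> [] = v \<and> (\<forall>x\<in>tverts d. length x < k \<longrightarrow> shift_compat d \<tau> x (N x (\<tau> x)))"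
  have "\<exists>\<sigma>. \<forall>x. x \<in> tverts d \<and> length x < k \<longrightarrow>
     \<sigma> x < d \<and> (x = [] \<longrightarrow> \<sigma> x = 0) \<and> (\<forall>a<d. \<tau> (tmul x a) = N x (\<tau> x) ((a + \<sigma> x) mod d))"
    using R unfolding shift_compat_def by (intro choice) blast
  then obtain \<sigma> where \<sigma>: "\<And>x. x \<in> tverts d \<Longrightarrow> length x < k \<Longrightarrow> \<sigma> x < d"
    "0 < k \<Longrightarrow> \<sigma> [] = 0"
    "\<And>x a. x \<in> tverts d \<Longrightarrow> length x < k \<Longrightarrow> a < d \<Longrightarrow> \<tau> (tmul x a) = N x (\<tau> x) ((a + \<sigma> x) mod d)"
    by force
  have "\<tau> x = cov d N v 0 x" if "x \<in> tb d k" for x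
  proof -
    \<comment> \<open>For k = 0 the choice leaves the shift at the root arbitrary; overriding it by
      0 makes the initial state agree in every case.\<close>
    have "\<tau> x = cov d N v 0 x \<and> (length x < k \<longrightarrow> (\<sigma>([] := 0)) x = shf d N v 0 x)"
    proof (rule cov_unique)
      fix x assume x: "x \<in> tverts d" "length x < k"
      show "(\<sigma>([] := 0)) x < d" using \<sigma>(1)[OF x] d_pos by simp
      fix a assume a: "a < d"
      show "\<tau> (tmul x a) = N x (\<tau> x) ((a + (\<sigma>([] := 0)) x) mod d)"
        using \<sigma>(3)[OF x a] \<sigma>(2) x by (cases "x = []") auto
    qed (use that assms R d_pos in \<open>auto simp: tball_root\<close>)
    then show ?thesis ..
  qed
  then show "restrict (cov d N v 0) (tb d k) = \<tau>"
    using \<tau> by (auto simp: local_covs_def fun_eq_iff PiE_def extensional_def)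
qed

end

lemma card_compat:
  assumes d: "0 < d" and \<tau>: "\<tau> \<in> local_covs d n G k" and x: "x \<in> tverts d" "length x < k"
  shows "card {h \<in> numb d G (\<tau> x). shift_compat d \<tau> x h} = (if x = [] then 1 else d)"
proof -
  have bij: "bij_betw (\<lambda>a. \<tau> (tmul x a)) {..<d} (gnbr G (\<tau> x))"
    using assms by (auto simp: local_covs_eq)
  define S where "S = (if x = [] then {0} else {..<d})"
  define H where "H = (\<lambda>s. restrict (\<lambda>i. \<tau> (tmul x ((i + (d - s)) mod d))) {..<d})"
  have S: "S \<subseteq> {..<d}" using d by (auto simp: S_def)
  have "bij_betw H S {h \<in> numb d G (\<tau> x). shift_compat d \<tau> x h}"
  proof (rule bij_betw_imageI)
    show "inj_on H S"
    proof (rule inj_onI)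
      fix s t assume st: "s \<in> S" "t \<in> S" "H s = H t"
      then have lt: "s < d" "t < d" using S by auto
      from fun_cong[OF st(3), of "s"] lt d
      have "\<tau> (tmul x 0) = \<tau> (tmul x ((s + (d - t)) mod d))" by (simp add: H_def)
      then have "(s + (d - t)) mod d = 0"
        using inj_onD[OF bij_betw_imp_inj_on[OF bij], of 0 "(s + (d - t)) mod d"] d by simp
      then have "(s + (d - t)) mod d = (t + (d - t)) mod d" using lt by simp
      then show "s = t" using add_mod_eq_iff[OF lt] by blast
    qed
    show "H ` S = {h \<in> numb d G (\<tau> x). shift_compat d \<tau> x h}"
    proof (intro equalityI subsetI)
      fix h assume "h \<in> H ` S"
      then obtain s where s: "s \<in> S" "h = H s" by blast
      then have sd: "s < d" using S by auto
      have eq: "((a + s) mod d + (d - s)) mod d = a" if "a < d" for a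
        unfolding mod_add_left_eq using that sd by simp
      have "bij_betw ((\<lambda>a. \<tau> (tmul x a)) \<circ> (\<lambda>i. (i + (d - s)) mod d)) {..<d} (gnbr G (\<tau> x))"
        by (rule bij_betw_trans[OF _ bij], rule bij_betw_imageI)
           (use d inj_on_add_mod[of "d - s" d] in \<open>auto intro!: endo_inj_surj[THEN equalityD2, THEN subsetD]\<close>)
      then have "bij_betw h {..<d} (gnbr G (\<tau> x))"
        by (rule bij_betw_cong[THEN iffD1, rotated]) (auto simp: s H_def)
      moreover have "shift_compat d \<tau> x h"
        unfolding shift_compat_def using s sd eq d by (intro exI[of _ s]) (auto simp: H_def S_def)
      ultimately show "h \<in> {h \<in> numb d G (\<tau> x). shift_compat d \<tau> x h}"
        by (auto simp: numb_def s H_def)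
    next
      fix h assume "h \<in> {h \<in> numb d G (\<tau> x). shift_compat d \<tau> x h}"
      then obtain s where h: "h \<in> extensional {..<d}" "s < d" "x = [] \<longrightarrow> s = 0"
        "\<And>a. a < d \<Longrightarrow> \<tau> (tmul x a) = h ((a + s) mod d)"
        by (auto simp: numb_def shift_compat_def)
      have eq: "((a + (d - s)) mod d + s) mod d = a" if "a < d" for a
        unfolding mod_add_left_eq using that h(2) by simp
      have "h = H s"
        by (rule extensionalityI[of _ "{..<d}"]) (use h eq d in \<open>auto simp: H_def\<close>)
      then show "h \<in> H ` S" using h by (auto simp: S_def)
    qed
  qed
  from bij_betw_same_card[OF this] show ?thesis by (simp add: S_def split: if_splits)
qed

section \<open>The random covering map\<close>

text \<open>Composition with one fixed bijection reduces bijections from A to B to permutations of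
  A, whose number is known.\<close>

lemma bij_ext_permutes:
  assumes "bij_betw b A B"
  shows "bij_betw (\<lambda>p. restrict (b \<circ> p) A) {p. p permutes A} {h \<in> extensional A. bij_betw h A B}"
proof (rule bij_betw_byWitness[where f' = "\<lambda>h x. if x \<in> A then the_inv_into A b (h x) else x"])
  note [simp] = bij_betw_imp_surj_on[OF assms] bij_betw_imp_inj_on[OF assms]
  show "\<forall>p\<in>{p. p permutes A}. (\<lambda>x. if x \<in> A then the_inv_into A b (restrict (b \<circ> p) A x) else x) = p"
    by (auto simp: fun_eq_iff permutes_not_in the_inv_into_f_f permutes_in_image)
  show "\<forall>h\<in>{h \<in> extensional A. bij_betw h A B}.
     restrict (b \<circ> (\<lambda>x. if x \<in> A then the_inv_into A b (h x) else x)) A = h"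
  proof
    fix h assume h: "h \<in> {h \<in> extensional A. bij_betw h A B}"
    then have "h x \<in> B" if "x \<in> A" for x using that by (auto simp: bij_betw_def)
    then show "restrict (b \<circ> (\<lambda>x. if x \<in> A then the_inv_into A b (h x) else x)) A = h"
      using h by (auto simp: fun_eq_iff extensional_def f_the_inv_into_f)
  qed
  show "(\<lambda>p. restrict (b \<circ> p) A) ` {p. p permutes A} \<subseteq> {h \<in> extensional A. bij_betw h A B}"
  proof (intro image_subsetI CollectI conjI)
    fix p assume "p \<in> {p. p permutes A}"
    then have "bij_betw (b \<circ> p) A B" using assms by (auto intro: bij_betw_trans permutes_imp_bij)
    then show "bij_betw (restrict (b \<circ> p) A) A B"
      by (rule bij_betw_cong[THEN iffD1, rotated]) simp
  qed simp
  show "(\<lambda>h x. if x \<in> A then the_inv_into A b (h x) else x) ` {h \<in> extensional A. bij_betw h A B} \<subseteq> {p. p permutes A}"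
  proof (intro image_subsetI CollectI bij_imp_permutes)
    fix h assume h: "h \<in> {h \<in> extensional A. bij_betw h A B}"
    have "bij_betw (the_inv_into A b \<circ> h) A A"
      using h by (intro bij_betw_trans[of h A B] bij_betw_the_inv_into assms) auto
    then show "bij_betw (\<lambda>x. if x \<in> A then the_inv_into A b (h x) else x) A A"
      by (rule bij_betw_cong[THEN iffD1, rotated]) simp
  qed simp
qed

lemma card_ext_bij:
  assumes "finite A" "finite B" "card A = card B"
  shows "card {h \<in> extensional A. bij_betw h A B} = fact (card A)"
proof -
  obtain b where "bij_betw b A B" using finite_same_card_bij[OF assms] by blast
  from bij_betw_same_card[OF bij_ext_permutes[OF this]] show ?thesis
    using assms(1) by (simp add: card_permutations)
qed

lemma card_numb: "G \<in> reg_graphs d n \<Longrightarrow> u < n \<Longrightarrow> card (numb d G u) = fact d"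
  unfolding numb_def by (subst card_ext_bij) (auto simp: reg_graphsD)

lemma finite_numb: "G \<in> reg_graphs d n \<Longrightarrow> u < n \<Longrightarrow> finite (numb d G u)"
  using card_numb by (metis card.infinite fact_nonzero)

lemma numb_nonempty: "G \<in> reg_graphs d n \<Longrightarrow> u < n \<Longrightarrow> numb d G u \<noteq> {}"
  using card_numb by (metis card.empty fact_nonzero)

text \<open>Coordinate n of a seed encodes the uniformly random image of the root as a constant function.\<close>

definition seed_pmf :: "nat \<Rightarrow> nat \<Rightarrow> (nat \<times> nat) set \<Rightarrow> (nat \<Rightarrow> nat \<Rightarrow> nat) pmf" where
  "seed_pmf d n G = Pi_pmf {..n} undefined
     (\<lambda>u. if u = n then map_pmf (\<lambda>v _. v) (pmf_of_set {..<n}) else pmf_of_set (numb d G u))"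

text \<open>At a vertex other than the root the d cyclic shifts of one numbering induce the same local cover.\<close>

definition compat_prob :: "nat \<Rightarrow> nat \<Rightarrow> nat list \<Rightarrow> real" where
  "compat_prob d k x = (if length x < k then (if x = [] then 1 else real d) / fact d else 1)"

lemma prob_compat:
  assumes "0 < d" "G \<in> reg_graphs d n" "\<tau> \<in> local_covs d n G k" "x \<in> tverts d" "length x < k"
  shows "measure_pmf.prob (pmf_of_set (numb d G (\<tau> x))) {h. shift_compat d \<tau> x h} = compat_prob d k x"
proof -
  have u: "\<tau> x < n" using assms by (auto simp: local_covs_def PiE_def Pi_def tball_root)
  have "numb d G (\<tau> x) \<inter> {h. shift_compat d \<tau> x h} = {h \<in> numb d G (\<tau> x). shift_compat d \<tau> x h}" by auto
  then show ?thesis using assms u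
    by (simp add: measure_pmf_of_set numb_nonempty finite_numb card_compat card_numb compat_prob_def)
qed

text \<open>The two requirements concern different coordinates of the seed, coordinate n for the
  root and coordinate \<open>\<tau> x\<close> for the numbering, and these are independent.\<close>

lemma prob_seed:
  assumes "0 < d" "0 < n" "G \<in> reg_graphs d n" "\<tau> \<in> local_covs d n G k" "x \<in> tb d k"
  shows "measure_pmf.prob (seed_pmf d n G)
     {\<eta>. (x = [] \<longrightarrow> \<eta> n 0 = \<tau> []) \<and> (length x < k \<longrightarrow> shift_compat d \<tau> x (\<eta> (\<tau> x)))}
   = (if x = [] then 1 / n else 1) * compat_prob d k x"
proof -
  have u: "\<tau> x < n" using assms by (auto simp: local_covs_def PiE_def Pi_def)
  have u0: "\<tau> [] < n" using assms by (auto simp: local_covs_def PiE_def Pi_def tball_root)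
  have x: "x \<in> tverts d" using assms(5) by (simp add: tball_root)
  define C where "C = (\<lambda>i. if i = n then (if x = [] then {h. h 0 = \<tau> []} else UNIV)
     else if i = \<tau> x \<and> length x < k then {h. shift_compat d \<tau> x h} else UNIV)"
  let ?p = "\<lambda>u. if u = n then map_pmf (\<lambda>v _. v) (pmf_of_set {..<n}) else pmf_of_set (numb d G u)"
  have "{\<eta>. (x = [] \<longrightarrow> \<eta> n 0 = \<tau> []) \<and> (length x < k \<longrightarrow> shift_compat d \<tau> x (\<eta> (\<tau> x)))} = Pi {..n} C"
  proof (rule set_eqI)
    fix \<eta>
    have "\<eta> \<in> Pi {..n} C \<longleftrightarrow> \<eta> n \<in> C n \<and> (\<forall>i<n. \<eta> i \<in> C i)" by (auto simp: Pi_def le_less)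
    also have "(\<forall>i<n. \<eta> i \<in> C i) \<longleftrightarrow> (length x < k \<longrightarrow> shift_compat d \<tau> x (\<eta> (\<tau> x)))"
      using u by (simp add: C_def)
    also have "\<eta> n \<in> C n \<longleftrightarrow> (x = [] \<longrightarrow> \<eta> n 0 = \<tau> [])" by (simp add: C_def)
    finally show "\<eta> \<in> {\<eta>. (x = [] \<longrightarrow> \<eta> n 0 = \<tau> []) \<and> (length x < k \<longrightarrow> shift_compat d \<tau> x (\<eta> (\<tau> x)))}
      \<longleftrightarrow> \<eta> \<in> Pi {..n} C" by blast
  qed
  then have "measure_pmf.prob (seed_pmf d n G)
     {\<eta>. (x = [] \<longrightarrow> \<eta> n 0 = \<tau> []) \<and> (length x < k \<longrightarrow> shift_compat d \<tau> x (\<eta> (\<tau> x)))}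
     = (\<Prod>i\<le>n. measure_pmf.prob (?p i) (C i))"
    unfolding seed_pmf_def by (simp add: measure_Pi_pmf_Pi)
  also have "\<dots> = measure_pmf.prob (?p n) (C n) * (\<Prod>i<n. measure_pmf.prob (?p i) (C i))"
    by (simp add: lessThan_Suc_atMost[symmetric] mult.commute)
  also have "measure_pmf.prob (?p n) (C n) = (if x = [] then 1 / n else 1)"
  proof -
    have "{..<n} \<inter> (\<lambda>v _. v) -` {h. h (0::nat) = \<tau> []} = {\<tau> []}" using u0 by auto
    then show ?thesis using assms(2) by (simp add: C_def measure_pmf_of_set lessThan_empty_iff)
  qed
  also have "(\<Prod>i<n. measure_pmf.prob (?p i) (C i)) = (\<Prod>i<n. if i = \<tau> x then compat_prob d k x else 1)"
    using prob_compat[OF assms(1,3,4) x] by (intro prod.cong) (auto simp: C_def compat_prob_def)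
  also have "\<dots> = compat_prob d k x" using u by (simp add: prod.delta)
  finally show ?thesis .
qed

text \<open>Each tree vertex carries its own seed, with a numbering of every graph vertex. A graph
  vertex visited twice is thus numbered afresh, which keeps the construction uniform even over local
  covers that are not injective.\<close>

definition seeds :: "nat \<Rightarrow> nat \<Rightarrow> (nat \<times> nat) set \<Rightarrow> (nat list \<Rightarrow> nat \<Rightarrow> nat \<Rightarrow> nat) measure" where
  "seeds d n G = PiM (tverts d) (\<lambda>_. measure_pmf (seed_pmf d n G))"

lemma measurable_seed_component:
  assumes "x \<in> tverts d"
  shows "(\<lambda>\<omega>. F (\<omega> x)) \<in> measurable (seeds d n G) (count_space UNIV)"
proof -
  have "(\<lambda>\<omega>. \<omega> x) \<in> measurable (seeds d n G) (measure_pmf (seed_pmf d n G))"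
    unfolding seeds_def by (rule measurable_component_singleton) fact
  then show ?thesis by (rule measurable_compose) simp
qed

text \<open>The states form a countable set, so a step that reads a seed at a random state is
  measurable as soon as it is so at each fixed state.\<close>

lemma measurable_cov_state:
  "rev r \<in> tverts d \<Longrightarrow> (\<lambda>\<omega>. cov_state d \<omega> (\<omega> [] n 0, 0) r) \<in> measurable (seeds d n G) (count_space UNIV)"
proof (induction r)
  case Nil
  have "(\<lambda>\<omega>. (\<lambda>\<eta>. (\<eta> n 0, 0::nat)) (\<omega> [])) \<in> measurable (seeds d n G) (count_space UNIV)"
    by (rule measurable_seed_component) simp
  then show ?case by simp
next
  case (Cons a r)
  then have r: "rev r \<in> tverts d" "rev (a # r) \<in> tverts d" by (simp_all add: snoc_in_tverts)
  let ?M = "measurable (seeds d n G) (count_space UNIV)"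
  define W where "W = (\<lambda>us (\<omega>::nat list \<Rightarrow> nat \<Rightarrow> nat \<Rightarrow> nat). \<omega> (rev r) (fst us) ((a + snd us) mod d))"
  define R where "R = (\<lambda>(us::nat \<times> nat) w (\<omega>::nat list \<Rightarrow> nat \<Rightarrow> nat \<Rightarrow> nat).
     (w, SOME t. t < d \<and> \<omega> (rev (a # r)) w ((a + t) mod d) = fst us))"
  have W: "W us \<in> ?M" for us :: "nat \<times> nat"
    unfolding W_def by (rule measurable_seed_component[OF r(1)])
  have R: "R us w \<in> ?M" for us :: "nat \<times> nat" and w
    unfolding R_def by (rule measurable_seed_component[OF r(2)])
  have "(\<lambda>\<omega>. R us (W us \<omega>) \<omega>) \<in> ?M" for us
    by (rule measurable_compose_countable[OF R W])
  from measurable_compose_countable[OF this Cons.IH[OF r(1)]]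
  have "(\<lambda>\<omega>. R (cov_state d \<omega> (\<omega> [] n 0, 0) r) (W (cov_state d \<omega> (\<omega> [] n 0, 0) r) \<omega>) \<omega>) \<in> ?M" .
  moreover have "(\<lambda>\<omega>. cov_state d \<omega> (\<omega> [] n 0, 0) (a # r))
    = (\<lambda>\<omega>. R (cov_state d \<omega> (\<omega> [] n 0, 0) r) (W (cov_state d \<omega> (\<omega> [] n 0, 0) r) \<omega>) \<omega>)"
    by (rule ext) (simp only: W_def R_def cov_state.simps case_prod_beta Let_def)
  ultimately show ?case by (simp only:)
qed

definition rcov :: "nat \<Rightarrow> nat \<Rightarrow> (nat \<times> nat) set \<Rightarrow> (nat list \<Rightarrow> nat) measure" where
  "rcov d n G = distr (seeds d n G) (PiM (tverts d) (\<lambda>_. count_space UNIV))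
     (\<lambda>\<omega>. restrict (cov d \<omega> (\<omega> [] n 0) 0) (tverts d))"

lemma measurable_rcov:
  "(\<lambda>\<omega>. restrict (cov d \<omega> (\<omega> [] n 0) 0) (tverts d)) \<in> measurable (seeds d n G) (PiM (tverts d) (\<lambda>_. count_space UNIV))"
proof (rule measurable_restrict)
  fix x assume "x \<in> tverts d"
  from measurable_compose[OF measurable_cov_state[of "rev x"], of d fst "count_space UNIV"] this
  show "(\<lambda>\<omega>. cov d \<omega> (\<omega> [] n 0) 0 x) \<in> measurable (seeds d n G) (count_space UNIV)"
    by (simp add: cov_def)
qed

lemma prob_space_seeds: "prob_space (seeds d n G)"
  unfolding seeds_def by (rule prob_space_PiM) (rule prob_space_measure_pmf)

lemma set_seed_pmf:
  assumes "G \<in> reg_graphs d n" "0 < n" "\<eta> \<in> set_pmf (seed_pmf d n G)"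
  shows "u < n \<Longrightarrow> \<eta> u \<in> numb d G u" "\<eta> n 0 < n"
proof -
  have *: "\<eta> u \<in> set_pmf (if u = n then map_pmf (\<lambda>v _. v) (pmf_of_set {..<n}) else pmf_of_set (numb d G u))"
    if "u \<le> n" for u
    using assms(3) that by (auto simp: seed_pmf_def set_Pi_pmf PiE_dflt_def)
  show "u < n \<Longrightarrow> \<eta> u \<in> numb d G u"
    using *[of u] assms by (simp add: finite_numb numb_nonempty set_pmf_of_set)
  have "{..<n} \<noteq> {}" using assms(2) by auto
  then show "\<eta> n 0 < n" using *[of n] by (auto simp: set_pmf_of_set)
qed

lemma AE_seeds:
  assumes "G \<in> reg_graphs d n" "0 < n" "0 < d"
  shows "AE \<omega> in seeds d n G. numbering d n G \<omega> \<and> \<omega> [] n 0 < n"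
proof -
  have "AE \<omega> in seeds d n G. \<forall>x\<in>tverts d. \<omega> x \<in> set_pmf (seed_pmf d n G)"
  proof (rule AE_ball_countable[THEN iffD2, rule_format])
    fix x assume "x \<in> tverts d"
    then show "AE \<omega> in seeds d n G. \<omega> x \<in> set_pmf (seed_pmf d n G)" unfolding seeds_def
      by (intro AE_PiM_component prob_space_measure_pmf AE_measure_pmf)
  qed simp
  then show ?thesis
  proof eventually_elim
    case (elim \<omega>)
    then show ?case using assms set_seed_pmf[OF assms(1,2)] by (auto intro!: numbering.intro)
  qed
qed

lemma sets_cylinder:
  assumes "sets P = sets (PiM (tverts d) (\<lambda>_. count_space (UNIV :: 'a set)))" "finite J" "J \<subseteq> tverts d"
  shows "{\<psi>\<in>space P. \<forall>v\<in>J. \<psi> v = \<tau> v} \<in> sets P"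
proof -
  have "{\<psi>\<in>space (PiM (tverts d) (\<lambda>_. count_space (UNIV :: 'a set))). \<forall>v\<in>J. \<psi> v \<in> {\<tau> v}}
    = prod_emb (tverts d) (\<lambda>_. count_space UNIV) J (PiE J (\<lambda>v. {\<tau> v}))"
    using assms(3) by (auto simp: prod_emb_def space_PiM PiE_iff dest: extensional_arb)
  also have "\<dots> \<in> sets (PiM (tverts d) (\<lambda>_. count_space (UNIV :: 'a set)))"
    by (rule sets_PiM_I) (use assms in auto)
  finally show ?thesis using sets_eq_imp_space_eq[OF assms(1)] assms(1) by simp
qed

text \<open>This is n times the probability of one local cover. It depends on d and k alone and, by
  \<open>cov_weight_root\<close>, is the reciprocal of the number of local covers with a given root
  image.\<close>

definition cov_weight :: "nat \<Rightarrow> nat \<Rightarrow> real" where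
  "cov_weight d k = (\<Prod>x\<in>tb d k. compat_prob d k x)"

lemma tb_subset: "tb d k \<subseteq> tverts d"
  by (auto simp: tball_root)

text \<open>By \<open>cov_eq_iff\<close> the event is almost surely an intersection of events about
  the seeds at different tree vertices, and the probability of each factor is the same for all
  \<tau>. Hence all local covers are equally likely.\<close>

lemma prob_rcov:
  assumes "0 < d" "0 < n" "G \<in> reg_graphs d n" "\<tau> \<in> local_covs d n G k"
  shows "measure (rcov d n G) {\<psi>\<in>space (rcov d n G). \<forall>v\<in>tb d k. \<psi> v = \<tau> v} = cov_weight d k / n"
proof -
  interpret S: prob_space "seeds d n G" by (rule prob_space_seeds)
  let ?P = "PiM (tverts d) (\<lambda>_. count_space (UNIV :: nat set))"
  let ?f = "\<lambda>\<omega>. restrict (cov d \<omega> (\<omega> [] n 0) 0) (tverts d)"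
  define X where "X = (\<lambda>x. {\<eta>. (x = [] \<longrightarrow> \<eta> n 0 = \<tau> []) \<and> (length x < k \<longrightarrow> shift_compat d \<tau> x (\<eta> (\<tau> x)))})"
  have sp: "space (rcov d n G) = space ?P" "sets (rcov d n G) = sets ?P" by (simp_all add: rcov_def)
  have cyl: "{\<psi>\<in>space ?P. \<forall>v\<in>tb d k. \<psi> v = \<tau> v} \<in> sets ?P"
    using sets_cylinder[OF refl finite_tb tb_subset] .
  have emb: "{\<omega>\<in>space (seeds d n G). \<forall>x\<in>tb d k. \<omega> x \<in> X x} = 
       prod_emb (tverts d) (\<lambda>_. measure_pmf (seed_pmf d n G)) (tb d k) (PiE (tb d k) X)"
      using tb_subset[of d k] by (auto simp: seeds_def prod_emb_def space_PiM PiE_iff dest: extensional_arb)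
  have "measure (rcov d n G) {\<psi>\<in>space (rcov d n G). \<forall>v\<in>tb d k. \<psi> v = \<tau> v}
     = measure (seeds d n G) (?f -` {\<psi>\<in>space ?P. \<forall>v\<in>tb d k. \<psi> v = \<tau> v} \<inter> space (seeds d n G))"
    unfolding sp unfolding rcov_def by (rule measure_distr[OF measurable_rcov cyl])
  also have "\<dots> = measure (seeds d n G) {\<omega>\<in>space (seeds d n G). \<forall>x\<in>tb d k. \<omega> x \<in> X x}"
  proof (rule S.finite_measure_eq_AE)
    show "?f -` {\<psi>\<in>space ?P. \<forall>v\<in>tb d k. \<psi> v = \<tau> v} \<inter> space (seeds d n G) \<in> sets (seeds d n G)"
      by (rule measurable_sets[OF measurable_rcov cyl])
    show "{\<omega>\<in>space (seeds d n G). \<forall>x\<in>tb d k. \<omega> x \<in> X x} \<in> sets (seeds d n G)"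
      unfolding emb unfolding seeds_def by (rule sets_PiM_I) (auto simp: tb_subset finite_tb)
    show "AE \<omega> in seeds d n G. \<omega> \<in> ?f -` {\<psi>\<in>space ?P. \<forall>v\<in>tb d k. \<psi> v = \<tau> v} \<inter> space (seeds d n G) \<longleftrightarrow>
       \<omega> \<in> {\<omega>\<in>space (seeds d n G). \<forall>x\<in>tb d k. \<omega> x \<in> X x}"
      using AE_seeds[OF assms(3,2,1)] AE_space
    proof eventually_elim
      case (elim \<omega>)
      then interpret numbering d n G \<omega> by simp
      let ?v = "\<omega> [] n 0"
      have "(\<forall>v\<in>tb d k. ?f \<omega> v = \<tau> v) \<longleftrightarrow> restrict (cov d \<omega> ?v 0) (tb d k) = \<tau>"
        using assms(4) tb_subset[of d k]
        by (fastforce simp: local_covs_def fun_eq_iff PiE_def extensional_def)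
      also have "\<dots> \<longleftrightarrow> \<tau> [] = ?v \<and> (\<forall>x\<in>tverts d. length x < k \<longrightarrow> shift_compat d \<tau> x (\<omega> x (\<tau> x)))"
        by (rule cov_eq_iff) (use elim assms in auto)
      also have "\<dots> \<longleftrightarrow> (\<forall>x\<in>tb d k. \<omega> x \<in> X x)"
        by (auto simp: X_def tball_root dest: spec[of _ "[]"])
      finally show ?case using elim by (auto simp: space_PiM)
    qed
  qed
  also have "\<dots> = (\<Prod>x\<in>tb d k. measure_pmf.prob (seed_pmf d n G) (X x))"
  proof -
    interpret product_prob_space "\<lambda>_. measure_pmf (seed_pmf d n G)" "tverts d"
      by standard
    show ?thesis unfolding emb unfolding seeds_def
      by (rule measure_PiM_emb) (auto simp: tb_subset finite_tb)
  qed
  also have "\<dots> = (\<Prod>x\<in>tb d k. (if x = [] then 1 / n else 1) * compat_prob d k x)"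
    unfolding X_def using assms by (intro prod.cong prob_seed) auto
  also have "\<dots> = cov_weight d k / n"
  proof -
    have "[] \<in> tb d k" by (simp add: tball_root)
    then have "(\<Prod>x\<in>tb d k. if x = [] then 1 / real n else 1) = 1 / real n" by (simp add: finite_tb)
    then show ?thesis by (simp add: prod.distrib cov_weight_def)
  qed
  finally show ?thesis .
qed

lemma cyl_disjoint:
  assumes "\<tau> \<in> local_covs d n G k" "\<tau>' \<in> local_covs d n G k" "\<forall>v\<in>tb d k. \<psi> v = \<tau> v" "\<forall>v\<in>tb d k. \<psi> v = \<tau>' v"
  shows "\<tau> = \<tau>'"
  by (rule PiE_ext[of _ "tb d k" "\<lambda>_. {..<n}"]) (use assms in \<open>auto simp: local_covs_def\<close>)

lemma measure_Union_cyl: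
  fixes c :: real
  assumes P: "prob_space P" "sets P = sets (PiM (tverts d) (\<lambda>_. count_space (UNIV :: nat set)))"
    and c: "\<And>\<tau>. \<tau> \<in> local_covs d n G k \<Longrightarrow> measure P {\<psi>\<in>space P. \<forall>v\<in>tb d k. \<psi> v = \<tau> v} = c"
  shows "measure P (\<Union>\<tau>\<in>local_covs d n G k. {\<psi>\<in>space P. \<forall>v\<in>tb d k. \<psi> v = \<tau> v}) = card (local_covs d n G k) * c"
proof -
  interpret prob_space P by fact
  have "measure P (\<Union>\<tau>\<in>local_covs d n G k. {\<psi>\<in>space P. \<forall>v\<in>tb d k. \<psi> v = \<tau> v})
     = (\<Sum>\<tau>\<in>local_covs d n G k. measure P {\<psi>\<in>space P. \<forall>v\<in>tb d k. \<psi> v = \<tau> v})"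
  proof (rule finite_measure_finite_Union)
    show "(\<lambda>\<tau>. {\<psi>\<in>space P. \<forall>v\<in>tb d k. \<psi> v = \<tau> v}) ` local_covs d n G k \<subseteq> events"
      using sets_cylinder[OF P(2) finite_tb tb_subset] by (rule image_subsetI)
    show "disjoint_family_on (\<lambda>\<tau>. {\<psi>\<in>space P. \<forall>v\<in>tb d k. \<psi> v = \<tau> v}) (local_covs d n G k)"
      unfolding disjoint_family_on_def using cyl_disjoint by blast
  qed (rule finite_local_covs)
  then show ?thesis using c by simp
qed

text \<open>The cylinders of the local covers are disjoint, equally likely, and cover the space
  almost surely, so their number is read off from the total mass 1 instead of being counted.\<close>

lemma card_local_covs:
  assumes "0 < d" "0 < n" "G \<in> reg_graphs d n"
  shows "card (local_covs d n G k) * (cov_weight d k / n) = 1"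
proof -
  interpret S: prob_space "seeds d n G" by (rule prob_space_seeds)
  interpret P: prob_space "rcov d n G" unfolding rcov_def by (rule S.prob_space_distr[OF measurable_rcov])
  let ?U = "\<Union>\<tau>\<in>local_covs d n G k. {\<psi>\<in>space (rcov d n G). \<forall>v\<in>tb d k. \<psi> v = \<tau> v}"
  have sets: "sets (rcov d n G) = sets (PiM (tverts d) (\<lambda>_. count_space (UNIV :: nat set)))"
    by (simp add: rcov_def)
  have U: "?U \<in> sets (rcov d n G)"
    using sets_cylinder[OF sets finite_tb tb_subset] finite_local_covs by blast
  have sp: "space (rcov d n G) = space (PiM (tverts d) (\<lambda>_. count_space (UNIV :: nat set)))" by (simp add: rcov_def)
  have "AE \<omega> in seeds d n G. restrict (cov d \<omega> (\<omega> [] n 0) 0) (tverts d) \<in> ?U"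
    using AE_seeds[OF assms(3,2,1)]
  proof eventually_elim
    case (elim \<omega>)
    then interpret numbering d n G \<omega> by simp
    have "restrict (cov d \<omega> (\<omega> [] n 0) 0) (tb d k) \<in> local_covs d n G k"
      by (rule cov_in_local_covs) (use elim in auto)
    moreover have "restrict (cov d \<omega> (\<omega> [] n 0) 0) (tverts d) \<in> space (rcov d n G)"
      by (simp add: sp space_PiM)
    ultimately show ?case using tb_subset[of d k]
      by (intro UN_I[of "restrict (cov d \<omega> (\<omega> [] n 0) 0) (tb d k)"]) auto
  qed
  then have "AE \<psi> in rcov d n G. \<psi> \<in> ?U"
    unfolding rcov_def
  proof (subst AE_distr_iff[OF measurable_rcov])
    have "{x \<in> space (rcov d n G). x \<in> ?U} = ?U" by blast
    then show "{x \<in> space (PiM (tverts d) (\<lambda>_. count_space UNIV)). x \<in>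
       (\<Union>\<tau>\<in>local_covs d n G k. {\<psi> \<in> space (distr (seeds d n G) (PiM (tverts d) (\<lambda>_. count_space UNIV))
         (\<lambda>\<omega>. restrict (cov d \<omega> (\<omega> [] n 0) 0) (tverts d))). \<forall>v\<in>tb d k. \<psi> v = \<tau> v})}
       \<in> sets (PiM (tverts d) (\<lambda>_. count_space UNIV))"
      using U unfolding rcov_def by simp
  qed (simp add: rcov_def)
  then have "P.prob ?U = 1" using P.prob_eq_1[OF U] by simp
  moreover have "P.prob ?U = card (local_covs d n G k) * (cov_weight d k / n)"
    by (rule measure_Union_cyl[OF P.prob_space_axioms sets prob_rcov[OF assms]])
  ultimately show ?thesis by (simp only:)
qed

lemma inverse_card_local_covs:
  assumes "0 < d" "0 < n" "G \<in> reg_graphs d n"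
  shows "1 / card (local_covs d n G k) = cov_weight d k / n"
  using card_local_covs[OF assms, of k] by (cases "card (local_covs d n G k) = 0") (auto simp: field_simps)

lemma is_random_cover_rcov:
  assumes "0 < d" "0 < n" "G \<in> reg_graphs d n"
  shows "is_random_cover d n G (rcov d n G)"
proof -
  interpret S: prob_space "seeds d n G" by (rule prob_space_seeds)
  have "prob_space (rcov d n G)" unfolding rcov_def by (rule S.prob_space_distr[OF measurable_rcov])
  then show ?thesis unfolding is_random_cover_def
    using prob_rcov[OF assms] inverse_card_local_covs[OF assms] by (auto simp: rcov_def)
qed

text \<open>Holds for every measure that meets the defining condition, so it yields the uniqueness
  of the random covering map as well as integrals against it.\<close>

lemma integral_is_random_cover:
  fixes F :: "(nat list \<Rightarrow> nat) \<Rightarrow> real"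
  assumes "0 < d" "0 < n" "G \<in> reg_graphs d n" and P: "is_random_cover d n G P"
  shows "(\<integral>\<psi>. F (restrict \<psi> (tb d k)) \<partial>P) = cov_weight d k / n * (\<Sum>\<tau>\<in>local_covs d n G k. F \<tau>)"
proof -
  let ?L = "local_covs d n G k"
  define cyl where "cyl = (\<lambda>\<tau>. {\<psi>\<in>space P. \<forall>v\<in>tb d k. \<psi> v = \<tau> v})"
  interpret prob_space P using P by (simp add: is_random_cover_def)
  have sets: "sets P = sets (PiM (tverts d) (\<lambda>_. count_space (UNIV :: nat set)))"
    and c: "\<And>\<tau>. \<tau> \<in> ?L \<Longrightarrow> prob (cyl \<tau>) = cov_weight d k / n"
    using P inverse_card_local_covs[OF assms(1-3)] by (auto simp: is_random_cover_def cyl_def)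
  have cyl: "cyl \<tau> \<in> events" for \<tau>
    unfolding cyl_def by (rule sets_cylinder[OF sets finite_tb tb_subset])
  have "prob (\<Union>\<tau>\<in>?L. cyl \<tau>) = card ?L * (cov_weight d k / n)"
    unfolding cyl_def by (rule measure_Union_cyl[OF prob_space_axioms sets c[unfolded cyl_def]])
  then have "prob (\<Union>\<tau>\<in>?L. cyl \<tau>) = 1"
    by (simp only: card_local_covs[OF assms(1-3)])
  then have AE: "AE \<psi> in P. \<psi> \<in> (\<Union>\<tau>\<in>?L. cyl \<tau>)"
    by (subst prob_eq_1[symmetric]) (use cyl finite_local_covs in auto)
  have meas: "(\<lambda>\<psi>. restrict \<psi> (tb d k)) \<in> measurable P (count_space (PiE (tb d k) (\<lambda>_. UNIV)))"
  proof (subst measurable_count_space_eq_countable)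
    show "countable (PiE (tb d k) (\<lambda>_. UNIV :: nat set))"
      by (rule countable_PiE) (auto simp: finite_tb)
    have "(\<lambda>\<psi>. restrict \<psi> (tb d k)) -` {a} \<inter> space P = cyl a" if "a \<in> PiE (tb d k) (\<lambda>_. UNIV)" for a
      using that by (auto simp: cyl_def fun_eq_iff PiE_iff extensional_def)
    then show "(\<lambda>\<psi>. restrict \<psi> (tb d k)) \<in> space P \<rightarrow> tb d k \<rightarrow>\<^sub>E UNIV \<and>
      (\<forall>a\<in>tb d k \<rightarrow>\<^sub>E UNIV. (\<lambda>\<psi>. restrict \<psi> (tb d k)) -` {a} \<inter> space P \<in> events)"
      using cyl by auto
  qed
  have "(\<integral>\<psi>. F (restrict \<psi> (tb d k)) \<partial>P) = (\<integral>\<psi>. (\<Sum>\<tau>\<in>?L. F \<tau> * indicator (cyl \<tau>) \<psi>) \<partial>P)"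
  proof (rule integral_cong_AE)
    show "(\<lambda>\<psi>. F (restrict \<psi> (tb d k))) \<in> borel_measurable P"
      by (rule measurable_compose[OF meas]) simp
    show "(\<lambda>\<psi>. \<Sum>\<tau>\<in>?L. F \<tau> * indicator (cyl \<tau>) \<psi>) \<in> borel_measurable P"
      using cyl by (intro borel_measurable_sum borel_measurable_times borel_measurable_indicator) auto
    show "AE \<psi> in P. F (restrict \<psi> (tb d k)) = (\<Sum>\<tau>\<in>?L. F \<tau> * indicator (cyl \<tau>) \<psi>)"
      using AE
    proof eventually_elim
      case (elim \<psi>)
      then obtain \<tau> where \<tau>: "\<tau> \<in> ?L" "\<psi> \<in> cyl \<tau>" by blast
      have "(\<Sum>\<tau>\<in>?L. F \<tau> * indicator (cyl \<tau>) \<psi>) = (\<Sum>\<tau>'\<in>?L. if \<tau>' = \<tau> then F \<tau>' else 0)"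
        using \<tau> cyl_disjoint[of \<tau> d n G k _ \<psi>] by (intro sum.cong) (auto simp: cyl_def indicator_def)
      also have "\<dots> = F \<tau>" using \<tau> by (simp add: finite_local_covs)
      also have "\<tau> = restrict \<psi> (tb d k)"
        using \<tau> by (auto simp: cyl_def local_covs_def fun_eq_iff PiE_iff extensional_def)
      finally show ?case by (rule sym)
    qed
  qed
  also have "\<dots> = (\<Sum>\<tau>\<in>?L. F \<tau> * prob (cyl \<tau>))"
    using cyl by (subst Bochner_Integration.integral_sum) (auto simp: emeasure_eq_measure)
  also have "\<dots> = cov_weight d k / n * (\<Sum>\<tau>\<in>?L. F \<tau>)"
    using c by (simp add: sum_distrib_left mult.commute)
  finally show ?thesis .
qed

lemma is_random_cover_unique:
  assumes "0 < d" "0 < n" "G \<in> reg_graphs d n" "is_random_cover d n G P" "is_random_cover d n G Q"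
  shows "P = Q"
proof (rule measure_eqI_PiM_infinite)
  interpret P: prob_space P using assms by (simp add: is_random_cover_def)
  interpret Q: prob_space Q using assms by (simp add: is_random_cover_def)
  let ?M = "PiM (tverts d) (\<lambda>_. count_space (UNIV :: nat set))"
  show P: "sets P = sets ?M" and Q: "sets Q = sets ?M"
    using assms by (auto simp: is_random_cover_def)
  show "finite_measure P" by (rule P.finite_measure_axioms)
  fix A :: "nat list \<Rightarrow> nat set" and J assume J: "finite J" "J \<subseteq> tverts d"
  let ?E = "prod_emb (tverts d) (\<lambda>_. count_space UNIV) J (PiE J A)"
  \<comment> \<open>A radius equal to the sum of the lengths is enough for every word of J.\<close>
  obtain k where k: "J \<subseteq> tb d k"
  proof
    show "J \<subseteq> tb d (\<Sum>x\<in>J. length x)"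
      using J by (auto simp: tball_root intro!: member_le_sum)
  qed
  define F :: "(nat list \<Rightarrow> nat) \<Rightarrow> real" where "F = (\<lambda>\<tau>. if \<forall>j\<in>J. \<tau> j \<in> A j then 1 else 0)"
  have E: "?E \<in> sets ?M" by (rule sets_PiM_I) (use J in auto)
  have *: "measure R ?E = (\<integral>\<psi>. F (restrict \<psi> (tb d k)) \<partial>R)" if R: "sets R = sets ?M" for R
  proof -
    have "(\<integral>\<psi>. F (restrict \<psi> (tb d k)) \<partial>R) = (\<integral>\<psi>. indicator ?E \<psi> \<partial>R)"
      using k J sets_eq_imp_space_eq[OF R]
      by (intro Bochner_Integration.integral_cong) (auto simp: F_def prod_emb_def space_PiM indicator_def subset_iff PiE_iff)
    then show ?thesis using E sets_eq_imp_space_eq[OF R] sets.sets_into_space[OF E]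
      by (simp add: Int_absorb2)
  qed
  have "measure P ?E = measure Q ?E"
    unfolding *[OF P] *[OF Q] integral_is_random_cover[OF assms(1-3,4)] integral_is_random_cover[OF assms(1-3,5)] ..
  then show "emeasure P ?E = emeasure Q ?E"
    by (simp add: P.emeasure_eq_measure Q.emeasure_eq_measure)
qed

text \<open>Existence and uniqueness together license the definite description behind
  \<open>random_cover\<close>.\<close>

lemma is_random_cover_random_cover:
  assumes "0 < d" "0 < n" "G \<in> reg_graphs d n"
  shows "is_random_cover d n G (random_cover d n G)"
  unfolding random_cover_def
  by (rule theI[of _ "rcov d n G"])
     (use is_random_cover_rcov[OF assms] is_random_cover_unique[OF assms] in blast)+

section \<open>Discretized processes\<close>

lemma cont_discretization_pmf:
  fixes \<phi> :: "'x::metric_space \<Rightarrow> 'f::finite pmf"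
  assumes "cont_discretization \<phi>"
  shows "continuous_on UNIV (\<lambda>x. pmf (\<phi> x) f)"
  unfolding continuous_on_iff
proof (intro ballI allI impI)
  fix x :: 'x and e :: real assume "0 < e"
  \<comment> \<open>The probability of one letter changes by at most the l1 distance, which is twice
    the total variation distance; hence the half.\<close>
  then obtain \<delta> where \<delta>: "\<delta> > 0" "\<And>y. dist y x < \<delta> \<Longrightarrow> tv_dist (\<phi> y) (\<phi> x) < e / 2"
    using assms unfolding cont_discretization_def by (meson half_gt_zero)
  show "\<exists>d>0. \<forall>x'\<in>UNIV. dist x' x < d \<longrightarrow> dist (pmf (\<phi> x') f) (pmf (\<phi> x) f) < e"
  proof (intro exI[of _ \<delta>] conjI ballI impI)
    fix y assume y: "dist y x < \<delta>"
    have "\<bar>pmf (\<phi> y) f - pmf (\<phi> x) f\<bar> \<le> (\<Sum>f\<in>UNIV. \<bar>pmf (\<phi> y) f - pmf (\<phi> x) f\<bar>)"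
      by (rule member_le_sum[of f UNIV "\<lambda>f. \<bar>pmf (\<phi> y) f - pmf (\<phi> x) f\<bar>"]) auto
    then show "dist (pmf (\<phi> y) f) (pmf (\<phi> x) f) < e"
      using \<delta>(2)[OF y] unfolding tv_dist_def dist_real_def by simp
  qed fact
qed

context
  fixes d :: nat and \<phi> :: "'x::metric_space \<Rightarrow> 'f::finite pmf" and \<mu> :: "(nat list \<Rightarrow> 'x) measure"
  assumes \<phi>: "cont_discretization \<phi>" and inv: "invariant_process d borel \<mu>"
begin


lemma prob_space_\<mu>: "prob_space \<mu>" and sets_\<mu>: "sets \<mu> = sets (PiM (tverts d) (\<lambda>_. borel :: 'x measure))"
  using inv by (auto simp: invariant_process_def)

lemma measurable_pmf_\<phi> [measurable]: "(\<lambda>x. pmf (\<phi> x) f) \<in> borel_measurable borel"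
  by (rule borel_measurable_continuous_onI[OF cont_discretization_pmf[OF \<phi>]])

lemma measurable_emeasure_\<phi> [measurable]: "(\<lambda>x. emeasure (measure_pmf (\<phi> x)) E) \<in> borel_measurable borel"
proof -
  have "emeasure (measure_pmf (\<phi> x)) E = ennreal (\<Sum>f\<in>E. pmf (\<phi> x) f)" for x
    by (simp add: measure_pmf.emeasure_eq_measure measure_measure_pmf_finite)
  then show ?thesis by simp
qed

lemma emeasure_kernel:
  assumes "finite J" "J \<subseteq> tverts d"
  shows "emeasure (PiM (tverts d) (\<lambda>v. measure_pmf (\<phi> (\<alpha> v)))) (prod_emb (tverts d) (\<lambda>_. count_space UNIV) J (PiE J E)) = (\<Prod>j\<in>J. emeasure (measure_pmf (\<phi> (\<alpha> j))) (E j))"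
proof -
  have "prod_emb (tverts d) (\<lambda>_. count_space UNIV) J (PiE J E) = prod_emb (tverts d) (\<lambda>v. measure_pmf (\<phi> (\<alpha> v))) J (PiE J E)"
    by (simp add: prod_emb_def)
  then show ?thesis
    using emeasure_PiM_emb[of "tverts d" "\<lambda>v. measure_pmf (\<phi> (\<alpha> v))" J E] assms
    by (simp add: prob_space_measure_pmf)
qed

lemma measurable_prod_kernel:
  assumes "finite J" "J \<subseteq> tverts d"
  shows "(\<lambda>\<alpha>. \<Prod>j\<in>J. emeasure (measure_pmf (\<phi> (\<alpha> j))) (E j)) \<in> borel_measurable (PiM (tverts d) (\<lambda>_. borel :: 'x measure))"
proof (rule borel_measurable_prod_ennreal)
  fix j assume "j \<in> J"
  then have "(\<lambda>\<alpha>. \<alpha> j) \<in> measurable (PiM (tverts d) (\<lambda>_. borel :: 'x measure)) borel" using assms by (intro measurable_component_singleton) auto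
  from measurable_compose[OF this measurable_emeasure_\<phi>]
  show "(\<lambda>\<alpha>. emeasure (measure_pmf (\<phi> (\<alpha> j))) (E j)) \<in> borel_measurable (PiM (tverts d) (\<lambda>_. borel :: 'x measure))" .
qed

text \<open>It suffices to test on the generating cylinders, where the product measure is a finite
  product of measurable functions of single coordinates.\<close>

lemma measurable_kernel: "(\<lambda>\<alpha>. PiM (tverts d) (\<lambda>v. measure_pmf (\<phi> (\<alpha> v)))) \<in> measurable (PiM (tverts d) (\<lambda>_. borel :: 'x measure)) (prob_algebra (PiM (tverts d) (\<lambda>_. count_space UNIV :: 'f measure)))"
proof (rule measurable_prob_algebra_generated[OF sets_PiM Int_stable_prod_algebra prod_algebra_sets_into_space])
  show "prob_space (PiM (tverts d) (\<lambda>v. measure_pmf (\<phi> (\<alpha> v))))" for \<alpha> by (rule prob_space_PiM) (rule prob_space_measure_pmf)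
  show "sets (PiM (tverts d) (\<lambda>v. measure_pmf (\<phi> (\<alpha> v)))) = sets (PiM (tverts d) (\<lambda>_. count_space UNIV :: 'f measure))" for \<alpha> by (rule sets_PiM_cong) auto
  fix A assume "A \<in> prod_algebra (tverts d) (\<lambda>_. count_space UNIV :: 'f measure)"
  then show "(\<lambda>\<alpha>. emeasure (PiM (tverts d) (\<lambda>v. measure_pmf (\<phi> (\<alpha> v)))) A) \<in> borel_measurable (PiM (tverts d) (\<lambda>_. borel :: 'x measure))"
    by (rule prod_algebraE) (simp add: emeasure_kernel measurable_prod_kernel)
qed

lemma \<mu>_prob_algebra: "\<mu> \<in> space (prob_algebra (PiM (tverts d) (\<lambda>_. borel :: 'x measure)))"
  using prob_space_\<mu> sets_\<mu> by (simp add: space_prob_algebra)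

lemma sets_discr: "sets (discr_conv d \<phi> \<mu>) = sets (PiM (tverts d) (\<lambda>_. count_space UNIV :: 'f measure))"
  unfolding discr_conv_def by (rule sets_bind'[OF \<mu>_prob_algebra measurable_kernel])

lemma space_discr: "space (discr_conv d \<phi> \<mu>) = space (PiM (tverts d) (\<lambda>_. count_space UNIV :: 'f measure))"
  by (rule sets_eq_imp_space_eq[OF sets_discr])

lemma prob_space_discr: "prob_space (discr_conv d \<phi> \<mu>)"
  unfolding discr_conv_def by (rule prob_space_bind'[OF \<mu>_prob_algebra measurable_kernel])

lemma emeasure_discr:
  assumes "finite J" "J \<subseteq> tverts d"
  shows "emeasure (discr_conv d \<phi> \<mu>) (prod_emb (tverts d) (\<lambda>_. count_space UNIV) J (PiE J E)) =
    (\<integral>\<^sup>+\<alpha>. (\<Prod>j\<in>J. emeasure (measure_pmf (\<phi> (\<alpha> j))) (E j)) \<partial>\<mu>)"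
  unfolding discr_conv_def
  by (subst emeasure_bind_prob_algebra[OF \<mu>_prob_algebra measurable_kernel])
     (use assms in \<open>auto simp: emeasure_kernel intro!: sets_PiM_I\<close>)

lemma measure_discr:
  assumes "finite J" "J \<subseteq> tverts d"
  shows "measure (discr_conv d \<phi> \<mu>) {\<beta>\<in>space (discr_conv d \<phi> \<mu>). \<forall>v\<in>J. \<beta> v = c v} =
    (\<integral>\<alpha>. (\<Prod>j\<in>J. pmf (\<phi> (\<alpha> j)) (c j)) \<partial>\<mu>)"
proof -
  have "{\<beta>\<in>space (discr_conv d \<phi> \<mu>). \<forall>v\<in>J. \<beta> v = c v} = prod_emb (tverts d) (\<lambda>_. count_space UNIV) J (PiE J (\<lambda>v. {c v}))"
    using assms by (auto simp: space_discr prod_emb_def space_PiM PiE_iff dest: extensional_arb)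
  then have "emeasure (discr_conv d \<phi> \<mu>) {\<beta>\<in>space (discr_conv d \<phi> \<mu>). \<forall>v\<in>J. \<beta> v = c v}
    = (\<integral>\<^sup>+\<alpha>. (\<Prod>j\<in>J. emeasure (measure_pmf (\<phi> (\<alpha> j))) {c j}) \<partial>\<mu>)"
    using emeasure_discr[OF assms] by simp
  also have "\<dots> = (\<integral>\<^sup>+\<alpha>. ennreal (\<Prod>j\<in>J. pmf (\<phi> (\<alpha> j)) (c j)) \<partial>\<mu>)"
    by (simp add: emeasure_pmf_single prod_ennreal)
  finally show ?thesis
    by (subst integral_eq_nn_integral)
       (auto simp: measure_def prod_nonneg assms intro!: borel_measurable_prod measurable_compose[OF _ measurable_pmf_\<phi>]
          measurable_component_singleton simp: measurable_cong_sets[OF sets_\<mu> refl] subsetD[OF assms(2)])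
qed

text \<open>Both measures are compared on cylinders. Pulling a cylinder over J back along \<sigma>
  gives one over the image of J, whose probability given \<alpha> is that of the original cylinder
  given \<alpha> composed with \<sigma>; this leaves the invariance of \<mu>.\<close>

lemma invariant_discr: "invariant_process d (count_space UNIV) (discr_conv d \<phi> \<mu>)"
  unfolding invariant_process_def
proof (intro conjI allI impI prob_space_discr sets_discr)
  fix \<sigma> assume \<sigma>: "tree_aut d \<sigma>"
  let ?\<nu> = "discr_conv d \<phi> \<mu>"
  interpret \<nu>: prob_space ?\<nu> by (rule prob_space_discr)
  have bij: "bij_betw \<sigma> (tverts d) (tverts d)" using \<sigma> by (simp add: tree_aut_def)
  then have \<sigma>T: "\<sigma> v \<in> tverts d" if "v \<in> tverts d" for v using that by (auto simp: bij_betw_def)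
  have m: "(\<lambda>\<alpha>. restrict (\<alpha> \<circ> \<sigma>) (tverts d)) \<in> measurable (PiM (tverts d) (\<lambda>_. L)) (PiM (tverts d) (\<lambda>_. L))" for L :: "'z measure"
    unfolding comp_def by (rule measurable_restrict) (rule measurable_component_singleton, rule \<sigma>T)
  have m\<nu>: "(\<lambda>\<alpha>. restrict (\<alpha> \<circ> \<sigma>) (tverts d)) \<in> measurable ?\<nu> ?\<nu>"
    unfolding measurable_cong_sets[OF sets_discr sets_discr] by (rule m)
  have m\<mu>: "(\<lambda>\<alpha>. restrict (\<alpha> \<circ> \<sigma>) (tverts d)) \<in> measurable \<mu> \<mu>"
    unfolding measurable_cong_sets[OF sets_\<mu> sets_\<mu>] by (rule m)
  show "distr ?\<nu> ?\<nu> (\<lambda>\<alpha>. restrict (\<alpha> \<circ> \<sigma>) (tverts d)) = ?\<nu>"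
  proof (rule measure_eqI_PiM_infinite)
    show "sets (distr ?\<nu> ?\<nu> (\<lambda>\<alpha>. restrict (\<alpha> \<circ> \<sigma>) (tverts d))) = sets (PiM (tverts d) (\<lambda>_. count_space UNIV :: 'f measure))" "sets ?\<nu> = sets (PiM (tverts d) (\<lambda>_. count_space UNIV :: 'f measure))"
      by (simp_all add: sets_discr)
    show "finite_measure (distr ?\<nu> ?\<nu> (\<lambda>\<alpha>. restrict (\<alpha> \<circ> \<sigma>) (tverts d)))"
      by (rule \<nu>.finite_measure_distr[OF m\<nu>])
    fix A :: "nat list \<Rightarrow> 'f set" and J assume J: "finite J" "J \<subseteq> tverts d"
    let ?E = "prod_emb (tverts d) (\<lambda>_. count_space UNIV) J (PiE J A)"
    define \<tau> where "\<tau> = the_inv_into (tverts d) \<sigma>"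
    have inj: "inj_on \<sigma> J" using bij J by (auto simp: bij_betw_def inj_on_subset)
    have \<tau>: "\<tau> (\<sigma> v) = v" if "v \<in> J" for v
      unfolding \<tau>_def using bij that J by (intro the_inv_into_f_f) (auto simp: bij_betw_def)
    have J': "finite (\<sigma> ` J)" "\<sigma> ` J \<subseteq> tverts d" using J \<sigma>T by auto
    have E: "?E \<in> sets ?\<nu>" unfolding sets_discr by (rule sets_PiM_I) (use J in auto)
    have "emeasure (distr ?\<nu> ?\<nu> (\<lambda>\<alpha>. restrict (\<alpha> \<circ> \<sigma>) (tverts d))) ?E
        = emeasure ?\<nu> ((\<lambda>\<alpha>. restrict (\<alpha> \<circ> \<sigma>) (tverts d)) -` ?E \<inter> space ?\<nu>)"
      by (rule emeasure_distr[OF m\<nu> E])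
    also have "(\<lambda>\<alpha>. restrict (\<alpha> \<circ> \<sigma>) (tverts d)) -` ?E \<inter> space ?\<nu>
       = prod_emb (tverts d) (\<lambda>_. count_space UNIV) (\<sigma> ` J) (PiE (\<sigma> ` J) (A \<circ> \<tau>))"
      using J \<tau> by (auto simp: space_discr prod_emb_def space_PiM PiE_iff subset_iff)
    also have "emeasure ?\<nu> \<dots> = (\<integral>\<^sup>+\<alpha>. (\<Prod>j\<in>\<sigma> ` J. emeasure (measure_pmf (\<phi> (\<alpha> j))) ((A \<circ> \<tau>) j)) \<partial>\<mu>)"
      by (rule emeasure_discr[OF J'])
    also have "\<dots> = (\<integral>\<^sup>+\<alpha>. (\<Prod>j\<in>J. emeasure (measure_pmf (\<phi> (restrict (\<alpha> \<circ> \<sigma>) (tverts d) j))) (A j)) \<partial>\<mu>)"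
      using inj \<tau> J by (intro nn_integral_cong) (auto simp: prod.reindex intro!: prod.cong)
    also have "\<dots> = (\<integral>\<^sup>+\<alpha>. (\<Prod>j\<in>J. emeasure (measure_pmf (\<phi> (\<alpha> j))) (A j)) \<partial>distr \<mu> \<mu> (\<lambda>\<alpha>. restrict (\<alpha> \<circ> \<sigma>) (tverts d)))"
      by (rule nn_integral_distr[symmetric, OF m\<mu>])
         (simp add: measurable_cong_sets[OF sets_\<mu> refl] measurable_prod_kernel[OF J])
    also have "distr \<mu> \<mu> (\<lambda>\<alpha>. restrict (\<alpha> \<circ> \<sigma>) (tverts d)) = \<mu>"
      using inv \<sigma> by (simp add: invariant_process_def)
    also have "(\<integral>\<^sup>+\<alpha>. (\<Prod>j\<in>J. emeasure (measure_pmf (\<phi> (\<alpha> j))) (A j)) \<partial>\<mu>) = emeasure ?\<nu> ?E"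
      by (rule emeasure_discr[OF J, symmetric])
    finally show "emeasure (distr ?\<nu> ?\<nu> (\<lambda>\<alpha>. restrict (\<alpha> \<circ> \<sigma>) (tverts d))) ?E = emeasure ?\<nu> ?E" .
  qed
qed

end

section \<open>Matchings that respect edge types\<close>

text \<open>Perfect matchings as fixed-point-free involutions; \<open>num_matchings N\<close> is (N - 1)!!, and 0 for odd N.\<close>

definition matchings :: "'a set \<Rightarrow> ('a \<Rightarrow> 'a) set" where
  "matchings H = {\<sigma> \<in> extensional H. \<forall>h\<in>H. \<sigma> h \<in> H \<and> \<sigma> h \<noteq> h \<and> \<sigma> (\<sigma> h) = h}"

fun num_matchings :: "nat \<Rightarrow> nat" where
  "num_matchings 0 = 1"
| "num_matchings (Suc 0) = 0"
| "num_matchings (Suc (Suc n)) = Suc n * num_matchings n"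

lemma matchingsD:
  assumes "\<sigma> \<in> matchings H" "h \<in> H"
  shows "\<sigma> h \<in> H" "\<sigma> h \<noteq> h" "\<sigma> (\<sigma> h) = h"
  using assms by (auto simp: matchings_def)

lemma finite_matchings: "finite H \<Longrightarrow> finite (matchings H)"
  by (rule finite_subset[of _ "PiE H (\<lambda>_. H)"]) (auto simp: matchings_def PiE_def finite_PiE[unfolded PiE_def])

lemma matchings_remove_pair:
  assumes "h \<in> H" "h' \<in> H" "h \<noteq> h'"
  shows "bij_betw (\<lambda>\<sigma>. restrict \<sigma> (H - {h, h'})) {\<sigma> \<in> matchings H. \<sigma> h = h'} (matchings (H - {h, h'}))"
proof (rule bij_betw_byWitness[where f' = "\<lambda>\<sigma>. \<sigma>(h := h', h' := h)"])
  show "\<forall>\<sigma>\<in>{\<sigma> \<in> matchings H. \<sigma> h = h'}. (restrict \<sigma> (H - {h, h'}))(h := h', h' := h) = \<sigma>"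
  proof
    fix \<sigma> assume "\<sigma> \<in> {\<sigma> \<in> matchings H. \<sigma> h = h'}"
    then have "\<sigma> \<in> matchings H" "\<sigma> h = h'" by auto
    then have "\<sigma> h' = h" using assms matchingsD(3) by metis
    then show "(restrict \<sigma> (H - {h, h'}))(h := h', h' := h) = \<sigma>"
      using \<open>\<sigma> \<in> matchings H\<close> \<open>\<sigma> h = h'\<close> by (auto simp: fun_eq_iff matchings_def extensional_def)
  qed
  show "\<forall>\<sigma>\<in>matchings (H - {h, h'}). restrict (\<sigma>(h := h', h' := h)) (H - {h, h'}) = \<sigma>"
    by (auto simp: fun_eq_iff matchings_def extensional_def)
  show "(\<lambda>\<sigma>. restrict \<sigma> (H - {h, h'})) ` {\<sigma> \<in> matchings H. \<sigma> h = h'} \<subseteq> matchings (H - {h, h'})"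
  proof safe
    fix \<sigma> assume \<sigma>: "\<sigma> \<in> matchings H" "h' = \<sigma> h"
    then have "\<sigma> (\<sigma> h) = h" using assms matchingsD(3) by metis
    moreover have "\<sigma> x \<noteq> h" "\<sigma> x \<noteq> \<sigma> h" if "x \<in> H" "x \<noteq> h" "x \<noteq> \<sigma> h" for x
      using that \<sigma> assms matchingsD(3)[of \<sigma> H] by metis+
    ultimately show "restrict \<sigma> (H - {h, \<sigma> h}) \<in> matchings (H - {h, \<sigma> h})"
      using \<sigma> by (auto simp: matchings_def)
  qed
  show "(\<lambda>\<sigma>. \<sigma>(h := h', h' := h)) ` matchings (H - {h, h'}) \<subseteq> {\<sigma> \<in> matchings H. \<sigma> h = h'}"
  proof (intro image_subsetI)
    fix \<sigma> assume \<sigma>: "\<sigma> \<in> matchings (H - {h, h'})"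
    let ?\<sigma> = "\<sigma>(h := h', h' := h)"
    have "?\<sigma> x \<in> H \<and> ?\<sigma> x \<noteq> x \<and> ?\<sigma> (?\<sigma> x) = x" if "x \<in> H" for x
    proof (cases "x \<in> {h, h'}")
      case True
      then show ?thesis using assms by auto
    next
      case False
      then have "x \<in> H - {h, h'}" using that by simp
      from matchingsD[OF \<sigma> this] False show ?thesis by auto
    qed
    moreover have "?\<sigma> \<in> extensional H" using \<sigma> assms by (auto simp: matchings_def extensional_def)
    moreover have "?\<sigma> h = h'" using assms by simp
    ultimately show "?\<sigma> \<in> {\<sigma> \<in> matchings H. \<sigma> h = h'}" unfolding matchings_def by blast
  qed
qed

lemma card_matchings_pair:
  assumes "h \<in> H" "h' \<in> H" "h \<noteq> h'"
  shows "card {\<sigma> \<in> matchings H. \<sigma> h = h'} = card (matchings (H - {h, h'}))"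
  by (rule bij_betw_same_card[OF matchings_remove_pair[OF assms]])

text \<open>Classify by the partner of one fixed point; removing the pair leaves a matching on two
  points fewer.\<close>

lemma card_matchings: "finite H \<Longrightarrow> card (matchings H) = num_matchings (card H)"
proof (induction "card H" arbitrary: H rule: num_matchings.induct)
  case 1
  then have "H = {}" by simp
  then have "matchings H = {\<lambda>_. undefined}" by (auto simp: matchings_def)
  then show ?case using \<open>H = {}\<close> by simp
next
  case 2
  then obtain h where "H = {h}" by (metis card_1_singletonE One_nat_def)
  then have "matchings H = {}" by (auto simp: matchings_def)
  then show ?case using \<open>H = {h}\<close> by simp
next
  case (3 n)
  then obtain h where h: "h \<in> H" by fastforce
  have fin: "finite H" by fact
  have "matchings H = (\<Union>h'\<in>H - {h}. {\<sigma> \<in> matchings H. \<sigma> h = h'})"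
    using h by (auto simp: matchings_def)
  also have "card \<dots> = (\<Sum>h'\<in>H - {h}. card {\<sigma> \<in> matchings H. \<sigma> h = h'})"
    by (rule card_UN_disjoint) (use fin finite_matchings[OF fin] in auto)
  also have "\<dots> = (\<Sum>h'\<in>H - {h}. num_matchings n)"
  proof (rule sum.cong)
    fix h' assume h': "h' \<in> H - {h}"
    have "card {h, h'} = 2" using h' by auto
    then have "card (H - {h, h'}) = n" using h h' 3(2)[symmetric] fin by (simp add: card_Diff_subset)
    then show "card {\<sigma> \<in> matchings H. \<sigma> h = h'} = num_matchings n"
      using 3(1)[of "H - {h, h'}"] h h' fin card_matchings_pair[of h H h'] by auto
  qed simp
  also have "\<dots> = Suc n * num_matchings n" using h 3(2)[symmetric] fin by (simp add: card_Diff_subset)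
  finally show ?case using 3(2) by (metis num_matchings.simps(3))
qed

text \<open>For even N one has N! = N!! (N-1)!! and N!! <= (N+1)!! = (N+1) (N-1)!!. This trades the
  factorial of Stirling's formula for the number of matchings at a polynomial cost.\<close>

lemma fact_le_num_matchings: "even N \<Longrightarrow> fact N \<le> (num_matchings N)\<^sup>2 * Suc N"
proof (induction N rule: num_matchings.induct)
  case (3 n)
  then have IH: "fact n \<le> (num_matchings n)\<^sup>2 * Suc n" by simp
  have "(fact (Suc (Suc n)) :: nat) = (n + 2) * (n + 1) * fact n" by (simp add: algebra_simps)
  also have "\<dots> \<le> (n + 3) * (n + 1) * ((num_matchings n)\<^sup>2 * Suc n)"
    by (rule mult_mono[OF _ IH]) (auto simp: algebra_simps)
  also have "\<dots> = (num_matchings (Suc (Suc n)))\<^sup>2 * Suc (Suc (Suc n))"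
    by (simp add: power2_eq_square algebra_simps)
  finally show ?case .
qed auto

definition typed_matchings :: "('a \<Rightarrow> 'e) \<Rightarrow> ('e \<Rightarrow> 'e) \<Rightarrow> 'a set \<Rightarrow> ('a \<Rightarrow> 'a) set" where
  "typed_matchings t r H = {\<sigma> \<in> matchings H. \<forall>h\<in>H. t (\<sigma> h) = r (t h)}"

lemma typed_matchings_remove_pair:
  assumes "h \<in> H" "h' \<in> H" "h \<noteq> h'" "finite H"
  shows "card {\<sigma> \<in> typed_matchings t r H. \<sigma> h = h'} \<le> card (typed_matchings t r (H - {h, h'}))"
proof (rule card_inj_on_le[where f = "\<lambda>\<sigma>. restrict \<sigma> (H - {h, h'})"])
  show "inj_on (\<lambda>\<sigma>. restrict \<sigma> (H - {h, h'})) {\<sigma> \<in> typed_matchings t r H. \<sigma> h = h'}"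
    by (rule inj_on_subset[OF bij_betw_imp_inj_on[OF matchings_remove_pair[OF assms(1-3)]]]) (auto simp: typed_matchings_def)
  show "(\<lambda>\<sigma>. restrict \<sigma> (H - {h, h'})) ` {\<sigma> \<in> typed_matchings t r H. \<sigma> h = h'} \<subseteq> typed_matchings t r (H - {h, h'})"
  proof (intro image_subsetI)
    fix \<sigma> assume \<sigma>: "\<sigma> \<in> {\<sigma> \<in> typed_matchings t r H. \<sigma> h = h'}"
    then have *: "restrict \<sigma> (H - {h, h'}) \<in> matchings (H - {h, h'})"
      using bij_betwE[OF matchings_remove_pair[OF assms(1-3)]] by (simp add: typed_matchings_def)
    have "\<forall>x\<in>H - {h, h'}. t (\<sigma> x) = r (t x)" using \<sigma> by (simp add: typed_matchings_def)
    then show "restrict \<sigma> (H - {h, h'}) \<in> typed_matchings t r (H - {h, h'})"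
      using * matchingsD(1)[OF *] unfolding typed_matchings_def by (auto simp: restrict_def)
  qed
  show "finite (typed_matchings t r (H - {h, h'}))"
    using finite_matchings[of "H - {h, h'}"] assms(4) by (simp add: typed_matchings_def)
qed

text \<open>The matching itself exchanges the two classes.\<close>

lemma typed_matchings_class_card:
  assumes "finite H" "\<sigma> \<in> typed_matchings t r H" "\<And>e. r (r e) = e"
  shows "card {h \<in> H. t h = r e} = card {h \<in> H. t h = e}"
proof -
  have "bij_betw \<sigma> {h \<in> H. t h = r e} {h \<in> H. t h = e}"
    by (rule bij_betw_byWitness[where f' = \<sigma>]) (use assms in \<open>auto simp: typed_matchings_def matchings_def\<close>)
  then show ?thesis by (rule bij_betw_same_card)
qed

text \<open>A class e of size m and a different class \<open>r e\<close> are matched by one of at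
  most m! bijections, a class with \<open>r e = e\<close> by one of at most (m-1)!! matchings.
  Squaring makes both fit one product over all classes, without choosing representatives of the
  pairs {e, r e}. The induction removes one point with its partner.\<close>

lemma card_typed_matchings_le:
  fixes t :: "'a \<Rightarrow> 'e"
  assumes r: "\<And>e. r (r e) = e" and "finite E"
  shows "finite H \<Longrightarrow> t ` H \<subseteq> E \<Longrightarrow> (card (typed_matchings t r H))\<^sup>2 \<le> (\<Prod>e\<in>E. fact (card {h \<in> H. t h = e}))"
proof (induction "card H" arbitrary: H rule: less_induct)
  case less
  have fin: "finite H" by fact
  define m where "m = (\<lambda>H e. card {h \<in> H. t h = e})"
  show ?case
  proof (cases "typed_matchings t r H = {}")
    case True
    then show ?thesis by simp
  next
    case False
    then obtain \<sigma>0 where \<sigma>0: "\<sigma>0 \<in> typed_matchings t r H" by blast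
    show ?thesis
    proof (cases "H = {}")
      case True
      then have "typed_matchings t r H = {\<lambda>_. undefined}" by (auto simp: typed_matchings_def matchings_def)
      then show ?thesis using True by simp
    next
      case False
      then obtain h where h: "h \<in> H" by blast
      define e where "e = t h"
      define C where "C = {h' \<in> H - {h}. t h' = r e}"
      have finC: "finite C" using fin by (simp add: C_def)
      \<comment> \<open>The right-hand side for H without h and its partner: both come from class e
        if \<open>r e = e\<close>, otherwise one each from e and \<open>r e\<close>.\<close>
      define B where "B = (\<Prod>f\<in>E. if f = e then (if r e = e then fact (m H e - 2) else fact (m H e - 1))
         else if f = r e then fact (m H f - 1) else fact (m H f) :: nat)"
      have me: "m H (r e) = m H e" unfolding m_def by (rule typed_matchings_class_card[OF fin \<sigma>0 r])
      have bound: "(card {\<sigma> \<in> typed_matchings t r H. \<sigma> h = h'})\<^sup>2 \<le> B" if h': "h' \<in> C" for h'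
      proof -
        have hh: "h' \<in> H" "h \<noteq> h'" "t h' = r e" using h' by (auto simp: C_def)
        let ?H = "H - {h, h'}"
        have "(card {\<sigma> \<in> typed_matchings t r H. \<sigma> h = h'})\<^sup>2 \<le> (card (typed_matchings t r ?H))\<^sup>2"
          using typed_matchings_remove_pair[OF h hh(1,2) fin] by (rule power_mono) simp
        also have "\<dots> \<le> (\<Prod>f\<in>E. fact (card {x \<in> ?H. t x = f}))"
        proof (rule less.hyps)
          show "card ?H < card H" by (rule psubset_card_mono[OF fin]) (use h in auto)
        qed (use fin less.prems in auto)
        also have "\<dots> = B" unfolding B_def
        proof (rule prod.cong)
          fix f assume "f \<in> E"
          have "{x \<in> ?H. t x = f} = {x \<in> H. t x = f} - (if f = e then (if r e = e then {h, h'} else {h})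
              else if f = r e then {h'} else {})"
            using hh by (auto simp: e_def)
          then have "card {x \<in> ?H. t x = f} = m H f - card (if f = e then (if r e = e then {h, h'} else {h})
              else if f = r e then {h'} else {})"
            unfolding m_def by (simp only:) (rule card_Diff_subset, use h hh in \<open>auto simp: e_def\<close>)
          then show "fact (card {x \<in> ?H. t x = f}) = (if f = e then (if r e = e then fact (m H e - 2) else fact (m H e - 1))
             else if f = r e then fact (m H f - 1) else fact (m H f) :: nat)"
            using hh by (auto simp: numeral_2_eq_2)
        qed simp
        finally show ?thesis .
      qed
      have "typed_matchings t r H = (\<Union>h'\<in>C. {\<sigma> \<in> typed_matchings t r H. \<sigma> h = h'})"
        using h by (auto simp: C_def typed_matchings_def matchings_def e_def)
      then have "card (typed_matchings t r H) = card (\<Union>h'\<in>C. {\<sigma> \<in> typed_matchings t r H. \<sigma> h = h'})" by simp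
      also have "\<dots> = (\<Sum>h'\<in>C. card {\<sigma> \<in> typed_matchings t r H. \<sigma> h = h'})"
        by (rule card_UN_disjoint) (use finC finite_matchings[OF fin] in \<open>auto simp: typed_matchings_def\<close>)
      finally have "real (card (typed_matchings t r H)) = (\<Sum>h'\<in>C. real (card {\<sigma> \<in> typed_matchings t r H. \<sigma> h = h'}))"
        by simp
      \<comment> \<open>Cauchy-Schwarz over the partners of h; with the bound B for each partner the
        square is at most |C|^2 B.\<close>
      then have "(real (card (typed_matchings t r H)))\<^sup>2 \<le> (\<Sum>h'\<in>C. (real (card {\<sigma> \<in> typed_matchings t r H. \<sigma> h = h'}))\<^sup>2) * card C"
        using sum_squared_le_sum_of_squares[of "\<lambda>h'. real (card {\<sigma> \<in> typed_matchings t r H. \<sigma> h = h'})" C] by simp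
      also have "\<dots> \<le> (\<Sum>h'\<in>C. real B) * card C"
        by (intro mult_right_mono sum_mono) (use bound in \<open>auto simp flip: of_nat_power\<close>)
      also have "\<dots> = real (card C * card C * B)" by simp
      \<comment> \<open>If \<open>r e = e\<close> there are m - 1 partners and (m-1)^2 (m-2)! <= m!;
        otherwise there are m of them, and m^2 (m-1)!^2 = m!^2.\<close>
      also have "card C * card C * B \<le> (\<Prod>f\<in>E. fact (m H f))"
      proof (cases "r e = e")
        case True
        have eE: "e \<in> E" using less.prems h by (auto simp: e_def)
        have "C = {x \<in> H. t x = e} - {h}" using True by (auto simp: C_def)
        then have cC: "card C = m H e - 1" using h by (simp add: m_def e_def)
        have "B = fact (m H e - 2) * (\<Prod>f\<in>E - {e}. fact (m H f))"
          unfolding B_def using eE assms(2) True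
          by (subst prod.remove[of _ e]) (auto intro!: prod.cong)
        moreover have "(\<Prod>f\<in>E. fact (m H f)) = fact (m H e) * (\<Prod>f\<in>E - {e}. fact (m H f) :: nat)"
          using eE assms(2) by (subst prod.remove[of _ e]) auto
        moreover have "card C * card C * fact (m H e - 2) \<le> (fact (m H e) :: nat)"
        proof (cases "m H e \<le> 1")
          case True
          then show ?thesis by (simp add: cC)
        next
          case False
          then obtain j where j: "m H e = Suc (Suc j)" by (metis One_nat_def not0_implies_Suc not_less_eq_eq le0)
          show ?thesis unfolding cC j by (simp add: algebra_simps)
        qed
        ultimately show ?thesis by (simp add: mult.assoc[symmetric])
      next
        case False
        have eE: "e \<in> E" using less.prems h by (auto simp: e_def)
        have "C = {x \<in> H. t x = r e}" using False by (auto simp: C_def e_def)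
        then have cC: "card C = m H e" using me by (simp add: m_def)
        have pos: "m H e \<noteq> 0" using h fin by (auto simp: m_def e_def)
        show ?thesis
        proof (cases "C = {}")
          case True
          then show ?thesis by simp
        next
          case False
          then have reE: "r e \<in> E" using less.prems by (auto simp: C_def)
          have neq: "r e \<noteq> e" by fact
          have "B = fact (m H e - 1) * (fact (m H e - 1) * (\<Prod>f\<in>E - {e} - {r e}. fact (m H f)))"
            unfolding B_def using eE reE assms(2) neq me
            by (subst prod.remove[of _ e], simp, simp, subst prod.remove[of _ "r e"]) (auto intro!: prod.cong)
          moreover have "(\<Prod>f\<in>E. fact (m H f)) = fact (m H e) * (fact (m H e) * (\<Prod>f\<in>E - {e} - {r e}. fact (m H f) :: nat))"
            using eE reE assms(2) neq me
            by (subst prod.remove[of _ e], simp, simp, subst prod.remove[of _ "r e"]) auto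
          moreover obtain j where j: "m H e = Suc j" using pos by (cases "m H e") auto
          ultimately show ?thesis unfolding cC j by (simp add: algebra_simps)
        qed
      qed
      finally have "real ((card (typed_matchings t r H))\<^sup>2) \<le> real (\<Prod>f\<in>E. fact (m H f))" by (simp del: of_nat_prod)
      then show ?thesis unfolding m_def by (simp only: of_nat_le_iff)
    qed
  qed
qed

text \<open>Expand the power as a sum over all maps from V to A: each map with the prescribed counts
  contributes the same product. This is the entropy bound for a multinomial coefficient, free of
  factorials.\<close>

lemma multinomial_le:
  fixes c :: "'t \<Rightarrow> nat"
  assumes "finite V" "finite A"
  shows "card {L \<in> PiE V (\<lambda>_. A). \<forall>a\<in>A. card {v \<in> V. L v = a} = c a} * (\<Prod>a\<in>A. c a ^ c a) \<le> (\<Sum>a\<in>A. c a) ^ card V"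
proof -
  let ?S = "{L \<in> PiE V (\<lambda>_. A). \<forall>a\<in>A. card {v \<in> V. L v = a} = c a}"
  have "(\<Sum>a\<in>A. c a) ^ card V = (\<Prod>v\<in>V. \<Sum>a\<in>A. c a)" by simp
  also have "\<dots> = (\<Sum>L\<in>PiE V (\<lambda>_. A). \<Prod>v\<in>V. c (L v))"
    using assms by (intro prod_sum_PiE) auto
  also have "\<dots> \<ge> (\<Sum>L\<in>?S. \<Prod>v\<in>V. c (L v))"
    by (rule sum_mono2) (use assms in \<open>auto simp: finite_PiE\<close>)
  also have "(\<Sum>L\<in>?S. \<Prod>v\<in>V. c (L v)) = (\<Sum>L\<in>?S. \<Prod>a\<in>A. c a ^ c a)"
  proof (rule sum.cong)
    fix L assume L: "L \<in> ?S"
    have "(\<Prod>v\<in>V. c (L v)) = (\<Prod>a\<in>A. \<Prod>v\<in>{v \<in> V. L v = a}. c (L v))"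
      by (rule prod.group[symmetric]) (use assms L in auto)
    also have "\<dots> = (\<Prod>a\<in>A. c a ^ c a)"
      using L by (intro prod.cong) auto
    finally show "(\<Prod>v\<in>V. c (L v)) = (\<Prod>a\<in>A. c a ^ c a)" .
  qed simp
  finally show ?thesis by simp
qed

text \<open>The induction rests on e <= (1 + 1/k)^(k+1). The factor k + 1 in place of k admits k =
  0.\<close>

lemma fact_upper: "real (fact k) \<le> exp 1 * (real k + 1) * (real k ^ k * exp (- real k))"
proof (cases k)
  case 0
  then show ?thesis by simp
next
  case (Suc j)
  have "real (fact k) \<le> exp 1 * k * (real k ^ k * exp (- real k))" if "k \<ge> 1" for k
    using that
  proof (induction k rule: dec_induct)
    case base
    then show ?case by (simp add: exp_minus)
  next
    case (step k)
    have k: "real k > 0" using step by simp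
    have "1 / real (Suc k) \<le> - ln (real k / real (Suc k))"
      using ln_le_minus_one[of "real k / real (Suc k)"] k by (simp add: field_simps)
    then have "1 \<le> real (Suc k) * ln (real (Suc k) / real k)"
      using k by (simp add: ln_div field_simps)
    then have "exp 1 \<le> exp (real (Suc k) * ln (real (Suc k) / real k))" by simp
    also have "\<dots> = (real (Suc k) / real k) ^ Suc k"
      using k by (simp only: exp_of_nat_mult) (simp add: exp_ln)
    finally have *: "exp 1 * real k ^ Suc k \<le> real (Suc k) ^ Suc k"
      using k by (simp add: power_divide field_simps)
    have "real (fact (Suc k)) = real (Suc k) * fact k" by (simp add: algebra_simps)
    also have "\<dots> \<le> real (Suc k) * (exp 1 * k * (real k ^ k * exp (- real k)))"
      using step.IH by (intro mult_left_mono) auto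
    also have "\<dots> = exp 1 * real (Suc k) * (exp 1 * real k ^ Suc k) * exp (- real (Suc k))"
      by (simp add: exp_diff exp_minus field_simps)
    also have "\<dots> \<le> exp 1 * real (Suc k) * (real (Suc k) ^ Suc k) * exp (- real (Suc k))"
      using * by (intro mult_right_mono mult_left_mono) auto
    finally show ?case by (simp add: mult.assoc)
  qed
  from this[of k] Suc have "real (fact k) \<le> exp 1 * k * (real k ^ k * exp (- real k))" by simp
  also have "\<dots> \<le> exp 1 * (k + 1) * (real k ^ k * exp (- real k))"
    by (intro mult_right_mono) auto
  finally show ?thesis by (simp add: add.commute)
qed

text \<open>Here the induction rests on (1 + 1/k)^k <= e.\<close>

lemma fact_lower: "real k ^ k * exp (- real k) \<le> fact k"
proof (induction k)
  case (Suc k)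
  show ?case
  proof (cases "k = 0")
    case False
    then have k: "real k > 0" by simp
    have "(1 + 1 / real k) ^ k \<le> exp (1 / real k) ^ k"
      using k exp_ge_add_one_self[of "1 / real k"] by (intro power_mono) auto
    also have "\<dots> = exp 1" using k by (simp add: exp_of_nat_mult[symmetric])
    finally have "real (Suc k) ^ k \<le> exp 1 * real k ^ k"
      using k by (simp add: field_simps power_divide)
    then have "real (Suc k) ^ Suc k * exp (- real (Suc k)) \<le> real (Suc k) * (exp 1 * real k ^ k) * exp (- real (Suc k))"
      by (intro mult_right_mono) (auto intro!: mult_left_mono)
    also have "\<dots> = real (Suc k) * (real k ^ k * exp (- real k))"
      by (simp add: exp_diff exp_minus field_simps)
    also have "\<dots> \<le> real (Suc k) * fact k" using Suc by (intro mult_left_mono) auto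
    finally show ?thesis by simp
  qed simp
qed simp

section \<open>From counts to entropies\<close>

definition ent :: "'a set \<Rightarrow> ('a \<Rightarrow> real) \<Rightarrow> real" where
  "ent A p = - (\<Sum>x\<in>A. p x * ln (p x))"

lemma power_eq_exp_xlnx: "real k ^ k = exp (k * ln k)"
  by (cases "k = 0") (simp_all add: exp_of_nat_mult)

lemma prod_power_eq_exp_ent:
  fixes c :: "'a \<Rightarrow> nat"
  assumes "0 < N" "(\<Sum>a\<in>A. c a) = N"
  shows "(\<Prod>a\<in>A. real (c a) ^ c a) = real N ^ N * exp (- (N * ent A (\<lambda>a. c a / N)))"
proof (cases "finite A")
  case True
  have "c a * ln (c a) = c a * ln N + N * (c a / N * ln (c a / N))" if "a \<in> A" for a
    using assms(1) by (cases "c a = 0") (simp_all add: ln_div field_simps)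
  then have "(\<Sum>a\<in>A. c a * ln (c a)) = (\<Sum>a\<in>A. c a * ln N + N * (c a / N * ln (c a / N)))"
    by (intro sum.cong) auto
  also have "\<dots> = real (\<Sum>a\<in>A. c a) * ln N + N * (\<Sum>a\<in>A. c a / N * ln (c a / N))"
    by (simp add: sum.distrib sum_distrib_left sum_distrib_right)
  also have "\<dots> = N * ln N - N * ent A (\<lambda>a. c a / N)"
    using assms(2) by (simp add: ent_def)
  finally have "exp (\<Sum>a\<in>A. c a * ln (c a)) = exp (N * ln N) * exp (- (N * ent A (\<lambda>a. c a / N)))"
    by (simp add: exp_diff exp_minus divide_inverse)
  then show ?thesis using True by (simp add: exp_sum power_eq_exp_xlnx)
next
  case False
  then show ?thesis using assms by simp
qed

text \<open>Here e a i is the edge type that a vertex of star type a shows along its i-th half-edge, and r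
  reverses edge types.\<close>

definition ematch :: "nat \<Rightarrow> nat \<Rightarrow> 't set \<Rightarrow> ('t \<Rightarrow> nat \<Rightarrow> 'e) \<Rightarrow> ('e \<Rightarrow> 'e)
    \<Rightarrow> ((nat \<times> nat \<Rightarrow> nat \<times> nat) \<times> (nat \<Rightarrow> 't)) set" where
  "ematch n d A e r = {(\<sigma>, L). \<sigma> \<in> matchings ({..<n} \<times> {..<d}) \<and> L \<in> PiE {..<n} (\<lambda>_. A) \<and>
     (\<forall>v<n. \<forall>i<d. e (L (fst (\<sigma> (v, i)))) (snd (\<sigma> (v, i))) = r (e (L v) i))}"

lemma finite_ematch:
  assumes "finite A" shows "finite (ematch n d A e r)"
  by (rule finite_subset[of _ "matchings ({..<n} \<times> {..<d}) \<times> PiE {..<n} (\<lambda>_. A)"])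
     (auto simp: ematch_def intro!: finite_cartesian_product finite_matchings finite_PiE assms finite_lessThan)

text \<open>The star counts c determine the edge-type counts m. There are at most exp(n H(c/n))
  label families; for each, the squared number of matchings is at most the product of the m_f!,
  which Stirling's bounds and \<open>fact_le_num_matchings\<close> turn into ((nd-1)!!)^2 exp(-nd
  H(m/nd)) times a polynomial.\<close>

lemma card_ematch_counts:
  fixes e :: "'t \<Rightarrow> nat \<Rightarrow> 'e" and c :: "'t \<Rightarrow> nat"
  assumes r: "\<And>f. r (r f) = f" and fin: "finite A" "finite E" and eE: "\<And>a i. a \<in> A \<Longrightarrow> i < d \<Longrightarrow> e a i \<in> E"
    and n: "0 < n" "0 < d"
  defines "S \<equiv> {(\<sigma>, L) \<in> ematch n d A e r. \<forall>a\<in>A. card {v \<in> {..<n}. L v = a} = c a}"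
  defines "m \<equiv> \<lambda>f. \<Sum>a\<in>A. c a * card {i \<in> {..<d}. e a i = f}"
  shows "real (card S) \<le> num_matchings (n * d) * (exp 1 * (real (n * d) + 1)) ^ (card E + 1)
     * exp (n * (ent A (\<lambda>a. c a / n) - d / 2 * ent E (\<lambda>f. m f / (n * d))))"
proof (cases "S = {}")
  case True
  then show ?thesis by simp
next
  case False
  let ?H = "{..<n} \<times> {..<d}" and ?N = "n * d"
  let ?L = "{L \<in> PiE {..<n} (\<lambda>_. A). \<forall>a\<in>A. card {v \<in> {..<n}. L v = a} = c a}"
  have finL: "finite ?L" by (simp add: finite_PiE fin)
  define t where "t = (\<lambda>(L :: nat \<Rightarrow> 't) h. e (L (fst h)) (snd h))"
  have t_count: "card {h \<in> ?H. t L h = f} = m f" if L: "L \<in> ?L" for L f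
  proof -
    have "{h \<in> ?H. t L h = f} = (SIGMA v:{..<n}. {i \<in> {..<d}. e (L v) i = f})"
      by (auto simp: t_def)
    then have "card {h \<in> ?H. t L h = f} = (\<Sum>v<n. card {i \<in> {..<d}. e (L v) i = f})"
      by (simp add: card_SigmaI)
    also have "\<dots> = (\<Sum>a\<in>A. \<Sum>v\<in>{v \<in> {..<n}. L v = a}. card {i \<in> {..<d}. e (L v) i = f})"
      by (rule sum.group[symmetric]) (use fin L in auto)
    also have "\<dots> = m f" unfolding m_def using L by (intro sum.cong) auto
    finally show ?thesis .
  qed
  have tE: "t L ` ?H \<subseteq> E" if "L \<in> ?L" for L using that by (auto simp: t_def intro!: eE)
  obtain \<sigma>0 L0 where s0: "\<sigma>0 \<in> matchings ?H" "L0 \<in> ?L"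
  proof -
    obtain \<sigma> L where "(\<sigma>, L) \<in> S" using False by fast
    then show ?thesis by (intro that[of \<sigma> L]) (simp_all add: S_def ematch_def)
  qed
  \<comment> \<open>The set S is nonempty here, so a matching exists; evenness is what
    \<open>fact_le_num_matchings\<close> asks for.\<close>
  have "even ?N"
  proof (rule ccontr)
    assume "odd ?N"
    moreover have "num_matchings k = 0" if "odd k" for k using that by (induction k rule: num_matchings.induct) auto
    ultimately have "matchings ?H = {}" using card_matchings[of ?H] finite_matchings[of ?H] by simp
    then show False using s0 by simp
  qed
  have csum: "(\<Sum>a\<in>A. c a) = n"
  proof -
    have "(\<Sum>a\<in>A. c a) = (\<Sum>a\<in>A. card {v \<in> {..<n}. L0 v = a})" using s0 by simp
    also have "\<dots> = (\<Sum>a\<in>A. \<Sum>v\<in>{v \<in> {..<n}. L0 v = a}. 1)" by simp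
    also have "\<dots> = (\<Sum>v<n. 1)" by (rule sum.group) (use s0 fin in auto)
    finally show ?thesis by simp
  qed
  have msum: "(\<Sum>f\<in>E. m f) = ?N"
  proof -
    have "(\<Sum>f\<in>E. m f) = (\<Sum>f\<in>E. card {h \<in> ?H. t L0 h = f})" using t_count[OF s0(2)] by simp
    also have "\<dots> = (\<Sum>f\<in>E. \<Sum>h\<in>{h \<in> ?H. t L0 h = f}. 1)" by simp
    also have "\<dots> = (\<Sum>h\<in>?H. 1)" by (rule sum.group) (use tE[OF s0(2)] fin in auto)
    finally show ?thesis by simp
  qed
  define P where "P = (\<Prod>f\<in>E. fact (m f) :: nat)"
  have "inj_on (\<lambda>(\<sigma>, L). (L, \<sigma>)) S" by (auto simp: inj_on_def)
  moreover have "(\<lambda>(\<sigma>, L). (L, \<sigma>)) ` S \<subseteq> (SIGMA L:?L. typed_matchings (t L) r ?H)"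
    by (auto simp: S_def ematch_def typed_matchings_def t_def)
  moreover have "finite (SIGMA L:?L. typed_matchings (t L) r ?H)"
    by (rule finite_SigmaI[OF finL]) (simp add: typed_matchings_def finite_matchings)
  ultimately have "card S \<le> card (SIGMA L:?L. typed_matchings (t L) r ?H)" by (rule card_inj_on_le)
  also have "\<dots> = (\<Sum>L\<in>?L. card (typed_matchings (t L) r ?H))"
    by (rule card_SigmaI[OF finL]) (simp add: typed_matchings_def finite_matchings)
  finally have "real (card S) \<le> (\<Sum>L\<in>?L. real (card (typed_matchings (t L) r ?H)))" by (simp flip: of_nat_sum)
  also have "\<dots> \<le> (\<Sum>L\<in>?L. sqrt P)"
  proof (rule sum_mono)
    fix L assume L: "L \<in> ?L"
    have "(card (typed_matchings (t L) r ?H))\<^sup>2 \<le> P"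
      using card_typed_matchings_le[OF r fin(2) _ tE[OF L]] t_count[OF L] by (simp add: P_def)
    then show "real (card (typed_matchings (t L) r ?H)) \<le> sqrt P"
      by (intro real_le_rsqrt) (simp flip: of_nat_power)
  qed
  finally have 1: "real (card S) \<le> card ?L * sqrt P" by simp
  have "card ?L * (\<Prod>a\<in>A. c a ^ c a) \<le> n ^ n"
    using multinomial_le[of "{..<n}" A c] fin csum by simp
  then have "real (card ?L) * (\<Prod>a\<in>A. real (c a) ^ c a) \<le> real n ^ n"
    by (simp flip: of_nat_power of_nat_prod of_nat_mult)
  then have "real (card ?L) * (real n ^ n * exp (- (n * ent A (\<lambda>a. c a / n)))) \<le> real n ^ n"
    using prod_power_eq_exp_ent[OF n(1) csum] by simp
  then have 2: "real (card ?L) \<le> exp (n * ent A (\<lambda>a. c a / n))"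
    using n by (simp add: exp_minus field_simps)
  \<comment> \<open>One polynomial quantity that dominates every Stirling error e (m_f + 1) and the
    factor nd + 1 lost in passing to double factorials.\<close>
  define X where "X = exp 1 * (real ?N + 1)"
  have X: "1 \<le> X" "0 < X" "real ?N + 1 \<le> X"
  proof -
    show "real ?N + 1 \<le> X" using mult_right_mono[of 1 "exp 1" "real ?N + 1"] by (simp add: X_def)
    then show "1 \<le> X" using of_nat_0_le_iff[of ?N] by linarith
    then show "0 < X" by linarith
  qed
  have X0: "0 \<le> X ^ card E * exp y" for y using X(2) by simp
  have mle: "m f \<le> ?N" if "f \<in> E" for f
    using member_le_sum[of f E m] that fin msum by simp
  have "real P \<le> (\<Prod>f\<in>E. X * (real (m f) ^ m f * exp (- real (m f))))"
    unfolding P_def of_nat_prod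
  proof (rule prod_mono, intro conjI)
    fix f assume "f \<in> E"
    have "real (fact (m f)) \<le> exp 1 * (real (m f) + 1) * (real (m f) ^ m f * exp (- real (m f)))"
      by (rule fact_upper)
    also have "\<dots> \<le> X * (real (m f) ^ m f * exp (- real (m f)))"
      using mle[OF \<open>f \<in> E\<close>] unfolding X_def
      by (intro mult_right_mono mult_left_mono) (auto simp flip: of_nat_Suc of_nat_mult)
    finally show "real (fact (m f)) \<le> X * (real (m f) ^ m f * exp (- real (m f)))" .
  qed simp
  also have "\<dots> = X ^ card E * ((\<Prod>f\<in>E. real (m f) ^ m f) * exp (- real ?N))"
    using fin msum by (simp add: prod.distrib exp_sum[symmetric] sum_negf flip: of_nat_sum)
  also have "(\<Prod>f\<in>E. real (m f) ^ m f) = real ?N ^ ?N * exp (- (?N * ent E (\<lambda>f. m f / ?N)))"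
    by (rule prod_power_eq_exp_ent) (use n msum in auto)
  also have "X ^ card E * (real ?N ^ ?N * exp (- (?N * ent E (\<lambda>f. m f / ?N))) * exp (- real ?N))
     = X ^ card E * exp (- (?N * ent E (\<lambda>f. m f / ?N))) * (real ?N ^ ?N * exp (- real ?N))"
    by simp
  also have "\<dots> \<le> X ^ card E * exp (- (?N * ent E (\<lambda>f. m f / ?N))) * fact ?N"
    using fact_lower[of ?N] X0 by (intro mult_left_mono) auto
  also have "\<dots> \<le> X ^ card E * exp (- (?N * ent E (\<lambda>f. m f / ?N))) * ((real (num_matchings ?N))\<^sup>2 * X)"
  proof (rule mult_left_mono)
    have "real (fact ?N) \<le> real ((num_matchings ?N)\<^sup>2 * Suc ?N)" using fact_le_num_matchings[OF \<open>even ?N\<close>] by (simp only: of_nat_le_iff)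
    also have "\<dots> = (real (num_matchings ?N))\<^sup>2 * (real ?N + 1)" by (simp add: algebra_simps)
    also have "\<dots> \<le> (real (num_matchings ?N))\<^sup>2 * X" using X by (intro mult_left_mono) auto
    finally show "fact ?N \<le> (real (num_matchings ?N))\<^sup>2 * X" by simp
  qed (rule X0)
  \<comment> \<open>A power of X is at least 1 and may be replaced by its square; this makes the
    bound a perfect square, ready for the root.\<close>
  also have "\<dots> \<le> (num_matchings ?N * X ^ (card E + 1) * exp (- (?N / 2 * ent E (\<lambda>f. m f / ?N))))\<^sup>2"
  proof -
    define Y where "Y = X ^ (card E + 1)"
    define Z where "Z = exp (- (?N / 2 * ent E (\<lambda>f. m f / ?N)))"
    have Y: "1 \<le> Y" unfolding Y_def by (rule one_le_power[OF X(1)])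
    have YX: "X ^ card E * X = Y" by (simp add: Y_def)
    have ZZ: "exp (- (?N * ent E (\<lambda>f. m f / ?N))) = Z\<^sup>2"
      unfolding Z_def power2_eq_square by (simp add: exp_add[symmetric])
    have "X ^ card E * exp (- (?N * ent E (\<lambda>f. m f / ?N))) * ((real (num_matchings ?N))\<^sup>2 * X) = Y * ((real (num_matchings ?N))\<^sup>2 * Z\<^sup>2)"
      unfolding ZZ YX[symmetric] by (simp add: mult_ac)
    also have "\<dots> \<le> (Y * Y) * ((real (num_matchings ?N))\<^sup>2 * Z\<^sup>2)"
      using mult_left_mono[OF Y, of Y] Y by (intro mult_right_mono) auto
    finally show ?thesis
      unfolding Y_def[symmetric] Z_def[symmetric] by (simp add: power2_eq_square mult_ac)
  qed
  finally have "sqrt P \<le> num_matchings ?N * X ^ (card E + 1) * exp (- (?N / 2 * ent E (\<lambda>f. m f / ?N)))"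
  proof (rule real_le_lsqrt[rotated])
    have "0 \<le> X ^ (card E + 1)" using X(2) by (intro zero_le_power) simp
    then show "0 \<le> num_matchings ?N * X ^ (card E + 1) * exp (- (?N / 2 * ent E (\<lambda>f. m f / ?N)))"
      by (intro mult_nonneg_nonneg) auto
  qed
  then have "card ?L * sqrt P \<le> exp (n * ent A (\<lambda>a. c a / n)) *
      (num_matchings ?N * X ^ (card E + 1) * exp (- (?N / 2 * ent E (\<lambda>f. m f / ?N))))"
    using 2 by (intro mult_mono) auto
  also have "\<dots> = num_matchings ?N * X ^ (card E + 1) * exp (n * (ent A (\<lambda>a. c a / n) - d / 2 * ent E (\<lambda>f. m f / ?N)))"
  proof -
    have "exp (n * ent A (\<lambda>a. c a / n)) * exp (- (?N / 2 * ent E (\<lambda>f. m f / ?N)))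
      = exp (n * (ent A (\<lambda>a. c a / n) - d / 2 * ent E (\<lambda>f. m f / ?N)))"
      unfolding exp_add[symmetric] by (simp add: algebra_simps)
    then show ?thesis by (rule subst) (simp only: mult_ac)
  qed
  finally show ?thesis using 1 unfolding X_def of_nat_mult by linarith
qed

section \<open>Continuity of entropy, and the count near a given distribution\<close>

lemma xlnx_continuous:
  fixes x :: real
  assumes "0 \<le> x" "0 < \<epsilon>"
  shows "\<exists>\<delta>>0. \<forall>y\<ge>0. \<bar>y - x\<bar> < \<delta> \<longrightarrow> \<bar>y * ln y - x * ln x\<bar> < \<epsilon>"
proof (cases "x = 0")
  case False
  then have "isCont (\<lambda>y. y * ln y) x" using assms by (intro continuous_intros) auto
  then obtain \<delta> where "\<delta> > 0" "\<And>y. dist y x < \<delta> \<Longrightarrow> dist (y * ln y) (x * ln x) < \<epsilon>"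
    using assms(2) unfolding continuous_at_eps_delta by blast
  then show ?thesis by (intro exI[of _ \<delta>]) (auto simp: dist_real_def)
next
  case True
  show ?thesis
  \<comment> \<open>For 0 < y < 1 the bound -ln y <= 2 / sqrt y gives |y ln y| <= 2 sqrt y, which
    dictates the radius.\<close>
  proof (intro exI[of _ "min 1 ((\<epsilon> / 2)\<^sup>2)"] conjI allI impI)
    fix y :: real assume y: "y \<ge> 0" "\<bar>y - x\<bar> < min 1 ((\<epsilon> / 2)\<^sup>2)"
    show "\<bar>y * ln y - x * ln x\<bar> < \<epsilon>"
    proof (cases "y = 0")
      case False
      then have y': "0 < y" "y < 1" "y < (\<epsilon> / 2)\<^sup>2" using y True by auto
      have "ln (1 / sqrt y) \<le> 1 / sqrt y" using ln_le_minus_one[of "1 / sqrt y"] y' by simp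
      then have "- ln y \<le> 2 / sqrt y" using y' by (simp add: ln_div ln_sqrt)
      then have "y * (- ln y) \<le> y * (2 / sqrt y)" using y' by (intro mult_left_mono) auto
      also have "\<dots> = 2 * sqrt y" using y' real_div_sqrt[of y] by (simp add: field_simps)
      also have "sqrt y < \<epsilon> / 2" using y' assms(2) by (intro real_less_lsqrt) auto
      finally show ?thesis using y' True by (simp add: abs_mult)
    qed (use assms True in auto)
  qed (use assms in auto)
qed

lemma ent_continuous:
  assumes "finite A" "\<And>a. a \<in> A \<Longrightarrow> 0 \<le> p a" "0 < \<epsilon>"
  shows "\<exists>\<delta>>0. \<forall>q. (\<forall>a\<in>A. 0 \<le> q a \<and> \<bar>q a - p a\<bar> < \<delta>) \<longrightarrow> \<bar>ent A q - ent A p\<bar> < \<epsilon>"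
proof (cases "A = {}")
  case True
  then show ?thesis using assms by (auto simp: ent_def)
next
  case False
  define \<eta> where "\<eta> = \<epsilon> / card A"
  have \<eta>: "\<eta> > 0" using assms False by (simp add: \<eta>_def card_gt_0_iff)
  have "\<forall>a\<in>A. \<exists>\<delta>>0. \<forall>y\<ge>0. \<bar>y - p a\<bar> < \<delta> \<longrightarrow> \<bar>y * ln y - p a * ln (p a)\<bar> < \<eta>"
    using xlnx_continuous assms \<eta> by blast
  then obtain D where D: "\<And>a. a \<in> A \<Longrightarrow> D a > 0"
    "\<And>a y. a \<in> A \<Longrightarrow> y \<ge> 0 \<Longrightarrow> \<bar>y - p a\<bar> < D a \<Longrightarrow> \<bar>y * ln y - p a * ln (p a)\<bar> < \<eta>"
    unfolding bchoice_iff by metis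
  define \<delta> where "\<delta> = Min (D ` A)"
  have \<delta>: "\<delta> > 0" "\<And>a. a \<in> A \<Longrightarrow> \<delta> \<le> D a"
    using D(1) assms False by (auto simp: \<delta>_def)
  show ?thesis
  proof (intro exI[of _ \<delta>] conjI allI impI)
    fix q assume q: "\<forall>a\<in>A. 0 \<le> q a \<and> \<bar>q a - p a\<bar> < \<delta>"
    have "\<bar>ent A q - ent A p\<bar> = \<bar>\<Sum>a\<in>A. q a * ln (q a) - p a * ln (p a)\<bar>"
      by (simp add: ent_def sum_subtractf)
    also have "\<dots> \<le> (\<Sum>a\<in>A. \<bar>q a * ln (q a) - p a * ln (p a)\<bar>)" by (rule sum_abs)
    also have "\<dots> < (\<Sum>a\<in>A. \<eta>)"
    proof (rule sum_strict_mono)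
      fix a assume "a \<in> A"
      then show "\<bar>q a * ln (q a) - p a * ln (p a)\<bar> < \<eta>"
        using D(2)[of a "q a"] \<delta>(2)[of a] q by fastforce
    qed (use assms False in auto)
    also have "\<dots> = \<epsilon>" using False assms by (simp add: \<eta>_def)
    finally show "\<bar>ent A q - ent A p\<bar> < \<epsilon>" .
  qed (rule \<delta>)
qed

text \<open>There are at most (n+1)^|A| count vectors, so a union bound over those near p costs only
  a polynomial. The distribution q is what p induces on the edge type in a uniformly random
  direction, and it varies continuously with p.\<close>

lemma card_ematch_near:
  fixes e :: "'t \<Rightarrow> nat \<Rightarrow> 'e" and p :: "'t \<Rightarrow> real"
  assumes r: "\<And>f. r (r f) = f" and fin: "finite A" "finite E" and eE: "\<And>a i. a \<in> A \<Longrightarrow> i < d \<Longrightarrow> e a i \<in> E"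
    and d: "0 < d" and p: "\<And>a. a \<in> A \<Longrightarrow> 0 \<le> p a" and \<epsilon>: "0 < \<epsilon>"
  defines "q \<equiv> \<lambda>f. (\<Sum>a\<in>A. p a * card {i \<in> {..<d}. e a i = f}) / d"
  shows "\<exists>\<delta>>0. \<forall>n>0.
    real (card {(\<sigma>, L) \<in> ematch n d A e r. \<forall>a\<in>A. \<bar>card {v \<in> {..<n}. L v = a} / n - p a\<bar> < \<delta>})
     \<le> num_matchings (n * d) * (exp 1 * (real (n * d) + 1)) ^ (card E + card A + 1) * exp (n * (ent A p - d / 2 * ent E q + \<epsilon>))"
proof -
  have q: "0 \<le> q f" for f unfolding q_def by (intro divide_nonneg_nonneg sum_nonneg mult_nonneg_nonneg p) auto
  obtain \<delta>1 where \<delta>1: "\<delta>1 > 0" "\<And>p'. (\<forall>a\<in>A. 0 \<le> p' a \<and> \<bar>p' a - p a\<bar> < \<delta>1) \<Longrightarrow> \<bar>ent A p' - ent A p\<bar> < \<epsilon> / 2"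
    using ent_continuous[of A p "\<epsilon> / 2"] fin p \<epsilon> by auto
  \<comment> \<open>The edge entropy is multiplied by d / 2, so a tolerance of \<epsilon> / d costs
    \<epsilon> / 2; the other half is spent on the stars.\<close>
  obtain \<delta>2 where \<delta>2: "\<delta>2 > 0" "\<And>q'. (\<forall>f\<in>E. 0 \<le> q' f \<and> \<bar>q' f - q f\<bar> < \<delta>2) \<Longrightarrow> \<bar>ent E q' - ent E q\<bar> < \<epsilon> / d"
    using ent_continuous[of E q "\<epsilon> / d"] fin q \<epsilon> d by auto
  \<comment> \<open>An edge frequency combines the |A| star frequencies with coefficients in [0, 1],
    so its error is at most |A| times theirs; the + 1 keeps the divisor positive and the final
    inequality strict.\<close>
  define \<delta> where "\<delta> = min \<delta>1 (\<delta>2 / (card A + 1))"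
  have \<delta>: "\<delta> > 0" using \<delta>1 \<delta>2 by (simp add: \<delta>_def)
  show ?thesis
  proof (intro exI[of _ \<delta>] conjI \<delta> allI impI)
    fix n :: nat assume n: "0 < n"
    let ?X = "exp 1 * (real (n * d) + 1)"
    let ?M = "{(\<sigma>, L) \<in> ematch n d A e r. \<forall>a\<in>A. \<bar>card {v \<in> {..<n}. L v = a} / n - p a\<bar> < \<delta>}"
    define S where "S = (\<lambda>c. {(\<sigma>, L) \<in> ematch n d A e r. \<forall>a\<in>A. card {v \<in> {..<n}. L v = a} = c a})"
    define Cs where "Cs = {c \<in> PiE A (\<lambda>_. {..n}). \<forall>a\<in>A. \<bar>c a / n - p a\<bar> < \<delta>}"
    define R where "R = num_matchings (n * d) * ?X ^ (card E + 1) * exp (n * (ent A p - d / 2 * ent E q + \<epsilon>))"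
    have finC: "finite Cs" unfolding Cs_def using fin by (simp add: finite_PiE)
    have "card Cs \<le> card (PiE A (\<lambda>_. {..n}))"
      unfolding Cs_def by (rule card_mono) (use fin in \<open>auto intro!: finite_PiE\<close>)
    also have "\<dots> = (n + 1) ^ card A" using fin by (simp add: card_PiE)
    finally have "real (card Cs) \<le> real ((n + 1) ^ card A)" by (simp only: of_nat_le_iff)
    then have cC: "real (card Cs) \<le> real (n + 1) ^ card A" by (simp only: of_nat_power)
    have SR: "real (card (S c)) \<le> R" if c: "c \<in> Cs" for c
    proof -
      define m where "m = (\<lambda>f. \<Sum>a\<in>A. c a * card {i \<in> {..<d}. e a i = f})"
      have "real (card (S c)) \<le> num_matchings (n * d) * ?X ^ (card E + 1)
        * exp (n * (ent A (\<lambda>a. c a / n) - d / 2 * ent E (\<lambda>f. m f / (n * d))))"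
        using card_ematch_counts[where c = c, OF r fin eE n d] by (simp add: S_def m_def)
      also have "\<dots> \<le> R" unfolding R_def
      proof (intro mult_left_mono)
        have 1: "\<bar>ent A (\<lambda>a. c a / n) - ent A p\<bar> < \<epsilon> / 2"
          by (rule \<delta>1(2)) (use c in \<open>auto simp: Cs_def \<delta>_def\<close>)
        have 2: "\<bar>ent E (\<lambda>f. m f / (n * d)) - ent E q\<bar> < \<epsilon> / d"
        proof (rule \<delta>2(2), intro ballI conjI)
          fix f assume "f \<in> E"
          have "m f / (n * d) = (\<Sum>a\<in>A. c a / n * (card {i \<in> {..<d}. e a i = f} / d))"
            unfolding m_def of_nat_sum sum_divide_distrib by simp
          moreover have "q f = (\<Sum>a\<in>A. p a * (card {i \<in> {..<d}. e a i = f} / d))"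
            unfolding q_def sum_divide_distrib by simp
          ultimately have "m f / (n * d) - q f = (\<Sum>a\<in>A. (c a / n - p a) * (card {i \<in> {..<d}. e a i = f} / d))"
            by (simp only: left_diff_distrib sum_subtractf)
          then have "\<bar>m f / (n * d) - q f\<bar> \<le> (\<Sum>a\<in>A. \<bar>(c a / n - p a) * (card {i \<in> {..<d}. e a i = f} / d)\<bar>)"
            by (simp only: sum_abs)
          also have "\<dots> \<le> (\<Sum>a\<in>A. \<delta>)"
          proof (rule sum_mono)
            fix a assume a: "a \<in> A"
            have "card {i \<in> {..<d}. e a i = f} \<le> card {..<d}" by (rule card_mono) auto
            then have "real (card {i \<in> {..<d}. e a i = f}) / d \<le> 1" using d by simp
            then have "\<bar>c a / n - p a\<bar> * (card {i \<in> {..<d}. e a i = f} / d) \<le> \<delta> * 1"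
              using c a \<delta> by (intro mult_mono) (auto simp: Cs_def less_imp_le)
            then show "\<bar>(c a / n - p a) * (card {i \<in> {..<d}. e a i = f} / d)\<bar> \<le> \<delta>"
              by (simp add: abs_mult)
          qed
          also have "\<dots> = card A * \<delta>" by simp
          also have "\<dots> \<le> card A * (\<delta>2 / (card A + 1))" by (intro mult_left_mono) (auto simp: \<delta>_def)
          also have "\<dots> < \<delta>2" using \<delta>2(1) by (simp add: field_simps)
          finally show "\<bar>m f / (n * d) - q f\<bar> < \<delta>2" .
        qed simp
        have "d / 2 * (ent E q - ent E (\<lambda>f. m f / (n * d))) \<le> d / 2 * (\<epsilon> / d)"
          using 2 by (intro mult_left_mono) auto
        also have "\<dots> = \<epsilon> / 2" using d by simp
        finally have "ent A (\<lambda>a. c a / n) - d / 2 * ent E (\<lambda>f. m f / (n * d)) \<le> ent A p - d / 2 * ent E q + \<epsilon>"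
          using 1 unfolding right_diff_distrib by linarith
        then show "exp (n * (ent A (\<lambda>a. c a / n) - d / 2 * ent E (\<lambda>f. m f / (n * d))))
          \<le> exp (n * (ent A p - d / 2 * ent E q + \<epsilon>))" by (simp add: mult_left_mono)
      qed auto
      finally show ?thesis .
    qed
    have "?M \<subseteq> (\<Union>c\<in>Cs. S c)"
    proof
      fix x assume "x \<in> ?M"
      then obtain \<sigma> L where x: "x = (\<sigma>, L)" "(\<sigma>, L) \<in> ematch n d A e r"
        "\<And>a. a \<in> A \<Longrightarrow> \<bar>card {v \<in> {..<n}. L v = a} / n - p a\<bar> < \<delta>" by auto
      have "card {v \<in> {..<n}. L v = a} \<le> n" for a
        using card_mono[of "{..<n}" "{v \<in> {..<n}. L v = a}"] by auto
      then show "x \<in> (\<Union>c\<in>Cs. S c)" using x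
        by (intro UN_I[of "restrict (\<lambda>a. card {v \<in> {..<n}. L v = a}) A"]) (auto simp: Cs_def S_def)
    qed
    moreover have fS: "finite (S c)" for c
      by (rule finite_subset[OF _ finite_ematch[OF fin(1), of n d e r]]) (auto simp: S_def)
    ultimately have "card ?M \<le> card (\<Union>c\<in>Cs. S c)" using finC by (intro card_mono) auto
    also have "\<dots> \<le> (\<Sum>c\<in>Cs. card (S c))" by (rule card_UN_le[OF finC])
    finally have "real (card ?M) \<le> (\<Sum>c\<in>Cs. real (card (S c)))" by (simp flip: of_nat_sum)
    also have "\<dots> \<le> (\<Sum>c\<in>Cs. R)" by (rule sum_mono[OF SR])
    also have "\<dots> = card Cs * R" by simp
    also have "\<dots> \<le> ?X ^ card A * R"
    proof (rule mult_right_mono)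
      have "real (n + 1) \<le> real (n * d) + 1" using d by (cases d) auto
      also have "\<dots> \<le> ?X" using mult_right_mono[of 1 "exp 1" "real (n * d) + 1"] by simp
      finally show "real (card Cs) \<le> ?X ^ card A" using cC power_mono[of "real (n + 1)" ?X "card A"] by simp
    qed (simp add: R_def)
    finally show "real (card ?M) \<le> num_matchings (n * d) * (exp 1 * (real (n * d) + 1)) ^ (card E + card A + 1)
       * exp (n * (ent A p - d / 2 * ent E q + \<epsilon>))"
      by (simp add: R_def power_add mult_ac add.commute)
  qed
qed

section \<open>Simple matchings and regular graphs\<close>

definition halves :: "nat \<Rightarrow> nat \<Rightarrow> (nat \<times> nat) set" where
  "halves n d = {..<n} \<times> {..<d}"

text \<open>The half-edge h lies in a loop or in a multiple edge.\<close>

definition bad_half :: "(nat \<times> nat) set \<Rightarrow> (nat \<times> nat \<Rightarrow> nat \<times> nat) \<Rightarrow> nat \<times> nat \<Rightarrow> bool" where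
  "bad_half H \<sigma> h \<longleftrightarrow> fst (\<sigma> h) = fst h \<or> (\<exists>x\<in>H. x \<noteq> h \<and> fst x = fst h \<and> fst (\<sigma> x) = fst (\<sigma> h))"

definition bads where "bads H \<sigma> = {h \<in> H. bad_half H \<sigma> h}"

lemma finite_halves [simp]: "finite (halves n d)" and card_halves: "card (halves n d) = n * d"
  by (simp_all add: halves_def)

lemma card_fibre: "card {x \<in> halves n d. fst x = u} \<le> d"
proof -
  have "{x \<in> halves n d. fst x = u} \<subseteq> {u} \<times> {..<d}" by (auto simp: halves_def)
  from card_mono[OF _ this] show ?thesis by simp
qed

lemma card_matchings_two_pairs:
  assumes "finite H" "h \<in> H" "k \<in> H" "x \<in> H" "y \<in> H" "distinct [h, k, x, y]"
  shows "card {\<sigma> \<in> matchings H. \<sigma> h = k \<and> \<sigma> x = y} \<le> num_matchings (card H - 4)"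
proof -
  have "card {\<sigma> \<in> matchings H. \<sigma> h = k \<and> \<sigma> x = y} \<le> card {\<sigma> \<in> matchings (H - {h, k}). \<sigma> x = y}"
  proof (rule card_inj_on_le[where f = "\<lambda>\<sigma>. restrict \<sigma> (H - {h, k})"])
    have bij: "bij_betw (\<lambda>\<sigma>. restrict \<sigma> (H - {h, k})) {\<sigma> \<in> matchings H. \<sigma> h = k} (matchings (H - {h, k}))"
      by (rule matchings_remove_pair) (use assms in auto)
    show "inj_on (\<lambda>\<sigma>. restrict \<sigma> (H - {h, k})) {\<sigma> \<in> matchings H. \<sigma> h = k \<and> \<sigma> x = y}"
      by (rule inj_on_subset[OF bij_betw_imp_inj_on[OF bij]]) auto
    show "(\<lambda>\<sigma>. restrict \<sigma> (H - {h, k})) ` {\<sigma> \<in> matchings H. \<sigma> h = k \<and> \<sigma> x = y} \<subseteq> {\<sigma> \<in> matchings (H - {h, k}). \<sigma> x = y}"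
    proof (intro image_subsetI)
      fix \<sigma> assume "\<sigma> \<in> {\<sigma> \<in> matchings H. \<sigma> h = k \<and> \<sigma> x = y}"
      then show "restrict \<sigma> (H - {h, k}) \<in> {\<sigma> \<in> matchings (H - {h, k}). \<sigma> x = y}"
        using bij_betwE[OF bij] assms by auto
    qed
    show "finite {\<sigma> \<in> matchings (H - {h, k}). \<sigma> x = y}" using finite_matchings[of "H - {h, k}"] assms by simp
  qed
  also have "\<dots> = card (matchings (H - {h, k} - {x, y}))"
    by (rule card_matchings_pair) (use assms in auto)
  also have "\<dots> = num_matchings (card (H - {h, k} - {x, y}))" by (rule card_matchings) (use assms in auto)
  also have "H - {h, k} - {x, y} = H - {h, k, x, y}" by auto
  also have "card (H - {h, k, x, y}) = card H - 4"
    using assms by (subst card_Diff_subset) auto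
  finally show ?thesis .
qed

text \<open>The first term counts loops, with at most d partners for h. The second counts double
  edges: another half-edge x at the vertex of h, a partner k of h, and a partner of x at the vertex
  of k, that is d, nd and d choices, after which two pairs are fixed.\<close>

lemma card_bad_matchings:
  assumes "h \<in> halves n d"
  shows "card {\<sigma> \<in> matchings (halves n d). bad_half (halves n d) \<sigma> h} \<le> d * num_matchings (n * d - 2) + d * d * (n * d) * num_matchings (n * d - 4)"
proof -
  let ?H = "halves n d"
  let ?F = "\<lambda>u. {x \<in> ?H. fst x = u}"
  have fin: "finite (matchings ?H)" by (simp add: finite_matchings)
  let ?A = "\<lambda>k. {\<sigma> \<in> matchings ?H. \<sigma> h = k}"
  let ?B = "\<lambda>x k y. {\<sigma> \<in> matchings ?H. \<sigma> h = k \<and> \<sigma> x = y}"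
  have "{\<sigma> \<in> matchings ?H. bad_half ?H \<sigma> h} \<subseteq> (\<Union>k\<in>?F (fst h) - {h}. ?A k) \<union>
     (\<Union>x\<in>?F (fst h) - {h}. \<Union>k\<in>?H - {h, x}. \<Union>y\<in>?F (fst k) - {h, x, k}. ?B x k y)"
  proof
    fix \<sigma> assume "\<sigma> \<in> {\<sigma> \<in> matchings ?H. bad_half ?H \<sigma> h}"
    then have \<sigma>: "\<sigma> \<in> matchings ?H" "bad_half ?H \<sigma> h" by auto
    note pd = matchingsD[OF \<sigma>(1)]
    show "\<sigma> \<in> (\<Union>k\<in>?F (fst h) - {h}. ?A k) \<union>
     (\<Union>x\<in>?F (fst h) - {h}. \<Union>k\<in>?H - {h, x}. \<Union>y\<in>?F (fst k) - {h, x, k}. ?B x k y)"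
    proof (cases "fst (\<sigma> h) = fst h")
      case True
      then show ?thesis using pd[OF assms] \<sigma>(1) by auto
    next
      case False
      then obtain x where x: "x \<in> ?H" "x \<noteq> h" "fst x = fst h" "fst (\<sigma> x) = fst (\<sigma> h)"
        using \<sigma>(2) by (auto simp: bad_half_def)
      have "\<sigma> x \<noteq> \<sigma> h" using pd(3)[OF x(1)] pd(3)[OF assms] x(2) by metis
      then have "\<sigma> x \<in> ?F (fst (\<sigma> h)) - {h, x, \<sigma> h}" using pd[OF x(1)] x False by auto
      moreover have "\<sigma> h \<in> ?H - {h, x}" using pd[OF assms] x False by auto
      ultimately show ?thesis using x \<sigma>(1) by blast
    qed
  qed
  then have "card {\<sigma> \<in> matchings ?H. bad_half ?H \<sigma> h} \<le> card ((\<Union>k\<in>?F (fst h) - {h}. ?A k) \<union>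
     (\<Union>x\<in>?F (fst h) - {h}. \<Union>k\<in>?H - {h, x}. \<Union>y\<in>?F (fst k) - {h, x, k}. ?B x k y))"
    by (rule card_mono[rotated]) (use fin in auto)
  also have "\<dots> \<le> card (\<Union>k\<in>?F (fst h) - {h}. ?A k) +
     card (\<Union>x\<in>?F (fst h) - {h}. \<Union>k\<in>?H - {h, x}. \<Union>y\<in>?F (fst k) - {h, x, k}. ?B x k y)"
    by (rule card_Un_le)
  also have "\<dots> \<le> d * num_matchings (n * d - 2) + d * ((n * d) * (d * num_matchings (n * d - 4)))"
  proof (rule add_mono)
    have "card (\<Union>k\<in>?F (fst h) - {h}. ?A k) \<le> (\<Sum>k\<in>?F (fst h) - {h}. card (?A k))"
      by (rule card_UN_le) simp
    also have "\<dots> = (\<Sum>k\<in>?F (fst h) - {h}. num_matchings (n * d - 2))"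
    proof (rule sum.cong)
      fix k assume k: "k \<in> ?F (fst h) - {h}"
      then have "card {h, k} = 2" by auto
      moreover have "card (?A k) = card (matchings (?H - {h, k}))" by (rule card_matchings_pair) (use k assms in auto)
      ultimately show "card (?A k) = num_matchings (n * d - 2)"
        using k assms by (simp add: card_matchings card_Diff_subset card_halves)
    qed simp
    also have "\<dots> \<le> d * num_matchings (n * d - 2)"
      using card_fibre[of n d "fst h"] card_mono[of "?F (fst h)" "?F (fst h) - {h}"]
      by (simp add: mult_right_mono)
    finally show "card (\<Union>k\<in>?F (fst h) - {h}. ?A k) \<le> d * num_matchings (n * d - 2)" .
    have le: "card (\<Union>i\<in>I. X i) \<le> M * b" if "finite I" "card I \<le> M" "\<And>i. i \<in> I \<Longrightarrow> card (X i) \<le> b"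
      for I :: "(nat \<times> nat) set" and X :: "nat \<times> nat \<Rightarrow> (nat \<times> nat \<Rightarrow> nat \<times> nat) set" and M b
    proof -
      have "card (\<Union>i\<in>I. X i) \<le> (\<Sum>i\<in>I. card (X i))" by (rule card_UN_le) fact
      also have "\<dots> \<le> card I * b" using sum_bounded_above[of I "\<lambda>i. card (X i)" b] that by simp
      also have "\<dots> \<le> M * b" using that by (simp add: mult_right_mono)
      finally show ?thesis .
    qed
    have cF: "card (?F u - Z) \<le> d" for u Z
      using card_fibre[of n d u] card_mono[of "?F u" "?F u - Z"] by simp
    show "card (\<Union>x\<in>?F (fst h) - {h}. \<Union>k\<in>?H - {h, x}. \<Union>y\<in>?F (fst k) - {h, x, k}. ?B x k y)
      \<le> d * ((n * d) * (d * num_matchings (n * d - 4)))"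
    proof (intro le cF)
      fix x k y assume "x \<in> ?F (fst h) - {h}" "k \<in> ?H - {h, x}" "y \<in> ?F (fst k) - {h, x, k}"
      then show "card (?B x k y) \<le> num_matchings (n * d - 4)"
        using card_matchings_two_pairs[of ?H h k x y] assms by (auto simp: card_halves)
    next
      fix x show "card (?H - {h, x}) \<le> n * d"
        using card_mono[of ?H "?H - {h, x}"] by (simp add: card_halves)
    qed simp_all
  qed
  finally show ?thesis by (simp add: mult_ac)
qed

text \<open>Linearity of expectation: a uniformly random matching has at most 6 d^2 bad half-edges
  on average, however large n is.\<close>

lemma sum_bads:
  assumes "6 \<le> n * d" "0 < d"
  shows "(\<Sum>\<sigma>\<in>matchings (halves n d). card (bads (halves n d) \<sigma>)) \<le> 6 * d\<^sup>2 * num_matchings (n * d)"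
proof -
  let ?H = "halves n d" let ?N = "n * d"
  have fin: "finite (matchings ?H)" by (simp add: finite_matchings)
  have "(\<Sum>\<sigma>\<in>matchings ?H. card (bads ?H \<sigma>)) = (\<Sum>\<sigma>\<in>matchings ?H. \<Sum>h\<in>?H. if bad_half ?H \<sigma> h then 1 else 0)"
    by (intro sum.cong) (simp_all add: bads_def sum.If_cases Int_def)
  also have "\<dots> = (\<Sum>h\<in>?H. \<Sum>\<sigma>\<in>matchings ?H. if bad_half ?H \<sigma> h then 1 else 0)" by (rule sum.swap)
  also have "\<dots> = (\<Sum>h\<in>?H. card {\<sigma> \<in> matchings ?H. bad_half ?H \<sigma> h})"
    using fin by (intro sum.cong) (simp_all add: sum.If_cases Int_def)
  also have "\<dots> \<le> (\<Sum>h\<in>?H. d * num_matchings (?N - 2) + d * d * ?N * num_matchings (?N - 4))"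
    by (intro sum_mono card_bad_matchings)
  also have "\<dots> = ?N * d * num_matchings (?N - 2) + d * d * (?N * ?N) * num_matchings (?N - 4)"
    by (simp add: card_halves algebra_simps)
  also have "\<dots> \<le> 6 * d\<^sup>2 * num_matchings ?N"
  proof -
    obtain j where j: "?N = Suc (Suc (Suc (Suc j)))" "2 \<le> j"
    proof
      show "?N = Suc (Suc (Suc (Suc (?N - 4))))" "2 \<le> ?N - 4" using assms(1) by simp_all
    qed
    \<comment> \<open>Relative to the number of all matchings, loops contribute at most 2 d^2 and
      double edges at most 4 d^2; the latter estimate uses j >= 2.\<close>
    have p: "num_matchings ?N = (j + 3) * ((j + 1) * num_matchings j)" "num_matchings (?N - 2) = (j + 1) * num_matchings j" "num_matchings (?N - 4) = num_matchings j"
      unfolding j(1) by (simp_all add: numeral_2_eq_2 numeral_eq_Suc)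
    have a: "?N * d \<le> 2 * (j + 3) * d\<^sup>2" unfolding j(1) using assms(2) by (cases d) (auto simp: power2_eq_square algebra_simps)
    have b: "?N * ?N \<le> 4 * ((j + 3) * (j + 1))" unfolding j(1) using j(2) by (auto simp: algebra_simps)
    have "?N * d * num_matchings (?N - 2) + d * d * (?N * ?N) * num_matchings (?N - 4)
       \<le> (2 * (j + 3) * d\<^sup>2) * ((j + 1) * num_matchings j) + d * d * (4 * ((j + 3) * (j + 1))) * num_matchings j"
      unfolding p by (intro add_mono mult_right_mono mult_left_mono a b) auto
    also have "\<dots> = 6 * d\<^sup>2 * num_matchings ?N" unfolding p by (simp add: power2_eq_square algebra_simps)
    finally show ?thesis .
  qed
  finally show ?thesis .
qed

text \<open>Markov's inequality at twice the mean bound of \<open>sum_bads\<close>.\<close>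

lemma half_few_bads:
  assumes "6 \<le> n * d" "0 < d"
  shows "num_matchings (n * d) \<le> 2 * card {\<sigma> \<in> matchings (halves n d). card (bads (halves n d) \<sigma>) \<le> 12 * d\<^sup>2}"
proof -
  let ?H = "halves n d"
  let ?X = "{\<sigma> \<in> matchings ?H. card (bads ?H \<sigma>) \<le> 12 * d\<^sup>2}"
  let ?Y = "{\<sigma> \<in> matchings ?H. \<not> card (bads ?H \<sigma>) \<le> 12 * d\<^sup>2}"
  have fin: "finite (matchings ?H)" by (simp add: finite_matchings)
  have "card ?Y * (12 * d\<^sup>2) = (\<Sum>\<sigma>\<in>?Y. 12 * d\<^sup>2)" by simp
  also have "\<dots> \<le> (\<Sum>\<sigma>\<in>?Y. card (bads ?H \<sigma>))" by (rule sum_mono) simp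
  also have "\<dots> \<le> (\<Sum>\<sigma>\<in>matchings ?H. card (bads ?H \<sigma>))" by (rule sum_mono2) (use fin in auto)
  also have "\<dots> \<le> 6 * d\<^sup>2 * num_matchings (n * d)" by (rule sum_bads[OF assms])
  finally have "(2 * card ?Y) * (6 * d\<^sup>2) \<le> num_matchings (n * d) * (6 * d\<^sup>2)" by (simp add: mult_ac)
  then have Y: "2 * card ?Y \<le> num_matchings (n * d)" using assms(2) by simp
  have "num_matchings (n * d) = card (matchings ?H)" by (simp add: card_matchings card_halves)
  also have "matchings ?H = ?X \<union> ?Y" by auto
  also have "card (?X \<union> ?Y) = card ?X + card ?Y" by (rule card_Un_disjoint) (use fin in auto)
  finally show ?thesis using Y by simp
qed

section \<open>Switchings of matchings\<close>

definition switch :: "('a \<Rightarrow> 'a) \<Rightarrow> 'a \<Rightarrow> 'a \<Rightarrow> 'a \<Rightarrow> 'a" where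
  "switch \<sigma> h r = \<sigma>(h := r, r := h, \<sigma> h := \<sigma> r, \<sigma> r := \<sigma> h)"

lemma switch_matchings:
  assumes \<sigma>: "\<sigma> \<in> matchings H" and "h \<in> H" "r \<in> H" "r \<noteq> h" "r \<noteq> \<sigma> h"
  shows "switch \<sigma> h r \<in> matchings H"
proof -
  note pd = matchingsD[OF \<sigma>]
  have ne: "\<sigma> h \<noteq> h" "\<sigma> r \<noteq> r" "\<sigma> r \<noteq> h" "\<sigma> r \<noteq> \<sigma> h" "\<sigma> h \<in> H" "\<sigma> r \<in> H"
    using pd assms by metis+
  have "switch \<sigma> h r x \<in> H \<and> switch \<sigma> h r x \<noteq> x \<and> switch \<sigma> h r (switch \<sigma> h r x) = x" if x: "x \<in> H" for x
  proof (cases "x \<in> {h, r, \<sigma> h, \<sigma> r}")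
    case True
    then show ?thesis using ne assms by (auto simp: switch_def)
  next
    case False
    then have "\<sigma> x \<notin> {h, r, \<sigma> h, \<sigma> r}" using pd[OF x] pd[OF \<open>h \<in> H\<close>] pd[OF \<open>r \<in> H\<close>] by auto
    then show ?thesis using False pd[OF x] by (auto simp: switch_def)
  qed
  moreover have "switch \<sigma> h r \<in> extensional H"
    using \<sigma> assms ne by (auto simp: switch_def matchings_def extensional_def)
  ultimately show ?thesis by (simp add: matchings_def)
qed

text \<open>A switching is undone from h, r and the old partner of h alone: the old partner of r is
  now matched with the old partner of h. This is the source of the factor (nd)^3 in
  \<open>few_bads_step\<close>.\<close>

lemma switch_switch:
  assumes \<sigma>: "\<sigma> \<in> matchings H" and "h \<in> H" "r \<in> H" "r \<noteq> h" "r \<noteq> \<sigma> h"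
  shows "(switch \<sigma> h r)(h := \<sigma> h, \<sigma> h := h, r := switch \<sigma> h r (\<sigma> h), switch \<sigma> h r (\<sigma> h) := r) = \<sigma>"
proof -
  note pd = matchingsD[OF \<sigma>]
  have ne: "\<sigma> h \<noteq> h" "\<sigma> r \<noteq> r" "\<sigma> r \<noteq> h" "\<sigma> r \<noteq> \<sigma> h" "\<sigma> (\<sigma> h) = h" "\<sigma> (\<sigma> r) = r"
    using pd assms by metis+
  then have "switch \<sigma> h r (\<sigma> h) = \<sigma> r" using assms by (simp add: switch_def)
  then show ?thesis using ne assms by (auto simp: fun_eq_iff switch_def)
qed

text \<open>The hypotheses say that the pairs of h and r share no vertex, that no edge joins them,
  and that r is not in a loop. So the two new edges join vertices that were not joined before: both
  are simple, h becomes good, and no other half-edge becomes bad.\<close>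

lemma switch_bads:
  assumes \<sigma>: "\<sigma> \<in> matchings H" and h: "h \<in> H" and r: "r \<in> H"
    and far: "\<And>p q. p \<in> {h, \<sigma> h} \<Longrightarrow> q \<in> {r, \<sigma> r} \<Longrightarrow> fst q \<noteq> fst p"
      "\<And>p q y. p \<in> {h, \<sigma> h} \<Longrightarrow> q \<in> {r, \<sigma> r} \<Longrightarrow> y \<in> H \<Longrightarrow> fst y = fst p \<Longrightarrow> fst (\<sigma> y) \<noteq> fst q"
    and rs: "fst (\<sigma> r) \<noteq> fst r"
  shows "bads H (switch \<sigma> h r) \<subseteq> bads H \<sigma> - {h}"
proof
  fix x assume "x \<in> bads H (switch \<sigma> h r)"
  then have x: "x \<in> H" and bad: "bad_half H (switch \<sigma> h r) x" by (auto simp: bads_def)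
  note pd = matchingsD[OF \<sigma>]
  define k s where "k = \<sigma> h" and "s = \<sigma> r"
  have k: "k \<in> H" "\<sigma> k = h" "s \<in> H" "\<sigma> s = r" using pd h r by (auto simp: k_def s_def)
  have ne: "fst r \<noteq> fst h" "fst r \<noteq> fst k" "fst s \<noteq> fst h" "fst s \<noteq> fst k" "fst s \<noteq> fst r"
    using far(1) rs by (auto simp: k_def s_def)
  have f: "fst (\<sigma> y) \<noteq> fst q" if "y \<in> H" "p \<in> {h, k}" "q \<in> {r, s}" "fst y = fst p" for y p q
    using far(2)[of p q y] that by (auto simp: k_def s_def)
  have f': "fst (\<sigma> y) \<noteq> fst p" if "y \<in> H" "p \<in> {h, k}" "q \<in> {r, s}" "fst y = fst q" for y p q
    using f[of "\<sigma> y" p q] pd[OF that(1)] that by auto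
  have sw: "switch \<sigma> h r h = r" "switch \<sigma> h r r = h" "switch \<sigma> h r k = s" "switch \<sigma> h r s = k"
    "\<And>y. y \<notin> {h, k, r, s} \<Longrightarrow> switch \<sigma> h r y = \<sigma> y"
    using ne k pd(2)[OF h] pd(2)[OF r] pd(3)[OF h] pd(3)[OF r]
    unfolding switch_def k_def[symmetric] s_def[symmetric] by auto
  have new: "fst (switch \<sigma> h r x) \<noteq> fst x \<and> (\<forall>y\<in>H. y \<noteq> x \<longrightarrow> fst y = fst x \<longrightarrow> fst (switch \<sigma> h r y) \<noteq> fst (switch \<sigma> h r x))"
    if xx: "x \<in> {h, k, r, s}"
  proof (intro conjI ballI impI)
    show "fst (switch \<sigma> h r x) \<noteq> fst x" using xx sw ne by auto
    fix y assume y: "y \<in> H" "y \<noteq> x" "fst y = fst x"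
    show "fst (switch \<sigma> h r y) \<noteq> fst (switch \<sigma> h r x)"
    proof (cases "y \<in> {h, k, r, s}")
      case True
      then show ?thesis using xx y sw ne by auto
    next
      case False
      then have "switch \<sigma> h r y = \<sigma> y" by (rule sw(5))
      then show ?thesis using xx y sw(1-4) f[OF y(1), of h r] f[OF y(1), of k s] f'[OF y(1), of h r] f'[OF y(1), of k s]
        by auto
    qed
  qed
  have nx: "x \<notin> {h, k, r, s}" using new bad by (auto simp: bad_half_def)
  then have sx: "switch \<sigma> h r x = \<sigma> x" by (rule sw(5))
  have "bad_half H \<sigma> x"
  proof (cases "fst (\<sigma> x) = fst x")
    case True
    then show ?thesis by (simp add: bad_half_def)
  next
    case False
    then obtain y where y: "y \<in> H" "y \<noteq> x" "fst y = fst x" "fst (switch \<sigma> h r y) = fst (\<sigma> x)"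
      using bad sx by (auto simp: bad_half_def)
    have "y \<notin> {h, k, r, s}"
      using y sw(1-4) f[OF x, of h r] f[OF x, of k s] f'[OF x, of h r] f'[OF x, of k s] by auto
    then have "switch \<sigma> h r y = \<sigma> y" by (rule sw(5))
    then show ?thesis using y by (auto simp: bad_half_def)
  qed
  then show "x \<in> bads H \<sigma> - {h}" using x nx by (auto simp: bads_def)
qed

definition few_bads :: "nat \<Rightarrow> nat \<Rightarrow> nat \<Rightarrow> (nat \<times> nat \<Rightarrow> nat \<times> nat) set" where
  "few_bads n d b = {\<sigma> \<in> matchings (halves n d). card (bads (halves n d) \<sigma>) \<le> b}"

lemma finite_few_bads: "finite (few_bads n d b)"
  using finite_matchings[of "halves n d"] by (simp add: few_bads_def)

text \<open>An unsuitable r is bad, or it or its partner sits at one of the at most 2 + 2d vertices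
  that are ends of the pair of h or neighbours of these. That makes at most 2 (2 + 2d) d + b + 1
  half-edges, fewer than nd.\<close>

lemma ex_switch:
  assumes \<sigma>: "\<sigma> \<in> few_bads n d (Suc b)" and h: "h \<in> bads (halves n d) \<sigma>"
    and N: "4 * d * (d + 1) + b + 1 < n * d"
  shows "\<exists>r\<in>halves n d. r \<noteq> h \<and> r \<noteq> \<sigma> h \<and> switch \<sigma> h r \<in> few_bads n d b"
proof -
  let ?H = "halves n d"
  have \<sigma>': "\<sigma> \<in> matchings ?H" "card (bads ?H \<sigma>) \<le> Suc b" using \<sigma> by (auto simp: few_bads_def)
  note pd = matchingsD[OF \<sigma>'(1)]
  have hH: "h \<in> ?H" using h by (simp add: bads_def)
  define nb where "nb = (\<lambda>u. (\<lambda>y. fst (\<sigma> y)) ` {y \<in> ?H. fst y = u})"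
  have nb: "card (nb u) \<le> d" "finite (nb u)" for u
    unfolding nb_def using card_image_le[of "{y \<in> ?H. fst y = u}"] card_fibre[of n d u]
    by (auto intro: le_trans)
  define D where "D = {fst h, fst (\<sigma> h)} \<union> (nb (fst h) \<union> nb (fst (\<sigma> h)))"
  have finD: "finite D" by (simp add: D_def nb)
  have "card D \<le> card {fst h, fst (\<sigma> h)} + card (nb (fst h) \<union> nb (fst (\<sigma> h)))"
    unfolding D_def by (rule card_Un_le)
  also have "\<dots> \<le> 2 + (d + d)"
    using card_Un_le[of "nb (fst h)" "nb (fst (\<sigma> h))"] nb(1)[of "fst h"] nb(1)[of "fst (\<sigma> h)"]
    by (intro add_mono) (auto simp: card_insert_if)
  finally have cD: "card D \<le> 2 + (d + d)" .
  define X1 X2 where "X1 = {r \<in> ?H. fst r \<in> D}" and "X2 = {r \<in> ?H. fst (\<sigma> r) \<in> D}"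
  have "X1 \<subseteq> D \<times> {..<d}" by (auto simp: X1_def halves_def)
  then have "card X1 \<le> card (D \<times> {..<d})" using finD by (intro card_mono) auto
  also have "\<dots> \<le> (2 + (d + d)) * d" 
    using mult_right_mono[OF cD, of d] by (simp only: card_cartesian_product card_lessThan)
  finally have c1: "card X1 \<le> (2 + (d + d)) * d" .
  have "X2 \<subseteq> \<sigma> ` X1"
  proof
    fix r assume "r \<in> X2"
    then have "r \<in> ?H" "\<sigma> r \<in> X1" using pd(1) by (auto simp: X1_def X2_def)
    then show "r \<in> \<sigma> ` X1" using pd(3)[of r] by (metis imageI)
  qed
  then have "card X2 \<le> card X1"
    using card_image_le[of X1 \<sigma>] card_mono[of "\<sigma> ` X1" X2] by (auto simp: X1_def intro: le_trans)
  then have "card (X1 \<union> X2 \<union> bads ?H \<sigma>) \<le> 2 * ((2 + (d + d)) * d) + Suc b"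
    using card_Un_le[of "X1 \<union> X2" "bads ?H \<sigma>"] card_Un_le[of X1 X2] c1 \<sigma>'(2) by simp
  also have "\<dots> < card ?H" using N by (simp add: card_halves algebra_simps)
  finally have "\<not> ?H \<subseteq> X1 \<union> X2 \<union> bads ?H \<sigma>"
    using card_mono[of "X1 \<union> X2 \<union> bads ?H \<sigma>" ?H] by (auto simp: X1_def X2_def bads_def)
  then obtain r where r: "r \<in> ?H" "fst r \<notin> D" "fst (\<sigma> r) \<notin> D" "\<not> bad_half ?H \<sigma> r"
    by (auto simp: X1_def X2_def bads_def)
  have rne: "r \<noteq> h" "r \<noteq> \<sigma> h" using r(2) by (auto simp: D_def)
  have "bads ?H (switch \<sigma> h r) \<subseteq> bads ?H \<sigma> - {h}"
  proof (rule switch_bads[OF \<sigma>'(1) hH r(1)])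
    fix p q assume p: "p \<in> {h, \<sigma> h}" and q: "q \<in> {r, \<sigma> r}"
    show "fst q \<noteq> fst p" using p q r by (auto simp: D_def)
    fix y assume y: "y \<in> ?H" "fst y = fst p"
    then have "fst (\<sigma> y) \<in> nb (fst p)" by (auto simp: nb_def)
    then have "fst (\<sigma> y) \<in> D" using p by (auto simp: D_def)
    then show "fst (\<sigma> y) \<noteq> fst q" using q r by auto
  next
    show "fst (\<sigma> r) \<noteq> fst r" using r(4) by (auto simp: bad_half_def)
  qed
  then have "card (bads ?H (switch \<sigma> h r)) \<le> card (bads ?H \<sigma> - {h})"
    by (intro card_mono) (auto simp: bads_def)
  also have "\<dots> \<le> b" using h \<sigma>'(2) by (simp add: bads_def)
  finally have "switch \<sigma> h r \<in> few_bads n d b"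
    using switch_matchings[OF \<sigma>'(1) hH r(1) rne] by (simp add: few_bads_def)
  then show ?thesis using r(1) rne by blast
qed

text \<open>A matching with exactly b + 1 bad half-edges is switched to one with at most b,
  injectively once h, r and the old partner of h are recorded. The + 1 accounts for the matchings
  that have at most b already.\<close>

lemma few_bads_step:
  assumes "4 * d * (d + 1) + b + 1 < n * d"
  shows "card (few_bads n d (Suc b)) \<le> ((n * d) ^ 3 + 1) * card (few_bads n d b)"
proof -
  let ?H = "halves n d"
  define hh where "hh = (\<lambda>\<sigma>. SOME h. h \<in> bads ?H \<sigma>)"
  define rr where "rr = (\<lambda>\<sigma>. SOME r. r \<in> ?H \<and> r \<noteq> hh \<sigma> \<and> r \<noteq> \<sigma> (hh \<sigma>) \<and> switch \<sigma> (hh \<sigma>) r \<in> few_bads n d b)"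
  define f where "f = (\<lambda>\<sigma>. (switch \<sigma> (hh \<sigma>) (rr \<sigma>), hh \<sigma>, rr \<sigma>, \<sigma> (hh \<sigma>)))"
  let ?Y = "few_bads n d (Suc b) - few_bads n d b"
  have P: "hh \<sigma> \<in> ?H \<and> rr \<sigma> \<in> ?H \<and> rr \<sigma> \<noteq> hh \<sigma> \<and> rr \<sigma> \<noteq> \<sigma> (hh \<sigma>) \<and> switch \<sigma> (hh \<sigma>) (rr \<sigma>) \<in> few_bads n d b
     \<and> \<sigma> \<in> matchings ?H" if \<sigma>: "\<sigma> \<in> ?Y" for \<sigma>
  proof -
    have "bads ?H \<sigma> \<noteq> {}" using \<sigma> by (auto simp: few_bads_def)
    then have h: "hh \<sigma> \<in> bads ?H \<sigma>" unfolding hh_def by (metis ex_in_conv someI_ex)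
    have "\<exists>r. r \<in> ?H \<and> r \<noteq> hh \<sigma> \<and> r \<noteq> \<sigma> (hh \<sigma>) \<and> switch \<sigma> (hh \<sigma>) r \<in> few_bads n d b"
      using ex_switch[OF _ h assms] \<sigma> by blast
    then have "rr \<sigma> \<in> ?H \<and> rr \<sigma> \<noteq> hh \<sigma> \<and> rr \<sigma> \<noteq> \<sigma> (hh \<sigma>) \<and> switch \<sigma> (hh \<sigma>) (rr \<sigma>) \<in> few_bads n d b"
      unfolding rr_def by (rule someI_ex)
    moreover have "hh \<sigma> \<in> ?H" using h by (simp add: bads_def)
    moreover have "\<sigma> \<in> matchings ?H" using \<sigma> by (simp add: few_bads_def)
    ultimately show ?thesis by blast
  qed
  have "card ?Y \<le> card (few_bads n d b \<times> ?H \<times> ?H \<times> ?H)"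
  proof (rule card_inj_on_le[where f = f])
    show "inj_on f ?Y"
    proof (rule inj_onI)
      fix \<sigma> \<tau> assume s: "\<sigma> \<in> ?Y" and t: "\<tau> \<in> ?Y" and eq: "f \<sigma> = f \<tau>"
      have "switch \<sigma> (hh \<sigma>) (rr \<sigma>) = switch \<tau> (hh \<tau>) (rr \<tau>)" "hh \<sigma> = hh \<tau>" "rr \<sigma> = rr \<tau>" "\<sigma> (hh \<sigma>) = \<tau> (hh \<tau>)"
        using eq by (auto simp: f_def)
      then show "\<sigma> = \<tau>" using switch_switch[of \<sigma> ?H "hh \<sigma>" "rr \<sigma>"] switch_switch[of \<tau> ?H "hh \<tau>" "rr \<tau>"] P[OF s] P[OF t]
        by metis
    qed
    show "f ` ?Y \<subseteq> few_bads n d b \<times> ?H \<times> ?H \<times> ?H"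
    proof (rule image_subsetI)
      fix \<sigma> assume "\<sigma> \<in> ?Y"
      from P[OF this] show "f \<sigma> \<in> few_bads n d b \<times> ?H \<times> ?H \<times> ?H"
        using matchingsD(1) by (fastforce simp: f_def)
    qed
  qed (simp add: finite_few_bads)
  also have "\<dots> = (n * d) ^ 3 * card (few_bads n d b)"
    by (simp add: card_cartesian_product card_halves power3_eq_cube)
  finally have "card ?Y \<le> (n * d) ^ 3 * card (few_bads n d b)" .
  moreover have "card (few_bads n d (Suc b)) = card ?Y + card (few_bads n d b)"
    by (subst card_Diff_subset) (auto simp: finite_few_bads few_bads_def intro!: le_add_diff_inverse2[symmetric] card_mono finite_matchings
        finite_subset[OF _ finite_matchings[of ?H]])
  ultimately show ?thesis by simp
qed

lemma few_bads_le:
  assumes "4 * d * (d + 1) + b + 1 < n * d"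
  shows "card (few_bads n d b) \<le> ((n * d) ^ 3 + 1) ^ b * card (few_bads n d 0)"
  using assms
proof (induction b)
  case (Suc b)
  have "card (few_bads n d (Suc b)) \<le> ((n * d) ^ 3 + 1) * card (few_bads n d b)"
    by (rule few_bads_step) (use Suc.prems in simp)
  also have "\<dots> \<le> ((n * d) ^ 3 + 1) * (((n * d) ^ 3 + 1) ^ b * card (few_bads n d 0))"
    by (rule mult_left_mono) (use Suc in auto)
  finally show ?case by (simp only: power_Suc mult.assoc)
qed simp

text \<open>A matching without bad half-edges is a simple graph with a numbering of the neighbours
  of each vertex. The index at the far end of an edge is not lost: without multiple edges only one
  half-edge of w leads back to v.\<close>

lemma card_simple_matchings:
  assumes "0 < d"
  shows "card (few_bads n d 0) \<le> card (reg_graphs d n) * fact d ^ n"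
proof -
  let ?H = "halves n d"
  define num where "num = (\<lambda>(\<sigma> :: nat \<times> nat \<Rightarrow> nat \<times> nat). \<lambda>v\<in>{..<n}. \<lambda>i\<in>{..<d}. fst (\<sigma> (v, i)))"
  define gr where "gr = (\<lambda>(\<sigma> :: nat \<times> nat \<Rightarrow> nat \<times> nat). {(v, w). \<exists>i<d. v < n \<and> w = fst (\<sigma> (v, i))})"
  have simple: "fst (\<sigma> (v, i)) \<noteq> v" "j < d \<Longrightarrow> fst (\<sigma> (v, i)) = fst (\<sigma> (v, j)) \<Longrightarrow> i = j"
      "\<sigma> (v, i) \<in> ?H" "\<sigma> (\<sigma> (v, i)) = (v, i)"
    if "\<sigma> \<in> few_bads n d 0" "v < n" "i < d" for \<sigma> v i j
  proof -
    have s: "\<sigma> \<in> matchings ?H" "(v, i) \<in> ?H" using that by (auto simp: few_bads_def halves_def)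
    have "bads ?H \<sigma> = {}" using that by (auto simp: few_bads_def bads_def)
    then have b: "\<not> bad_half ?H \<sigma> (v, i)" using s(2) by (auto simp: bads_def)
    show "fst (\<sigma> (v, i)) \<noteq> v" using b by (auto simp: bad_half_def)
    show "i = j" if "j < d" "fst (\<sigma> (v, i)) = fst (\<sigma> (v, j))"
      using b that \<open>v < n\<close> by (force simp: bad_half_def halves_def)
    show "\<sigma> (v, i) \<in> ?H" "\<sigma> (\<sigma> (v, i)) = (v, i)" using matchingsD[OF s] by auto
  qed
  have gn: "gnbr (gr \<sigma>) v = (\<lambda>i. fst (\<sigma> (v, i))) ` {..<d}" if "v < n" for \<sigma> v
    using that by (auto simp: gnbr_def gr_def)
  have inj: "inj_on (\<lambda>i. fst (\<sigma> (v, i))) {..<d}" if "\<sigma> \<in> few_bads n d 0" "v < n" for \<sigma> v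
    using simple(2)[OF that] by (auto intro!: inj_onI)
  have gr: "gr \<sigma> \<in> reg_graphs d n" if \<sigma>: "\<sigma> \<in> few_bads n d 0" for \<sigma>
    unfolding reg_graphs_def
  proof (intro CollectI conjI allI impI subsetI)
    fix p assume "p \<in> gr \<sigma>"
    then obtain v i where "v < n" "i < d" "p = (v, fst (\<sigma> (v, i)))" by (auto simp: gr_def)
    then show "p \<in> {..<n} \<times> {..<n}" using simple(3)[OF \<sigma>, of v i] by (auto simp: halves_def)
  next
    fix u w assume "(u, w) \<in> gr \<sigma>"
    then obtain i where i: "i < d" "u < n" "w = fst (\<sigma> (u, i))" by (auto simp: gr_def)
    then have "\<sigma> (u, i) = (w, snd (\<sigma> (u, i)))" "w < n" "snd (\<sigma> (u, i)) < d"
      using simple(3)[OF \<sigma> i(2,1)] by (auto simp: halves_def prod_eq_iff)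
    moreover from this have "\<sigma> (w, snd (\<sigma> (u, i))) = (u, i)" using simple(4)[OF \<sigma> i(2,1)] by simp
    ultimately show "(w, u) \<in> gr \<sigma>" unfolding gr_def by (auto intro!: exI[of _ "snd (\<sigma> (u, i))"])
  next
    show "(u, u) \<notin> gr \<sigma>" for u using simple(1)[OF \<sigma>, of u] unfolding gr_def by force
  next
    fix u assume u: "u < n"
    show "card {w. (u, w) \<in> gr \<sigma>} = d"
      using gn[OF u, of \<sigma>] card_image[OF inj[OF \<sigma> u]] by (simp add: gnbr_def)
  qed
  have "card (few_bads n d 0) \<le> card (SIGMA G:reg_graphs d n. PiE {..<n} (numb d G))"
  proof (rule card_inj_on_le[where f = "\<lambda>\<sigma>. (gr \<sigma>, num \<sigma>)"])
    show "inj_on (\<lambda>\<sigma>. (gr \<sigma>, num \<sigma>)) (few_bads n d 0)"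
    proof (rule inj_onI)
      fix \<sigma> \<tau> assume s: "\<sigma> \<in> few_bads n d 0" and t: "\<tau> \<in> few_bads n d 0" and eq: "(gr \<sigma>, num \<sigma>) = (gr \<tau>, num \<tau>)"
      have f: "fst (\<sigma> (v, i)) = fst (\<tau> (v, i))" if "v < n" "i < d" for v i
      proof -
        have "num \<sigma> v i = num \<tau> v i" using eq by simp
        then show ?thesis using that by (simp add: num_def)
      qed
      show "\<sigma> = \<tau>"
      proof (rule extensionalityI[of _ ?H])
        show "\<sigma> \<in> extensional ?H" "\<tau> \<in> extensional ?H" using s t by (auto simp: few_bads_def matchings_def)
        fix x assume "x \<in> ?H"
        then obtain v i where x: "x = (v, i)" "v < n" "i < d" by (auto simp: halves_def)
        obtain w j where wj: "\<sigma> (v, i) = (w, j)" by fastforce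
        obtain j' where wj': "\<tau> (v, i) = (w, j')" using f[OF x(2,3)] wj by (metis fst_conv surj_pair)
        have wn: "w < n" "j < d" "j' < d" using simple(3)[OF s x(2,3)] simple(3)[OF t x(2,3)] wj wj' by (auto simp: halves_def)
        have "\<sigma> (w, j) = (v, i)" "\<tau> (w, j') = (v, i)" using simple(4)[OF s x(2,3)] simple(4)[OF t x(2,3)] wj wj' by auto
        then have "fst (\<sigma> (w, j)) = fst (\<sigma> (w, j'))" using f[OF wn(1,3)] by simp
        then have "j = j'" by (rule simple(2)[OF s wn(1,2) wn(3)])
        then show "\<sigma> x = \<tau> x" using x wj wj' by simp
      qed
    qed
    show "(\<lambda>\<sigma>. (gr \<sigma>, num \<sigma>)) ` few_bads n d 0 \<subseteq> (SIGMA G:reg_graphs d n. PiE {..<n} (numb d G))"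
    proof (rule image_subsetI)
      fix \<sigma> assume s: "\<sigma> \<in> few_bads n d 0"
      have "num \<sigma> v \<in> numb d (gr \<sigma>) v" if v: "v < n" for v
      proof -
        have "bij_betw (\<lambda>i. fst (\<sigma> (v, i))) {..<d} (gnbr (gr \<sigma>) v)"
          using inj[OF s v] gn[OF v] by (auto simp: bij_betw_def)
        then have "bij_betw (num \<sigma> v) {..<d} (gnbr (gr \<sigma>) v)"
          by (rule bij_betw_cong[THEN iffD1, rotated]) (use v in \<open>simp add: num_def\<close>)
        then show ?thesis using v by (simp add: numb_def num_def)
      qed
      then show "(gr \<sigma>, num \<sigma>) \<in> (SIGMA G:reg_graphs d n. PiE {..<n} (numb d G))"
        using gr[OF s] by (auto simp: num_def)
    qed
    show "finite (SIGMA G:reg_graphs d n. PiE {..<n} (numb d G))"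
      by (intro finite_SigmaI finite_reg_graphs finite_PiE) (auto intro: finite_numb)
  qed
  also have "\<dots> = (\<Sum>G\<in>reg_graphs d n. card (PiE {..<n} (numb d G)))"
    by (intro card_SigmaI finite_reg_graphs ballI finite_PiE) (auto intro: finite_numb)
  also have "\<dots> = (\<Sum>G\<in>reg_graphs d n. fact d ^ n)"
    by (intro sum.cong) (auto simp: card_PiE card_numb)
  finally show ?thesis by simp
qed

text \<open>Half of all matchings have at most 12 d^2 bad half-edges, and that many rounds of
  switching remove them. The number of rounds does not grow with n, so the loss is
  polynomial.\<close>

lemma num_matchings_le_reg_graphs:
  assumes "0 < d" "4 * d * (d + 1) + 12 * d\<^sup>2 + 5 < n * d"
  shows "num_matchings (n * d) \<le> 2 * ((n * d) ^ 3 + 1) ^ (12 * d\<^sup>2) * (card (reg_graphs d n) * fact d ^ n)"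
proof -
  have "num_matchings (n * d) \<le> 2 * card (few_bads n d (12 * d\<^sup>2))"
    using half_few_bads[of n d] assms by (simp add: few_bads_def)
  also have "\<dots> \<le> 2 * (((n * d) ^ 3 + 1) ^ (12 * d\<^sup>2) * card (few_bads n d 0))"
    by (intro mult_left_mono few_bads_le) (use assms in auto)
  also have "\<dots> \<le> 2 * (((n * d) ^ 3 + 1) ^ (12 * d\<^sup>2) * (card (reg_graphs d n) * fact d ^ n))"
    by (intro mult_left_mono card_simple_matchings assms) auto
  finally show ?thesis by (simp only: mult.assoc)
qed

section \<open>Vertices near short cycles\<close>

definition gball :: "(nat \<times> nat) set \<Rightarrow> nat \<Rightarrow> nat \<Rightarrow> nat set" where
  "gball G k v = {p. \<exists>m\<le>k. (v, p) \<in> G ^^ m}"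

text \<open>The k-ball of v, unfolded along some local cover, meets a vertex twice. At all other
  vertices the numberings and letters read along a cover sit at distinct graph vertices, hence are
  independent.\<close>

definition cyc_vert :: "nat \<Rightarrow> nat \<Rightarrow> (nat \<times> nat) set \<Rightarrow> nat \<Rightarrow> nat \<Rightarrow> bool" where
  "cyc_vert d n G k v \<longleftrightarrow> (\<exists>\<tau>\<in>local_covs d n G k. \<tau> [] = v \<and> \<not> inj_on \<tau> (tb d k))"

lemma gball_mono: "k \<le> l \<Longrightarrow> gball G k v \<subseteq> gball G l v"
  unfolding gball_def using le_trans by blast

lemma gball_self: "v \<in> gball G k v"
  unfolding gball_def by (auto intro: exI[of _ 0])

lemma gball_step: "p \<in> gball G k v \<Longrightarrow> (p, q) \<in> G \<Longrightarrow> q \<in> gball G (Suc k) v"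
proof -
  assume "p \<in> gball G k v" "(p, q) \<in> G"
  then obtain m where "m \<le> k" "(v, p) \<in> G ^^ m" by (auto simp: gball_def)
  then have "Suc m \<le> Suc k" "(v, q) \<in> G ^^ Suc m" using \<open>(p, q) \<in> G\<close> by auto
  then show ?thesis unfolding gball_def by blast
qed

lemma relpow_subset: "E \<subseteq> G \<Longrightarrow> (v, p) \<in> (E :: ('a \<times> 'a) set) ^^ m \<Longrightarrow> (v, p) \<in> G ^^ m"
  by (induction m arbitrary: p) auto

lemma gball_Suc: "gball G (Suc k) v = insert v (\<Union>p\<in>gball G k v. gnbr G p)"
proof
  show "gball G (Suc k) v \<subseteq> insert v (\<Union>p\<in>gball G k v. gnbr G p)"
  proof
    fix q assume "q \<in> gball G (Suc k) v"
    then obtain m where m: "m \<le> Suc k" "(v, q) \<in> G ^^ m" by (auto simp: gball_def)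
    then show "q \<in> insert v (\<Union>p\<in>gball G k v. gnbr G p)"
    proof (cases m)
      case (Suc j)
      then obtain p where "(v, p) \<in> G ^^ j" "(p, q) \<in> G" using m(2) by auto
      then show ?thesis using m(1) Suc by (auto simp: gball_def gnbr_def)
    qed auto
  qed
  show "insert v (\<Union>p\<in>gball G k v. gnbr G p) \<subseteq> gball G (Suc k) v"
    using gball_self gball_step by (auto simp: gnbr_def)
qed

lemma card_gball:
  assumes "G \<in> reg_graphs d n" "v < n"
  shows "finite (gball G k v) \<and> gball G k v \<subseteq> {..<n} \<and> card (gball G k v) \<le> (d + 1) ^ k"
proof (induction k)
  case 0
  have "gball G 0 v = {v}" by (auto simp: gball_def)
  then show ?case using assms by simp
next
  case (Suc k)
  let ?U = "\<Union>p\<in>gball G k v. gnbr G p"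
  have "card ?U \<le> (\<Sum>p\<in>gball G k v. card (gnbr G p))" by (rule card_UN_le) (use Suc in simp)
  also have "\<dots> = (\<Sum>p\<in>gball G k v. d)"
    using Suc reg_graphsD(5)[OF assms(1)] by (intro sum.cong) auto
  finally have U: "card ?U \<le> (d + 1) ^ k * d" using Suc by (simp add: le_trans[OF _ mult_right_mono])
  have finU: "finite ?U" using Suc reg_graphsD(7)[OF assms(1)] by auto
  have "card (insert v ?U) \<le> Suc (card ?U)" using finU by (simp add: card_insert_if)
  also have "\<dots> \<le> (d + 1) ^ k * d + (d + 1) ^ k" using U by (simp add: add.commute Suc_le_eq le_less_trans[OF U])
  finally have "card (insert v ?U) \<le> (d + 1) ^ Suc k" by (simp add: algebra_simps)
  then show ?case unfolding gball_Suc using finU assms(2) reg_graphsD(8)[OF assms(1)] by auto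
qed

lemma cov_edge:
  assumes "\<tau> \<in> local_covs d n G k" "x \<in> tverts d" "length x < k" "a < d"
  shows "(\<tau> x, \<tau> (tmul x a)) \<in> G"
  using assms by (auto simp: local_covs_eq gnbr_def bij_betw_def)

lemma cov_nbr_inj:
  assumes "\<tau> \<in> local_covs d n G k" "x \<in> tverts d" "length x < k" "a < d" "b < d" "\<tau> (tmul x a) = \<tau> (tmul x b)"
  shows "a = b"
  using assms by (auto simp: local_covs_eq bij_betw_def dest!: inj_onD)

lemma cov_walk:
  assumes "\<And>z a. z @ [a] \<in> tverts d \<Longrightarrow> prefix (z @ [a]) w \<Longrightarrow> (\<tau> z, \<tau> (z @ [a])) \<in> E" "w \<in> tverts d"
  shows "(\<tau> [], \<tau> w) \<in> E ^^ length w"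
  using assms
proof (induction w rule: rev_induct)
  case (snoc b w)
  have "(\<tau> [], \<tau> w) \<in> E ^^ length w"
    by (rule snoc.IH) (use snoc.prems in \<open>auto simp: snoc_in_tverts\<close>)
  moreover have "(\<tau> w, \<tau> (w @ [b])) \<in> E" by (rule snoc.prems(1)) (use snoc.prems in auto)
  ultimately show ?case by auto
qed simp

text \<open>Take two words with the same image whose longer length is minimal. The last edge on the
  way to the longer one closes a cycle, and by minimality neither the path to the start of that edge
  nor the path to the other word uses it. So its removal leaves both ends within distance k of
  v.\<close>

lemma cyc_vert_edge:
  assumes G: "G \<in> reg_graphs d n" and cyc: "cyc_vert d n G k v"
  shows "\<exists>p q. (p, q) \<in> G \<and> p \<in> gball (G - {(p, q), (q, p)}) k v \<and> q \<in> gball (G - {(p, q), (q, p)}) k v"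
proof -
  obtain \<tau> where \<tau>: "\<tau> \<in> local_covs d n G k" "\<tau> [] = v" "\<not> inj_on \<tau> (tb d k)"
    using cyc by (auto simp: cyc_vert_def)
  define Q where "Q = (\<lambda>L. \<exists>x y. x \<in> tverts d \<and> y \<in> tverts d \<and> x \<noteq> y \<and> length x \<le> length y \<and> length y = L \<and> L \<le> k \<and> \<tau> x = \<tau> y)"
  have "\<exists>L. Q L"
  proof -
    obtain x y where "x \<in> tb d k" "y \<in> tb d k" "x \<noteq> y" "\<tau> x = \<tau> y" using \<tau>(3) by (auto simp: inj_on_def)
    then show ?thesis unfolding Q_def tball_root
      by (cases "length x \<le> length y") (auto, metis nat_le_linear)
  qed
  define L where "L = (LEAST L. Q L)"
  have "Q L" unfolding L_def using \<open>\<exists>L. Q L\<close> by (rule LeastI_ex)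
  then obtain x y where xy: "x \<in> tverts d" "y \<in> tverts d" "x \<noteq> y" "length x \<le> L" "length y = L" "L \<le> k" "\<tau> x = \<tau> y"
    by (auto simp: Q_def)
  \<comment> \<open>Minimality of L: the cover is injective on words shorter than L.\<close>
  have inj: "z = w" if "z \<in> tverts d" "w \<in> tverts d" "length z < L" "length w < L" "\<tau> z = \<tau> w" for z w
  proof (rule ccontr)
    assume "z \<noteq> w"
    then have "Q (max (length z) (length w))"
      unfolding Q_def using that xy(6) by (cases "length z \<le> length w") (auto simp: max_def intro: exI[of _ z] exI[of _ w], metis nat_le_linear)
    then show False using Least_le[of Q "max (length z) (length w)"] that unfolding L_def[symmetric] by auto
  qed
  have yne: "y \<noteq> []" using xy by auto
  then obtain z0 b where y: "y = z0 @ [b]" by (metis rev_exhaust)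
  have z0: "z0 \<in> tverts d" "b < d" "tmul z0 b = y" "length z0 < L"
    using xy(2,5) y by (auto simp: snoc_in_tverts tmul_def)
  have edge: "(\<tau> z, \<tau> (z @ [a])) \<in> G" if "z @ [a] \<in> tverts d" "length (z @ [a]) \<le> k" for z a
    using cov_edge[OF \<tau>(1), of z a] that by (auto simp: snoc_in_tverts tmul_def split: if_splits)
  define p q where "p = \<tau> z0" and "q = \<tau> x"
  have pq: "(p, q) \<in> G" using edge[of z0 b] xy y by (simp add: p_def q_def)
  let ?E = "G - {(p, q), (q, p)}"
  \<comment> \<open>The alternative \<open>z @ [a] = x\<close> handles two colliding words of the
    same length L, where the last step to x is out of reach of \<open>inj\<close>.\<close>
  have key: "(\<tau> z, \<tau> (z @ [a])) \<in> ?E"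
    if za: "z @ [a] \<in> tverts d" "length (z @ [a]) < L \<or> (z @ [a] = x \<and> length x = L)" for z a
  proof -
    have zT: "z \<in> tverts d" "a < d" "length z < L" "tmul z a = z @ [a]"
      using za by (auto simp: snoc_in_tverts tmul_def)
    have g: "(\<tau> z, \<tau> (z @ [a])) \<in> G" by (rule edge) (use za xy in auto)
    have nl: "\<tau> z \<noteq> \<tau> (z @ [a])" using g reg_graphsD(4)[OF G] by auto
    have "\<not> (\<tau> z = p \<and> \<tau> (z @ [a]) = q \<or> \<tau> z = q \<and> \<tau> (z @ [a]) = p)"
    proof
      assume "\<tau> z = p \<and> \<tau> (z @ [a]) = q \<or> \<tau> z = q \<and> \<tau> (z @ [a]) = p"
      then consider "\<tau> z = p" "\<tau> (z @ [a]) = q" | "\<tau> z = q" "\<tau> (z @ [a]) = p" by blast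
      then show False
      proof cases
        case 1
        then have "z = z0" using inj[OF zT(1) z0(1) zT(3) z0(4)] by (simp add: p_def)
        then have "\<tau> (tmul z0 a) = \<tau> (tmul z0 b)" using 1 zT z0 xy(7) by (simp add: q_def)
        then have "a = b" 
          using cov_nbr_inj[OF \<tau>(1) z0(1) _ zT(2) z0(2)] z0(4) xy(6) by simp
        then show False using \<open>z = z0\<close> y za xy by auto
      next
        case 2
        show False
        proof (cases "length (z @ [a]) < L")
          case True
          then have "z @ [a] = z0" using inj[OF za(1) z0(1) True z0(4)] 2 by (simp add: p_def)
          then have "tmul z0 a = z" by (auto simp: tmul_def)
          then have "\<tau> (tmul z0 a) = \<tau> (tmul z0 b)" using 2 z0 xy(7) by (simp add: q_def)
          then have "a = b" 
          using cov_nbr_inj[OF \<tau>(1) z0(1) _ zT(2) z0(2)] z0(4) xy(6) by simp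
          then show False using xy(2) y \<open>z @ [a] = z0\<close> by (auto simp: snoc_in_tverts)
        next
          case False
          then have "z @ [a] = x" using za by auto
          then show False using 2 nl by (simp add: q_def)
        qed
      qed
    qed
    then show ?thesis using g by auto
  qed
  have "(\<tau> [], \<tau> z0) \<in> ?E ^^ length z0"
  proof (rule cov_walk)
    fix z a assume "z @ [a] \<in> tverts d" "prefix (z @ [a]) z0"
    then show "(\<tau> z, \<tau> (z @ [a])) \<in> ?E" using key z0(4) prefix_length_le by fastforce
  qed (rule z0)
  moreover have "(\<tau> [], \<tau> x) \<in> ?E ^^ length x"
  proof (rule cov_walk)
    fix z a assume za: "z @ [a] \<in> tverts d" "prefix (z @ [a]) x"
    show "(\<tau> z, \<tau> (z @ [a])) \<in> ?E"
    proof (rule key[OF za(1)])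
      obtain r where r: "x = (z @ [a]) @ r" using za(2) by (auto simp: prefix_def)
      then show "length (z @ [a]) < L \<or> (z @ [a] = x \<and> length x = L)"
        using xy(4) by (cases r) auto
    qed
  qed (rule xy)
  moreover have "length z0 \<le> k" "length x \<le> k" using z0 xy by auto
  ultimately have "p \<in> gball ?E k v" "q \<in> gball ?E k v"
    unfolding gball_def p_def[symmetric] q_def[symmetric] \<tau>(2) by blast+
  then show ?thesis using pq by blast
qed

section \<open>Switchings of edges in a regular graph\<close>

definition eswitch :: "(nat \<times> nat) set \<Rightarrow> nat \<Rightarrow> nat \<Rightarrow> nat \<Rightarrow> nat \<Rightarrow> (nat \<times> nat) set" where
  "eswitch G p q x y = G - {(p, q), (q, p), (x, y), (y, x)} \<union> {(p, x), (x, p), (q, y), (y, q)}"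

lemma eswitch_reg:
  assumes G: "G \<in> reg_graphs d n" and e: "(p, q) \<in> G" "(x, y) \<in> G"
    and far: "x \<noteq> p" "x \<noteq> q" "y \<noteq> p" "y \<noteq> q" "(p, x) \<notin> G" "(q, y) \<notin> G"
  shows "eswitch G p q x y \<in> reg_graphs d n"
proof -
  note g = reg_graphsD[OF G]
  have ne: "p \<noteq> q" "x \<noteq> y" using e g(4) by auto
  have lt: "p < n" "q < n" "x < n" "y < n" using e g(1,2) by blast+
  let ?G = "eswitch G p q x y"
  have swap: "card (insert b (gnbr G u - {a})) = d" if "(u, a) \<in> G" "(u, b) \<notin> G" for u a b
  proof -
    have "card (insert b (gnbr G u - {a})) = Suc (card (gnbr G u - {a}))"
      using that g(7)[of u] by (simp add: gnbr_def)
    also have "\<dots> = card (gnbr G u)" using that g(7)[of u] card_Suc_Diff1[of "gnbr G u" a] by (simp add: gnbr_def)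
    finally show ?thesis using g(1)[OF that(1)] g(5) by simp
  qed
  have deg: "card {w. (u, w) \<in> ?G} = d" if u: "u < n" for u
  proof -
    consider "u = p" | "u = q" | "u = x" | "u = y" | "u \<notin> {p, q, x, y}" by blast
    then show ?thesis
    proof cases
      case 1
      then have "{w. (u, w) \<in> ?G} = insert x (gnbr G p - {q})" using ne far by (auto simp: eswitch_def gnbr_def)
      then show ?thesis using swap[of p q x] e far by simp
    next
      case 2
      then have "{w. (u, w) \<in> ?G} = insert y (gnbr G q - {p})" using ne far by (auto simp: eswitch_def gnbr_def)
      then show ?thesis using swap[of q p y] e far g(3) by simp
    next
      case 3
      then have "{w. (u, w) \<in> ?G} = insert p (gnbr G x - {y})" using ne far by (auto simp: eswitch_def gnbr_def)
      then show ?thesis using swap[of x y p] e far g(3) by simp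
    next
      case 4
      then have "{w. (u, w) \<in> ?G} = insert q (gnbr G y - {x})" using ne far by (auto simp: eswitch_def gnbr_def)
      then show ?thesis using swap[of y x q] e far g(3) by simp
    next
      case 5
      then have "{w. (u, w) \<in> ?G} = gnbr G u" by (auto simp: eswitch_def gnbr_def)
      then show ?thesis using g(5)[OF u] by simp
    qed
  qed
  have "?G \<subseteq> {..<n} \<times> {..<n}" using lt g(1,2) by (auto simp: eswitch_def)
  moreover have "(w, u) \<in> ?G" if "(u, w) \<in> ?G" for u w using that g(3) by (auto simp: eswitch_def)
  moreover have "(u, u) \<notin> ?G" for u using g(4) far by (auto simp: eswitch_def)
  ultimately show ?thesis using deg by (simp add: reg_graphs_def)
qed

lemma eswitch_eswitch:
  assumes G: "G \<in> reg_graphs d n" and e: "(p, q) \<in> G" "(x, y) \<in> G"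
    and far: "x \<noteq> p" "x \<noteq> q" "y \<noteq> p" "y \<noteq> q" "(p, x) \<notin> G" "(q, y) \<notin> G"
  shows "eswitch (eswitch G p q x y) p x q y = G"
proof -
  note g = reg_graphsD[OF G]
  have "(q, p) \<in> G" "(y, x) \<in> G" "(x, p) \<notin> G" "(y, q) \<notin> G" using e far g(3) by blast+
  then show ?thesis using e far by (auto simp: eswitch_def)
qed

text \<open>A walk of length m from v leaves only vertices within distance m of v, so it survives
  any change of the edge set that keeps the edges starting there.\<close>

lemma walk_in_ball: "(v, p) \<in> (E :: (nat \<times> nat) set) ^^ m \<Longrightarrow> E \<subseteq> G \<Longrightarrow> (\<And>a b. (a, b) \<in> E \<Longrightarrow> a \<in> gball G m v \<Longrightarrow> (a, b) \<in> E') \<Longrightarrow> (v, p) \<in> E' ^^ m"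
proof (induction m arbitrary: p)
  case (Suc m)
  then obtain u where u: "(v, u) \<in> E ^^ m" "(u, p) \<in> E" by auto
  have 1: "(v, u) \<in> E' ^^ m"
    by (rule Suc.IH[OF u(1) Suc.prems(2)]) (use Suc.prems(3) gball_mono[of m "Suc m" G v] in auto)
  have "(v, u) \<in> G ^^ m" using relpow_subset[OF Suc.prems(2) u(1)] .
  then have "u \<in> gball G (Suc m) v" by (auto simp: gball_def intro: exI[of _ m])
  then have "(u, p) \<in> E'" using Suc.prems(3) u(2) by blast
  then show ?case using 1 by auto
qed simp

lemma card_reg_graph: "G \<in> reg_graphs d n \<Longrightarrow> card G = n * d"
proof -
  assume G: "G \<in> reg_graphs d n"
  have "G = (SIGMA v:{..<n}. gnbr G v)" using reg_graphsD(1)[OF G] by (auto simp: gnbr_def)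
  then have "card G = (\<Sum>v<n. card (gnbr G v))" using card_SigmaI[of "{..<n}" "gnbr G"] reg_graphsD(7)[OF G] by simp
  then show ?thesis using reg_graphsD(5)[OF G] by simp
qed

text \<open>Double counting. For each v near a cycle, switch the edge pq of
  \<open>cyc_vert_edge\<close> with an edge xy far from v; at least nd/2 ordered edges qualify. In
  the switched graph p and q are still within k of v, x is a neighbour of p and y one of q, so each
  graph is reached in at most n (D d)^2 ways, where D = (d+1)^k. The quotient is 2 d D^2.\<close>

lemma sum_cyc_vert:
  assumes d: "0 < d" and n: "4 * (d + 1) ^ (k + 1) \<le> n"
  shows "(\<Sum>G\<in>reg_graphs d n. card {v. v < n \<and> cyc_vert d n G k v}) \<le> 2 * d * ((d + 1) ^ k) ^ 2 * card (reg_graphs d n)"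
proof -
  let ?R = "reg_graphs d n"
  define b where "b = (\<lambda>G. card {v. v < n \<and> cyc_vert d n G k v})"
  define P where "P = (\<lambda>G v. SOME pq. pq \<in> G \<and> fst pq \<in> gball (G - {pq, (snd pq, fst pq)}) k v \<and> snd pq \<in> gball (G - {pq, (snd pq, fst pq)}) k v)"
  have P: "P G v \<in> G" "fst (P G v) \<in> gball (G - {P G v, (snd (P G v), fst (P G v))}) k v" "snd (P G v) \<in> gball (G - {P G v, (snd (P G v), fst (P G v))}) k v"
    if cyc: "G \<in> ?R" "cyc_vert d n G k v" for G v
  proof -
    obtain p q where pq: "(p, q) \<in> G" "p \<in> gball (G - {(p, q), (q, p)}) k v" "q \<in> gball (G - {(p, q), (q, p)}) k v"
      using cyc_vert_edge[OF cyc] by blast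
    have "\<exists>pq. pq \<in> G \<and> fst pq \<in> gball (G - {pq, (snd pq, fst pq)}) k v \<and> snd pq \<in> gball (G - {pq, (snd pq, fst pq)}) k v"
      by (rule exI[of _ "(p, q)"]) (use pq in auto)
    from someI_ex[OF this]
    show "P G v \<in> G" "fst (P G v) \<in> gball (G - {P G v, (snd (P G v), fst (P G v))}) k v" "snd (P G v) \<in> gball (G - {P G v, (snd (P G v), fst (P G v))}) k v"
      unfolding P_def by blast+
  qed
  \<comment> \<open>Avoiding the (k+1)-ball, not just the k-ball, ensures that px and qy are not
    edges yet.\<close>
  define X where "X = (\<lambda>G v. {(x, y) \<in> G. x \<notin> gball G (k + 1) v \<and> y \<notin> gball G (k + 1) v})"
  define Dom where "Dom = (SIGMA G:?R. SIGMA v:{v. v < n \<and> cyc_vert d n G k v}. X G v)"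
  define Cod where "Cod = (SIGMA G:?R. SIGMA v:{..<n}. SIGMA p:gball G k v. SIGMA q:gball G k v. gnbr G p \<times> gnbr G q)"
  define f where "f = (\<lambda>(G, v, x, y). let (p, q) = P G v in (eswitch G p q x y, v, p, q, x, y))"
  let ?D = "(d + 1) ^ k"
  have finX: "finite (X G v)" if "G \<in> ?R" for G v
    using reg_graphsD(6)[OF that] by (rule finite_subset[rotated]) (auto simp: X_def)
  \<comment> \<open>At most (d+1)^(k+1) d ordered edges start in the (k+1)-ball and as many end
    there; by the lower bound on n this is at most half of all nd.\<close>
  have cX: "n * d \<le> 2 * card (X G v)" if G: "G \<in> ?R" and v: "v < n" for G v
  proof -
    let ?B = "gball G (k + 1) v"
    have B: "finite ?B" "?B \<subseteq> {..<n}" "card ?B \<le> (d + 1) ^ (k + 1)" using card_gball[OF G v, of "k + 1"] by blast+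
    let ?S = "SIGMA x:?B. gnbr G x"
    have "card ?S = (\<Sum>x\<in>?B. card (gnbr G x))" using B reg_graphsD(7)[OF G] by simp
    also have "\<dots> = card ?B * d" using B reg_graphsD(5)[OF G] by (simp add: subset_iff)
    finally have cS: "card ?S \<le> (d + 1) ^ (k + 1) * d" using B by (simp add: mult_right_mono)
    have finS: "finite ?S" using B reg_graphsD(7)[OF G] by auto
    have "G \<subseteq> X G v \<union> ?S \<union> prod.swap ` ?S"
    proof
      fix e assume e: "e \<in> G"
      obtain x y where xy: "e = (x, y)" by fastforce
      have "(y, x) \<in> G" using e xy reg_graphsD(3)[OF G] by blast
      then have "y \<in> ?B \<Longrightarrow> e \<in> prod.swap ` ?S" using xy by (auto simp: gnbr_def intro!: image_eqI[of _ _ "(y, x)"])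
      then show "e \<in> X G v \<union> ?S \<union> prod.swap ` ?S" using e xy by (auto simp: X_def gnbr_def)
    qed
    then have "card G \<le> card (X G v \<union> ?S \<union> prod.swap ` ?S)"
      by (intro card_mono finite_UnI finite_imageI finS finX G)
    also have "\<dots> \<le> card (X G v) + card ?S + card ?S"
      using card_Un_le[of "X G v \<union> ?S" "prod.swap ` ?S"] card_Un_le[of "X G v" ?S] card_image_le[OF finS, of prod.swap] by linarith
    finally have "n * d \<le> card (X G v) + 2 * ((d + 1) ^ (k + 1) * d)"
      using cS card_reg_graph[OF G] by linarith
    moreover have "4 * ((d + 1) ^ (k + 1) * d) \<le> n * d" using mult_right_mono[OF n, of d] by (simp only: mult.assoc)
    ultimately show ?thesis by linarith
  qed
  have "(\<Sum>G\<in>?R. b G) * (n * d) \<le> 2 * card Dom"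
  proof -
    have finb: "finite {v. v < n \<and> cyc_vert d n G k v}" for G by simp
    have "card Dom = (\<Sum>G\<in>?R. card (SIGMA v:{v. v < n \<and> cyc_vert d n G k v}. X G v))"
      unfolding Dom_def by (intro card_SigmaI finite_reg_graphs ballI finite_SigmaI finb finX)
    also have "\<dots> = (\<Sum>G\<in>?R. \<Sum>v\<in>{v. v < n \<and> cyc_vert d n G k v}. card (X G v))"
      by (intro sum.cong refl card_SigmaI finb ballI finX)
    finally have cD: "2 * card Dom = (\<Sum>G\<in>?R. \<Sum>v\<in>{v. v < n \<and> cyc_vert d n G k v}. 2 * card (X G v))"
      by (simp add: sum_distrib_left)
    have "(\<Sum>G\<in>?R. b G) * (n * d) = (\<Sum>G\<in>?R. \<Sum>v\<in>{v. v < n \<and> cyc_vert d n G k v}. n * d)"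
      by (simp add: b_def sum_distrib_right)
    also have "\<dots> \<le> 2 * card Dom" unfolding cD by (intro sum_mono cX) auto
    finally show ?thesis .
  qed
  also have "card Dom \<le> card Cod"
  proof (rule card_inj_on_le[where f = f])
    have main: "eswitch G p q x y \<in> ?R \<and> p \<in> gball (eswitch G p q x y) k v \<and> q \<in> gball (eswitch G p q x y) k v \<and>
        x \<in> gnbr (eswitch G p q x y) p \<and> y \<in> gnbr (eswitch G p q x y) q \<and> eswitch (eswitch G p q x y) p x q y = G"
      if D: "(G, v, x, y) \<in> Dom" and pq: "P G v = (p, q)" for G v x y p q
    proof -
      have G: "G \<in> ?R" and cyc: "cyc_vert d n G k v" and xy: "(x, y) \<in> G" "x \<notin> gball G (k + 1) v" "y \<notin> gball G (k + 1) v"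
        using D by (auto simp: Dom_def X_def)
      let ?E = "G - {(p, q), (q, p)}" and ?G = "eswitch G p q x y"
      have p: "(p, q) \<in> G" "p \<in> gball ?E k v" "q \<in> gball ?E k v" using P[OF G cyc] pq by auto
      have EG: "gball ?E k v \<subseteq> gball G k v" unfolding gball_def using relpow_subset[of ?E G] by blast
      have pG: "p \<in> gball G k v" "q \<in> gball G k v" using p EG by auto
      have nb: "(p, x) \<notin> G" "(q, y) \<notin> G" using gball_step[OF pG(1)] gball_step[OF pG(2)] xy by auto
      have m: "gball G k v \<subseteq> gball G (k + 1) v" by (rule gball_mono) simp
      have ne: "x \<noteq> p" "x \<noteq> q" "y \<noteq> p" "y \<noteq> q" using pG m xy by auto
      \<comment> \<open>The walk already avoids pq, and the only other edge removed, xy, lies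
        outside the ball in which the walk moves.\<close>
      have stay: "r \<in> gball ?G k v" if "r \<in> gball ?E k v" for r
      proof -
        obtain j where j: "j \<le> k" "(v, r) \<in> ?E ^^ j" using \<open>r \<in> gball ?E k v\<close> by (auto simp: gball_def)
        have "(v, r) \<in> ?G ^^ j"
        proof (rule walk_in_ball[OF j(2), of G])
          fix a c assume "(a, c) \<in> ?E" "a \<in> gball G j v"
          moreover have "gball G j v \<subseteq> gball G (k + 1) v" by (rule gball_mono) (use j in simp)
          ultimately show "(a, c) \<in> ?G" using xy by (auto simp: eswitch_def)
        qed auto
        then show ?thesis using j(1) by (auto simp: gball_def)
      qed
      show ?thesis
        using eswitch_reg[OF G p(1) xy(1) ne nb] eswitch_eswitch[OF G p(1) xy(1) ne nb] stay p
        by (auto simp: gnbr_def eswitch_def)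
    qed
    show "inj_on f Dom"
    proof (rule inj_onI)
      fix s t assume s: "s \<in> Dom" and t: "t \<in> Dom" and eq: "f s = f t"
      obtain G v x y where s': "s = (G, v, x, y)" by (cases s)
      obtain G' v' x' y' where t': "t = (G', v', x', y')" by (cases t)
      obtain p q where pq: "P G v = (p, q)" by fastforce
      obtain p' q' where pq': "P G' v' = (p', q')" by fastforce
      have eq': "eswitch G p q x y = eswitch G' p' q' x' y'" "v = v'" "p = p'" "q = q'" "x = x'" "y = y'"
        using eq by (auto simp: f_def s' t' pq pq')
      then have "G = G'" using main[OF s[unfolded s'] pq] main[OF t[unfolded t'] pq'] by metis
      then show "s = t" using eq' s' t' by simp
    qed
    show "f ` Dom \<subseteq> Cod"
    proof (rule image_subsetI)
      fix s assume s: "s \<in> Dom"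
      obtain G v x y where s': "s = (G, v, x, y)" by (cases s)
      obtain p q where pq: "P G v = (p, q)" by fastforce
      have "v < n" using s by (auto simp: s' Dom_def)
      then show "f s \<in> Cod" using main[OF s[unfolded s'] pq] by (simp add: f_def s' pq Cod_def)
    qed
    show "finite Cod" unfolding Cod_def
      using card_gball reg_graphsD(7) by (intro finite_SigmaI finite_reg_graphs finite_cartesian_product) auto
  qed
  also have "card Cod \<le> card ?R * (n * (?D * (?D * (d * d))))"
  proof -
    have fg: "finite (gball G k v)" "card (gball G k v) \<le> ?D" "gball G k v \<subseteq> {..<n}" if "G \<in> ?R" "v < n" for G v
      using card_gball[OF that] by auto
    have fn: "finite (gnbr G p \<times> gnbr G q)" if "G \<in> ?R" for G p q using reg_graphsD(7)[OF that] by auto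
    have "card Cod = (\<Sum>G\<in>?R. \<Sum>v<n. \<Sum>p\<in>gball G k v. \<Sum>q\<in>gball G k v. card (gnbr G p \<times> gnbr G q))"
      unfolding Cod_def
      by (subst card_SigmaI, simp add: finite_reg_graphs, use fg fn in blast, intro sum.cong refl,
          subst card_SigmaI, simp, use fg fn in blast, intro sum.cong refl,
          subst card_SigmaI, use fg fn in blast, use fg fn in blast, intro sum.cong refl,
          subst card_SigmaI, use fg fn in blast, use fg fn in blast, rule refl)
    also have "\<dots> = (\<Sum>G\<in>?R. \<Sum>v<n. \<Sum>p\<in>gball G k v. \<Sum>q\<in>gball G k v. d * d)"
    proof (intro sum.cong refl)
      fix G v p q assume *: "G \<in> ?R" "v \<in> {..<n}" "p \<in> gball G k v" "q \<in> gball G k v"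
      then have "p < n" "q < n" using subsetD[OF fg(3)[of G v]] by auto
      then show "card (gnbr G p \<times> gnbr G q) = d * d"
        using reg_graphsD(5)[OF *(1)] by (simp add: card_cartesian_product)
    qed
    also have "\<dots> = (\<Sum>G\<in>?R. \<Sum>v<n. card (gball G k v) * (card (gball G k v) * (d * d)))" by simp
    also have "\<dots> \<le> (\<Sum>G\<in>?R. \<Sum>v<n. ?D * (?D * (d * d)))"
      by (intro sum_mono mult_mono fg(2)) simp_all
    finally show ?thesis by simp
  qed
  finally have "(\<Sum>G\<in>?R. b G) * (n * d) \<le> 2 * (card ?R * (n * (?D * (?D * (d * d)))))" by simp
  also have "\<dots> = (2 * d * ?D\<^sup>2 * card ?R) * (n * d)" by (simp add: power2_eq_square mult_ac)
  finally have le: "(\<Sum>G\<in>?R. b G) * (n * d) \<le> (2 * d * ?D\<^sup>2 * card ?R) * (n * d)" .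
  have "0 < n" using n by (cases n) auto
  then have "0 < n * d" using d by simp
  then show ?thesis using le mult_le_cancel2 unfolding b_def by blast
qed

section \<open>Concentration\<close>

text \<open>R is a dependency graph: only pairs with \<open>R v w\<close> contribute to the
  variance, at most D for each v, and each contributes at most M.\<close>

lemma chebyshev_sum:
  fixes P :: "'w pmf" and Z :: "'v \<Rightarrow> 'w \<Rightarrow> real" and M :: real
  assumes fin: "finite (set_pmf P)" "finite V"
    and indep: "\<And>v w. v \<in> V \<Longrightarrow> w \<in> V \<Longrightarrow> \<not> R v w \<Longrightarrow>
      measure_pmf.expectation P (\<lambda>\<omega>. Z v \<omega> * Z w \<omega>) = measure_pmf.expectation P (Z v) * measure_pmf.expectation P (Z w)"
    and D: "\<And>v. v \<in> V \<Longrightarrow> card {w \<in> V. R v w} \<le> D"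
    and M: "\<And>v. v \<in> V \<Longrightarrow> measure_pmf.expectation P (\<lambda>\<omega>. (Z v \<omega>)\<^sup>2) \<le> M" and t: "0 < t"
  shows "measure_pmf.prob P {\<omega>. t \<le> \<bar>(\<Sum>v\<in>V. Z v \<omega>) - (\<Sum>v\<in>V. measure_pmf.expectation P (Z v))\<bar>} \<le> card V * (D * M) / t\<^sup>2"
proof (cases "V = {}")
  case True
  then show ?thesis using t by simp
next
  case False
  have int [simp]: "integrable (measure_pmf P) f" for f :: "'w \<Rightarrow> real"
    by (rule integrable_measure_pmf_finite[OF fin(1)])
  let ?E = "measure_pmf.expectation P"
  have M0: "0 \<le> M"
  proof -
    obtain v where "v \<in> V" using False by blast
    moreover have "0 \<le> ?E (\<lambda>\<omega>. (Z v \<omega>)\<^sup>2)" by simp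
    ultimately show ?thesis using M by (meson order_trans)
  qed
  define m where "m = (\<lambda>v. ?E (Z v))"
  define c where "c = (\<lambda>v w. ?E (\<lambda>\<omega>. (Z v \<omega> - m v) * (Z w \<omega> - m w)))"
  have c_eq: "c v w = ?E (\<lambda>\<omega>. Z v \<omega> * Z w \<omega>) - m v * m w" for v w
  proof -
    have "c v w = ?E (\<lambda>\<omega>. Z v \<omega> * Z w \<omega> - m w * Z v \<omega> - m v * Z w \<omega> + m v * m w)"
      unfolding c_def by (rule Bochner_Integration.integral_cong) (auto simp: algebra_simps)
    also have "\<dots> = ?E (\<lambda>\<omega>. Z v \<omega> * Z w \<omega>) - m w * m v - m v * m w + m v * m w"
      by (simp add: m_def)
    finally show ?thesis by simp
  qed
  have c_diag: "c v v \<le> M" if "v \<in> V" for v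
    using M[OF that] unfolding c_eq power2_eq_square by (smt (verit) zero_le_square)
  have c_le: "c v w \<le> (if R v w then M else 0)" if vw: "v \<in> V" "w \<in> V" for v w
  proof (cases "R v w")
    case True
    \<comment> \<open>A covariance is at most the average of the two variances, by ab <= (a^2 + b^2)
      / 2.\<close>
    have "c v w \<le> ?E (\<lambda>\<omega>. ((Z v \<omega> - m v) * (Z v \<omega> - m v) + (Z w \<omega> - m w) * (Z w \<omega> - m w)) / 2)"
      unfolding c_def
    proof (rule integral_mono)
      fix \<omega> show "(Z v \<omega> - m v) * (Z w \<omega> - m w) \<le> ((Z v \<omega> - m v) * (Z v \<omega> - m v) + (Z w \<omega> - m w) * (Z w \<omega> - m w)) / 2"
        using zero_le_square[of "(Z v \<omega> - m v) - (Z w \<omega> - m w)"] by (simp add: algebra_simps)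
    qed simp_all
    also have "\<dots> = (c v v + c w w) / 2" unfolding c_def by simp
    also have "\<dots> \<le> M" using c_diag[OF vw(1)] c_diag[OF vw(2)] by simp
    finally show ?thesis using True by simp
  next
    case False
    then show ?thesis using indep[OF vw] by (simp add: c_eq m_def)
  qed
  let ?X = "\<lambda>\<omega>. \<Sum>v\<in>V. Z v \<omega>"
  have EX: "?E ?X = (\<Sum>v\<in>V. m v)" by (simp add: m_def)
  have "measure_pmf.variance P ?X = ?E (\<lambda>\<omega>. \<Sum>v\<in>V. \<Sum>w\<in>V. (Z v \<omega> - m v) * (Z w \<omega> - m w))"
    unfolding EX by (simp add: sum_subtractf[symmetric] power2_eq_square sum_product)
  also have "\<dots> = (\<Sum>v\<in>V. \<Sum>w\<in>V. c v w)" unfolding c_def by simp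
  also have "\<dots> \<le> (\<Sum>v\<in>V. \<Sum>w\<in>V. if R v w then M else 0)" by (intro sum_mono c_le)
  also have "\<dots> = (\<Sum>v\<in>V. card {w \<in> V. R v w} * M)"
    using fin(2) by (intro sum.cong) (simp_all add: sum.If_cases Int_def)
  also have "\<dots> \<le> (\<Sum>v\<in>V. D * M)" using D M0 by (intro sum_mono mult_right_mono) auto
  finally have var: "measure_pmf.variance P ?X \<le> card V * (D * M)" by simp
  have "measure_pmf.prob P {\<omega> \<in> space (measure_pmf P). t \<le> \<bar>?X \<omega> - ?E ?X\<bar>} \<le> measure_pmf.variance P ?X / t\<^sup>2"
    by (rule measure_pmf.Chebyshev_inequality) (use t in simp_all)
  also have "\<dots> \<le> card V * (D * M) / t\<^sup>2" using var by (rule divide_right_mono) simp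
  finally show ?thesis by (simp add: EX m_def)
qed

lemma expectation_pair_pmf_prod:
  fixes f :: "'a \<Rightarrow> real" and g :: "'b \<Rightarrow> real"
  assumes "finite (set_pmf p)" "finite (set_pmf q)"
  shows "measure_pmf.expectation (pair_pmf p q) (\<lambda>x. f (fst x) * g (snd x))
     = measure_pmf.expectation p f * measure_pmf.expectation q g"
proof -
  have "measure_pmf.expectation (pair_pmf p q) (\<lambda>x. f (fst x) * g (snd x))
    = (\<Sum>x\<in>set_pmf p \<times> set_pmf q. (f (fst x) * g (snd x)) * pmf (pair_pmf p q) x)"
    by (rule integral_measure_pmf_real) (use assms in auto)
  also have "\<dots> = (\<Sum>a\<in>set_pmf p. \<Sum>b\<in>set_pmf q. (f a * pmf p a) * (g b * pmf q b))"
    unfolding sum.cartesian_product by (intro sum.cong) (auto simp: pmf_pair)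
  also have "\<dots> = (\<Sum>a\<in>set_pmf p. f a * pmf p a) * (\<Sum>b\<in>set_pmf q. g b * pmf q b)"
    by (simp add: sum_product)
  also have "(\<Sum>a\<in>set_pmf p. f a * pmf p a) = measure_pmf.expectation p f"
    by (rule integral_measure_pmf_real[symmetric]) (use assms in auto)
  also have "(\<Sum>b\<in>set_pmf q. g b * pmf q b) = measure_pmf.expectation q g"
    by (rule integral_measure_pmf_real[symmetric]) (use assms in auto)
  finally show ?thesis .
qed

lemma finite_set_Pi_pmf:
  assumes "finite A" "\<And>x. x \<in> A \<Longrightarrow> finite (set_pmf (Q x))"
  shows "finite (set_pmf (Pi_pmf A dflt Q))"
  using assms by (simp add: set_Pi_pmf finite_PiE_dflt)

text \<open>Locality of f and g is asked for on the support only, because \<open>pat_local\<close>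
  is available only for genuine numberings.\<close>

lemma expectation_Pi_pmf_indep:
  fixes f g :: "('a \<Rightarrow> 'b) \<Rightarrow> real"
  assumes fin: "finite A" "\<And>x. x \<in> A \<Longrightarrow> finite (set_pmf (Q x))"
    and f: "\<And>\<omega> \<omega>'. \<omega> \<in> set_pmf (Pi_pmf A dflt Q) \<Longrightarrow> \<omega>' \<in> set_pmf (Pi_pmf A dflt Q) \<Longrightarrow> (\<And>x. x \<in> B \<Longrightarrow> \<omega> x = \<omega>' x) \<Longrightarrow> f \<omega> = f \<omega>'"
    and g: "\<And>\<omega> \<omega>'. \<omega> \<in> set_pmf (Pi_pmf A dflt Q) \<Longrightarrow> \<omega>' \<in> set_pmf (Pi_pmf A dflt Q) \<Longrightarrow> (\<And>x. x \<in> C \<Longrightarrow> \<omega> x = \<omega>' x) \<Longrightarrow> g \<omega> = g \<omega>'"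
    and disj: "B \<inter> C = {}" "B \<subseteq> A" "C \<subseteq> A"
  shows "measure_pmf.expectation (Pi_pmf A dflt Q) (\<lambda>\<omega>. f \<omega> * g \<omega>)
     = measure_pmf.expectation (Pi_pmf A dflt Q) f * measure_pmf.expectation (Pi_pmf A dflt Q) g"
proof -
  let ?P1 = "Pi_pmf B dflt Q" and ?P2 = "Pi_pmf (A - B) dflt Q"
  let ?m = "\<lambda>(u, w) x. if x \<in> B then u x else w x"
  have finB: "finite B" "finite (A - B)" using fin disj by (auto intro: finite_subset)
  have P: "Pi_pmf A dflt Q = map_pmf ?m (pair_pmf ?P1 ?P2)"
    using Pi_pmf_union[of B "A - B" dflt Q] finB disj by (simp add: Un_absorb1 Un_Diff_cancel)
  have fin1: "finite (set_pmf ?P1)" "finite (set_pmf ?P2)"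
    using finB fin disj by (auto intro!: finite_set_Pi_pmf)
  obtain u0 w0 where u0: "u0 \<in> set_pmf ?P1" and w0: "w0 \<in> set_pmf ?P2"
    using set_pmf_not_empty[of ?P1] set_pmf_not_empty[of ?P2] by blast
  have supp: "?m (u, w) \<in> set_pmf (Pi_pmf A dflt Q)" if "u \<in> set_pmf ?P1" "w \<in> set_pmf ?P2" for u w
    unfolding P using that by (auto intro!: image_eqI[of _ _ "(u, w)"])
  \<comment> \<open>The missing coordinates are filled in with a fixed point of the support;
    locality makes the result independent of that point.\<close>
  define f' g' where "f' = (\<lambda>u. f (?m (u, w0)))" and "g' = (\<lambda>w. g (?m (u0, w)))"
  have f': "f (?m (u, w)) = f' u" if "u \<in> set_pmf ?P1" "w \<in> set_pmf ?P2" for u w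
    unfolding f'_def by (rule f) (use that supp w0 in auto)
  have g': "g (?m (u, w)) = g' w" if "u \<in> set_pmf ?P1" "w \<in> set_pmf ?P2" for u w
    unfolding g'_def by (rule g) (use that supp u0 disj in auto)
  have "measure_pmf.expectation (Pi_pmf A dflt Q) (\<lambda>\<omega>. f \<omega> * g \<omega>)
     = measure_pmf.expectation (pair_pmf ?P1 ?P2) (\<lambda>x. f' (fst x) * g' (snd x))"
    unfolding P integral_map_pmf by (rule integral_cong_AE) (auto simp: AE_measure_pmf_iff f'[simplified] g'[simplified])
  also have "\<dots> = measure_pmf.expectation ?P1 f' * measure_pmf.expectation ?P2 g'"
    by (rule expectation_pair_pmf_prod[OF fin1])
  also have "measure_pmf.expectation ?P1 f' = measure_pmf.expectation (pair_pmf ?P1 ?P2) (\<lambda>x. f' (fst x) * (\<lambda>_. 1) (snd x))"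
    unfolding expectation_pair_pmf_prod[OF fin1] by simp
  also have "\<dots> = measure_pmf.expectation (Pi_pmf A dflt Q) f"
    unfolding P integral_map_pmf by (rule integral_cong_AE) (auto simp: AE_measure_pmf_iff f'[simplified])
  also have "measure_pmf.expectation ?P2 g' = measure_pmf.expectation (pair_pmf ?P1 ?P2) (\<lambda>x. (\<lambda>_. 1) (fst x) * g' (snd x))"
    unfolding expectation_pair_pmf_prod[OF fin1] by simp
  also have "\<dots> = measure_pmf.expectation (Pi_pmf A dflt Q) g"
    unfolding P integral_map_pmf by (rule integral_cong_AE) (auto simp: AE_measure_pmf_iff g'[simplified])
  finally show ?thesis .
qed

lemma prob_pair_pmf_Times:
  "measure_pmf.prob (pair_pmf p q) (A \<times> B) = measure_pmf.prob p A * measure_pmf.prob q B"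
proof -
  have "measure_pmf.prob (pair_pmf p q) (A \<times> B) = measure_pmf.prob (pair_pmf p q) ((A \<times> B) \<inter> set_pmf (pair_pmf p q))"
    by (rule measure_Int_set_pmf[symmetric])
  also have "(A \<times> B) \<inter> set_pmf (pair_pmf p q) = (A \<inter> set_pmf p) \<times> (B \<inter> set_pmf q)" by auto
  also have "measure_pmf.prob (pair_pmf p q) \<dots> = measure_pmf.prob p (A \<inter> set_pmf p) * measure_pmf.prob q (B \<inter> set_pmf q)"
    by (rule measure_pmf_prob_product) (auto intro: countable_Int2)
  finally show ?thesis by (simp add: measure_Int_set_pmf)
qed

text \<open>One numbering for each graph vertex, shared by all tree vertices above it, in contrast
  to \<open>seeds\<close>. The product form gives both independence at a distance and the point
  probabilities \<open>pmf_LP\<close> used for counting.\<close>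

definition label_pmf :: "nat \<Rightarrow> nat \<Rightarrow> (nat \<times> nat) set \<Rightarrow> (nat \<Rightarrow> 'f pmf) \<Rightarrow> (nat \<Rightarrow> (nat \<Rightarrow> nat) \<times> 'f) pmf" where
  "label_pmf d n G q = Pi_pmf {..<n} undefined (\<lambda>v. pair_pmf (pmf_of_set (numb d G v)) (q v))"

definition pat :: "nat \<Rightarrow> nat \<Rightarrow> (nat \<Rightarrow> (nat \<Rightarrow> nat) \<times> 'f) \<Rightarrow> nat \<Rightarrow> nat list \<Rightarrow> 'f" where
  "pat d k \<omega> v = (\<lambda>x\<in>tb d k. snd (\<omega> (cov d (\<lambda>_ u. fst (\<omega> u)) v 0 x)))"

lemma bex_eq_iff: "c \<in> L \<Longrightarrow> (\<exists>x\<in>L. c = x \<and> R x) \<longleftrightarrow> R c"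
  by blast

locale labelled =
  fixes d n :: nat and G :: "(nat \<times> nat) set" and q :: "nat \<Rightarrow> 'f::finite pmf" and k :: nat
  assumes d_pos: "0 < d" and n_pos: "0 < n" and G: "G \<in> reg_graphs d n"
begin

abbreviation "LP \<equiv> label_pmf d n G q"

lemma set_LP: "\<omega> \<in> set_pmf LP \<longleftrightarrow> (\<forall>v<n. fst (\<omega> v) \<in> numb d G v \<and> snd (\<omega> v) \<in> set_pmf (q v)) \<and> (\<forall>v. \<not> v < n \<longrightarrow> \<omega> v = undefined)"
proof -
  have "set_pmf LP = PiE_dflt {..<n} undefined (\<lambda>v. numb d G v \<times> set_pmf (q v))"
    unfolding label_pmf_def
    by (auto simp: set_Pi_pmf PiE_dflt_def set_pmf_of_set[OF numb_nonempty[OF G] finite_numb[OF G]])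
  then show ?thesis by (auto simp: PiE_dflt_def mem_Times_iff)
qed

lemma finite_LP: "finite (set_pmf LP)"
  unfolding label_pmf_def
  by (rule finite_set_Pi_pmf) (auto simp: set_pmf_of_set[OF numb_nonempty[OF G] finite_numb[OF G]] finite_numb[OF G])

lemma numbering_LP:
  assumes "\<omega> \<in> set_pmf LP"
  shows "numbering d n G (\<lambda>_ u. fst (\<omega> u))"
  by unfold_locales (use assms d_pos G in \<open>auto simp: set_LP\<close>)

lemma pmf_LP:
  assumes "\<omega> \<in> set_pmf LP"
  shows "pmf LP \<omega> = (1 / fact d) ^ n * (\<Prod>v<n. pmf (q v) (snd (\<omega> v)))"
proof -
  have "pmf LP \<omega> = (\<Prod>v<n. pmf (pair_pmf (pmf_of_set (numb d G v)) (q v)) (\<omega> v))"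
    unfolding label_pmf_def by (rule pmf_Pi') (use assms in \<open>auto simp: set_LP\<close>)
  also have "\<dots> = (\<Prod>v<n. 1 / fact d * pmf (q v) (snd (\<omega> v)))"
  proof (rule prod.cong)
    fix v assume v: "v \<in> {..<n}"
    then have "pmf (pmf_of_set (numb d G v)) (fst (\<omega> v)) = 1 / fact d"
      using assms by (simp add: set_LP numb_nonempty[OF G] finite_numb[OF G] card_numb[OF G])
    then show "pmf (pair_pmf (pmf_of_set (numb d G v)) (q v)) (\<omega> v) = 1 / fact d * pmf (q v) (snd (\<omega> v))"
      by (metis pmf_pair prod.collapse)
  qed simp
  finally show ?thesis by (simp only: prod.distrib prod_constant card_lessThan)
qed

lemma prob_LP_Pi:
  "measure_pmf.prob LP {\<omega>. \<forall>v<n. \<omega> v \<in> A v \<times> B v}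
    = (\<Prod>v<n. measure_pmf.prob (pmf_of_set (numb d G v)) (A v) * measure_pmf.prob (q v) (B v))"
proof -
  have "{\<omega>. \<forall>v<n. \<omega> v \<in> A v \<times> B v} = Pi {..<n} (\<lambda>v. A v \<times> B v)" by (auto simp: Pi_def)
  then have "measure_pmf.prob LP {\<omega>. \<forall>v<n. \<omega> v \<in> A v \<times> B v}
    = (\<Prod>v<n. measure_pmf.prob (pair_pmf (pmf_of_set (numb d G v)) (q v)) (A v \<times> B v))"
    unfolding label_pmf_def by (simp only: measure_Pi_pmf_Pi finite_lessThan)
  then show ?thesis by (simp only: prob_pair_pmf_Times)
qed

text \<open>By \<open>cov_eq_iff\<close> the event is one condition for each word x, about the
  numbering and the letter at \<open>\<tau> x\<close>. Injectivity of \<tau> puts these conditions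
  at distinct vertices, so they multiply exactly as with a fresh numbering at each tree
  vertex.\<close>

lemma prob_pat_cov:
  assumes \<tau>: "\<tau> \<in> local_covs d n G k" "\<tau> [] = v" and inj: "inj_on \<tau> (tb d k)"
  shows "measure_pmf.prob LP {\<omega>. restrict (cov d (\<lambda>_ u. fst (\<omega> u)) v 0) (tb d k) = \<tau> \<and> (\<forall>x\<in>tb d k. snd (\<omega> (\<tau> x)) = a x)}
    = cov_weight d k * (\<Prod>x\<in>tb d k. pmf (q (\<tau> x)) (a x))"
proof -
  let ?B = "tb d k"
  have \<tau>n: "\<tau> x < n" if "x \<in> ?B" for x using \<tau> that by (auto simp: local_covs_def)
  have v: "v < n" using \<tau>n[of "[]"] \<tau>(2) by (simp add: tball_root)
  define A where "A = (\<lambda>u. if u \<in> \<tau> ` ?B then {h. length (the_inv_into ?B \<tau> u) < k \<longrightarrow> shift_compat d \<tau> (the_inv_into ?B \<tau> u) h} else UNIV)"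
  define B where "B = (\<lambda>u. if u \<in> \<tau> ` ?B then {a (the_inv_into ?B \<tau> u)} else UNIV)"
  have inv: "the_inv_into ?B \<tau> (\<tau> x) = x" if "x \<in> ?B" for x by (rule the_inv_into_f_f[OF inj that])
  have iff: "(restrict (cov d (\<lambda>_ u. fst (\<omega> u)) v 0) ?B = \<tau> \<and> (\<forall>x\<in>?B. snd (\<omega> (\<tau> x)) = a x))
      \<longleftrightarrow> (\<forall>u<n. \<omega> u \<in> A u \<times> B u)" if \<omega>: "\<omega> \<in> set_pmf LP" for \<omega>
  proof -
    interpret numbering d n G "\<lambda>_ u. fst (\<omega> u)" by (rule numbering_LP[OF \<omega>])
    have "(\<forall>u<n. \<omega> u \<in> A u \<times> B u) \<longleftrightarrow> (\<forall>x\<in>?B. \<omega> (\<tau> x) \<in> A (\<tau> x) \<times> B (\<tau> x))"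
    proof
      assume *: "\<forall>x\<in>?B. \<omega> (\<tau> x) \<in> A (\<tau> x) \<times> B (\<tau> x)"
      show "\<forall>u<n. \<omega> u \<in> A u \<times> B u"
      proof (intro allI impI)
        fix u show "\<omega> u \<in> A u \<times> B u"
        proof (cases "u \<in> \<tau> ` ?B")
          case True
          then show ?thesis using * by auto
        next
          case False
          then show ?thesis by (simp add: A_def B_def)
        qed
      qed
    qed (use \<tau>n in auto)
    also have "\<dots> \<longleftrightarrow> (\<forall>x\<in>?B. (length x < k \<longrightarrow> shift_compat d \<tau> x (fst (\<omega> (\<tau> x)))) \<and> snd (\<omega> (\<tau> x)) = a x)"
      by (intro ball_cong refl) (simp add: A_def B_def inv mem_Times_iff)
    also have "\<dots> \<longleftrightarrow> (\<tau> [] = v \<and> (\<forall>x\<in>tverts d. length x < k \<longrightarrow> shift_compat d \<tau> x (fst (\<omega> (\<tau> x))))) \<and> (\<forall>x\<in>?B. snd (\<omega> (\<tau> x)) = a x)"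
      using \<tau>(2) by (auto simp: tball_root)
    also have "(\<tau> [] = v \<and> (\<forall>x\<in>tverts d. length x < k \<longrightarrow> shift_compat d \<tau> x (fst (\<omega> (\<tau> x)))))
       \<longleftrightarrow> restrict (cov d (\<lambda>_ u. fst (\<omega> u)) v 0) ?B = \<tau>"
      by (rule cov_eq_iff[OF v \<tau>(1), symmetric])
    finally show ?thesis by blast
  qed
  have "measure_pmf.prob LP {\<omega>. restrict (cov d (\<lambda>_ u. fst (\<omega> u)) v 0) ?B = \<tau> \<and> (\<forall>x\<in>?B. snd (\<omega> (\<tau> x)) = a x)}
    = measure_pmf.prob LP {\<omega>. \<forall>u<n. \<omega> u \<in> A u \<times> B u}"
    by (rule measure_pmf.finite_measure_eq_AE) (auto simp: AE_measure_pmf_iff iff)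
  also have "\<dots> = (\<Prod>u<n. measure_pmf.prob (pmf_of_set (numb d G u)) (A u) * measure_pmf.prob (q u) (B u))"
    by (rule prob_LP_Pi)
  also have "\<dots> = (\<Prod>u\<in>\<tau> ` ?B. measure_pmf.prob (pmf_of_set (numb d G u)) (A u) * measure_pmf.prob (q u) (B u))"
    by (rule prod.mono_neutral_right) (use \<tau>n in \<open>auto simp: A_def B_def\<close>)
  also have "\<dots> = (\<Prod>x\<in>?B. measure_pmf.prob (pmf_of_set (numb d G (\<tau> x))) (A (\<tau> x)) * measure_pmf.prob (q (\<tau> x)) (B (\<tau> x)))"
    using inj by (subst prod.reindex) simp_all
  also have "\<dots> = (\<Prod>x\<in>?B. compat_prob d k x * pmf (q (\<tau> x)) (a x))"
  proof (rule prod.cong)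
    fix x assume x: "x \<in> ?B"
    have "measure_pmf.prob (pmf_of_set (numb d G (\<tau> x))) (A (\<tau> x)) = compat_prob d k x"
    proof (cases "length x < k")
      case True
      then have "A (\<tau> x) = {h. shift_compat d \<tau> x h}" using x by (simp add: A_def inv)
      then show ?thesis using prob_compat[OF d_pos G \<tau>(1) _ True] x by (simp add: tball_root)
    next
      case False
      then have "A (\<tau> x) = UNIV" using x by (simp add: A_def inv)
      then show ?thesis using False by (simp add: compat_prob_def)
    qed
    moreover have "measure_pmf.prob (q (\<tau> x)) (B (\<tau> x)) = pmf (q (\<tau> x)) (a x)"
      using x by (simp add: B_def inv measure_pmf_single)
    ultimately show "measure_pmf.prob (pmf_of_set (numb d G (\<tau> x))) (A (\<tau> x)) * measure_pmf.prob (q (\<tau> x)) (B (\<tau> x)) = compat_prob d k x * pmf (q (\<tau> x)) (a x)"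
      by simp
  qed simp
  also have "\<dots> = cov_weight d k * (\<Prod>x\<in>?B. pmf (q (\<tau> x)) (a x))" by (simp add: cov_weight_def prod.distrib)
  finally show ?thesis .
qed

text \<open>The probability of the pattern a at v, were the k-ball of v a tree.\<close>

definition mean_at :: "nat \<Rightarrow> (nat list \<Rightarrow> 'f) \<Rightarrow> real" where
  "mean_at v a = (\<Sum>\<tau>\<in>{\<tau> \<in> local_covs d n G k. \<tau> [] = v}. cov_weight d k * (\<Prod>x\<in>tb d k. pmf (q (\<tau> x)) (a x)))"

text \<open>The covering built from the numberings restricts to exactly one local cover at v, so the
  pattern event is a disjoint union over these covers.\<close>

lemma prob_pat:
  assumes v: "v < n" "\<not> cyc_vert d n G k v" and a: "a \<in> PiE (tb d k) (\<lambda>_. UNIV)"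
  shows "measure_pmf.prob LP {\<omega>. pat d k \<omega> v = a} = mean_at v a"
proof -
  let ?B = "tb d k"
  let ?L = "{\<tau> \<in> local_covs d n G k. \<tau> [] = v}"
  let ?S = "\<lambda>\<tau>. {\<omega>. restrict (cov d (\<lambda>_ u. fst (\<omega> u)) v 0) ?B = \<tau> \<and> (\<forall>x\<in>?B. snd (\<omega> (\<tau> x)) = a x)}"
  have "measure_pmf.prob LP {\<omega>. pat d k \<omega> v = a} = measure_pmf.prob LP (\<Union>\<tau>\<in>?L. ?S \<tau>)"
  proof (rule measure_pmf.finite_measure_eq_AE)
    show "AE \<omega> in measure_pmf LP. (\<omega> \<in> {\<omega>. pat d k \<omega> v = a}) = (\<omega> \<in> (\<Union>\<tau>\<in>?L. ?S \<tau>))"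
      unfolding AE_measure_pmf_iff
    proof
      fix \<omega> assume "\<omega> \<in> set_pmf LP"
      then interpret numbering d n G "\<lambda>_ u. fst (\<omega> u)" by (rule numbering_LP)
      let ?c = "restrict (cov d (\<lambda>_ u. fst (\<omega> u)) v 0) ?B"
      have "?c \<in> ?L" using cov_in_local_covs[OF v(1), of k] by (simp add: tball_root)
      have "\<omega> \<in> (\<Union>\<tau>\<in>?L. ?S \<tau>) \<longleftrightarrow> (\<exists>\<tau>\<in>?L. ?c = \<tau> \<and> (\<forall>x\<in>?B. snd (\<omega> (\<tau> x)) = a x))"
        by (simp only: UN_iff mem_Collect_eq)
      also have "\<dots> \<longleftrightarrow> (\<forall>x\<in>?B. snd (\<omega> (?c x)) = a x)" 
        by (rule bex_eq_iff[OF \<open>?c \<in> ?L\<close>])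
      also have "\<dots> \<longleftrightarrow> pat d k \<omega> v = a"
        using a by (auto simp: pat_def fun_eq_iff PiE_iff extensional_def)
      finally show "(\<omega> \<in> {\<omega>. pat d k \<omega> v = a}) = (\<omega> \<in> (\<Union>\<tau>\<in>?L. ?S \<tau>))" by simp
    qed
  qed simp_all
  also have "\<dots> = (\<Sum>\<tau>\<in>?L. measure_pmf.prob LP (?S \<tau>))"
    by (rule measure_pmf.finite_measure_finite_Union) (auto simp: finite_local_covs disjoint_family_on_def)
  also have "\<dots> = mean_at v a" unfolding mean_at_def
  proof (rule sum.cong)
    fix \<tau> assume \<tau>: "\<tau> \<in> ?L"
    then have "inj_on \<tau> ?B" using v(2) by (auto simp: cyc_vert_def)
    then show "measure_pmf.prob LP (?S \<tau>) = cov_weight d k * (\<Prod>x\<in>?B. pmf (q (\<tau> x)) (a x))"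
      using prob_pat_cov[of \<tau> v a] \<tau> by simp
  qed simp
  finally show ?thesis .
qed

text \<open>The chance that the random covering map sends the root to v can be computed at every
  radius with the same result; at radius 0 there is one local cover over v.\<close>

lemma cov_weight_root: "v < n \<Longrightarrow> cov_weight d k * card {\<tau> \<in> local_covs d n G k. \<tau> [] = v} = 1"
proof -
  assume v: "v < n"
  have count: "cov_weight d l * card {\<tau> \<in> local_covs d n G l. \<tau> [] = v} = n * (\<integral>\<psi>. (if \<psi> [] = v then 1 else 0) \<partial>random_cover d n G)" for l
  proof -
    have "(\<integral>\<psi>. (if \<psi> [] = v then 1 else 0 :: real) \<partial>random_cover d n G) = (\<integral>\<psi>. (if restrict \<psi> (tb d l) [] = v then 1 else 0) \<partial>random_cover d n G)"
      by (simp add: tball_root)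
    also have "\<dots> = cov_weight d l / n * (\<Sum>\<tau>\<in>local_covs d n G l. if \<tau> [] = v then 1 else 0)"
      by (rule integral_is_random_cover[OF d_pos n_pos G is_random_cover_random_cover[OF d_pos n_pos G], where F = "\<lambda>\<tau>. if \<tau> [] = v then 1 else 0"])
    also have "(\<Sum>\<tau>\<in>local_covs d n G l. if \<tau> [] = v then 1 else 0) = real (card {\<tau> \<in> local_covs d n G l. \<tau> [] = v})"
      by (simp add: sum.If_cases finite_local_covs Int_def)
    finally show ?thesis using n_pos by simp
  qed
  have "{\<tau> \<in> local_covs d n G 0. \<tau> [] = v} = {\<lambda>x\<in>{[]}. v}"
  proof -
    have t0: "tb d 0 = {[]}" by (auto simp: tball_root)
    show ?thesis using v unfolding local_covs_eq t0 by (auto simp: fun_eq_iff PiE_iff extensional_def)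
  qed
  moreover have "cov_weight d 0 = 1" by (simp add: cov_weight_def compat_prob_def)
  ultimately have "cov_weight d 0 * card {\<tau> \<in> local_covs d n G 0. \<tau> [] = v} = 1" by simp
  then show ?thesis using count[of k] count[of 0] by simp
qed

lemma cov_weight_nonneg: "0 \<le> cov_weight d k"
  unfolding cov_weight_def by (rule prod_nonneg) (auto simp: compat_prob_def)

lemma mean_at_bounds: "v < n \<Longrightarrow> 0 \<le> mean_at v a \<and> mean_at v a \<le> 1"
proof -
  assume v: "v < n"
  have "(\<Prod>x\<in>tb d k. pmf (q (\<tau> x)) (a x)) \<le> 1" for \<tau>
    by (rule prod_le_1) (auto simp: pmf_le_1)
  then have "mean_at v a \<le> (\<Sum>\<tau>\<in>{\<tau> \<in> local_covs d n G k. \<tau> [] = v}. cov_weight d k)"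
    unfolding mean_at_def using cov_weight_nonneg by (intro sum_mono) (simp add: mult_left_le)
  also have "\<dots> = 1" using cov_weight_root[OF v] by (simp add: mult.commute)
  finally show ?thesis
    unfolding mean_at_def by (auto intro!: sum_nonneg mult_nonneg_nonneg cov_weight_nonneg prod_nonneg)
qed

text \<open>The right-hand side is n times the probability of the pattern a along the random
  covering map (see \<open>integral_pattern\<close>); here the labelled graph meets the weak
  limit.\<close>

lemma sum_mean_at:
  "(\<Sum>v<n. mean_at v a) = cov_weight d k * (\<Sum>\<tau>\<in>local_covs d n G k. \<Prod>x\<in>tb d k. pmf (q (\<tau> x)) (a x))"
proof -
  have "(\<Sum>v<n. mean_at v a) = (\<Sum>\<tau>\<in>local_covs d n G k. cov_weight d k * (\<Prod>x\<in>tb d k. pmf (q (\<tau> x)) (a x)))"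
    unfolding mean_at_def
    by (rule sum.group[OF finite_local_covs]) (auto simp: local_covs_def tball_root)
  then show ?thesis by (simp add: sum_distrib_left)
qed

lemma cov_in_gball:
  assumes \<omega>: "\<omega> \<in> set_pmf LP" and v: "v < n" and x: "x \<in> tverts d"
  shows "cov d (\<lambda>_ u. fst (\<omega> u)) v 0 x \<in> gball G (length x) v"
proof -
  interpret numbering d n G "\<lambda>_ u. fst (\<omega> u)" by (rule numbering_LP[OF \<omega>])
  let ?c = "cov d (\<lambda>_ u. fst (\<omega> u)) v 0"
  have "(?c [], ?c x) \<in> G ^^ length x"
  proof (rule cov_walk[OF _ x])
    fix z a assume "z @ [a] \<in> tverts d"
    then have z: "z \<in> tverts d" by (simp add: snoc_in_tverts)
    show "(?c z, ?c (z @ [a])) \<in> G" unfolding cov_snoc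
      by (rule N_in) (use z v d_pos in \<open>auto intro: cov_less\<close>)
  qed
  then show ?thesis by (auto simp: gball_def)
qed

text \<open>Two covers that use the same numberings throughout the k-ball of v obey the same rule up
  to length k, so \<open>cov_unique\<close> identifies them.\<close>

lemma pat_local:
  assumes \<omega>: "\<omega> \<in> set_pmf LP" "\<omega>' \<in> set_pmf LP" and v: "v < n" and eq: "\<And>u. u \<in> gball G k v \<Longrightarrow> \<omega> u = \<omega>' u"
  shows "pat d k \<omega> v = pat d k \<omega>' v"
proof -
  interpret a: numbering d n G "\<lambda>_ u. fst (\<omega> u)" by (rule numbering_LP[OF \<omega>(1)])
  interpret b: numbering d n G "\<lambda>_ u. fst (\<omega>' u)" by (rule numbering_LP[OF \<omega>(2)])
  let ?c = "cov d (\<lambda>_ u. fst (\<omega> u)) v 0" and ?s = "shf d (\<lambda>_ u. fst (\<omega> u)) v 0"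
  have ball: "?c x \<in> gball G k v" if "x \<in> tverts d" "length x \<le> k" for x
    using cov_in_gball[OF \<omega>(1) v that(1)] gball_mono[OF that(2)] by blast
  have c: "?c x = cov d (\<lambda>_ u. fst (\<omega>' u)) v 0 x" if x: "x \<in> tverts d" "length x \<le> k" for x
  proof -
    have "?c x = cov d (\<lambda>_ u. fst (\<omega>' u)) v 0 x \<and> (length x < k \<longrightarrow> ?s x = shf d (\<lambda>_ u. fst (\<omega>' u)) v 0 x)"
    proof (rule b.cov_unique)
      fix x a assume x: "x \<in> tverts d" "length x < k" "a < d"
      show "?c (tmul x a) = fst (\<omega>' (?c x)) ((a + ?s x) mod d)"
        using a.cov_tmul[OF v d_pos x(1)] eq[OF ball[of x]] x by simp
    next
      fix x assume x: "x \<in> tverts d"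
      show "?s x < d" by (rule a.shf_less[OF v d_pos x])
    qed (use v d_pos x in auto)
    then show ?thesis ..
  qed
  show ?thesis unfolding pat_def
  proof (rule restrict_ext)
    fix x assume "x \<in> tb d k"
    then have x: "x \<in> tverts d" "length x \<le> k" by (auto simp: tball_root)
    show "snd (\<omega> (?c x)) = snd (\<omega>' (cov d (\<lambda>_ u. fst (\<omega>' u)) v 0 x))"
      unfolding c[OF x, symmetric] using eq[OF ball[OF x]] by simp
  qed
qed

lemma gball_trans: "p \<in> gball G i v \<Longrightarrow> r \<in> gball G j p \<Longrightarrow> r \<in> gball G (i + j) v"
proof -
  assume "p \<in> gball G i v" "r \<in> gball G j p"
  then obtain a b where ab: "a \<le> i" "(v, p) \<in> G ^^ a" "b \<le> j" "(p, r) \<in> G ^^ b" by (auto simp: gball_def)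
  then have "(v, r) \<in> G ^^ (a + b)" by (auto simp: relpow_add)
  then show ?thesis using ab unfolding gball_def by (auto intro!: exI[of _ "a + b"])
qed

lemma gball_sym: "p \<in> gball G i v \<Longrightarrow> v \<in> gball G i p"
proof -
  have "(p, v) \<in> G ^^ m" if "(v, p) \<in> G ^^ m" for m p
    using that
  proof (induction m arbitrary: p)
    case (Suc m)
    then obtain u where "(v, u) \<in> G ^^ m" "(u, p) \<in> G" by auto
    then have "(u, v) \<in> G ^^ m" "(p, u) \<in> G" using Suc.IH reg_graphsD(3)[OF G] by blast+
    then show ?case by (rule relpow_Suc_I2[rotated])
  qed simp
  then show "p \<in> gball G i v \<Longrightarrow> v \<in> gball G i p" by (auto simp: gball_def)
qed

text \<open>Half of the tolerance t n absorbs the vertices near cycles, where the true mean differs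
  from \<open>mean_at\<close> by at most 1; the other half goes into Chebyshev's inequality.
  Patterns at v and w can be dependent only if their k-balls meet, which confines w to the 2k-ball
  of v.\<close>

lemma prob_pat_deviation:
  fixes t :: real
  assumes t: "0 < t" and a: "a \<in> PiE (tb d k) (\<lambda>_. UNIV)"
    and cyc: "real (card {v. v < n \<and> cyc_vert d n G k v}) \<le> t / 2 * n"
  shows "measure_pmf.prob LP {\<omega>. t * n \<le> \<bar>card {v \<in> {..<n}. pat d k \<omega> v = a} - (\<Sum>v<n. mean_at v a)\<bar>}
    \<le> 4 * (d + 1) ^ (2 * k) / (n * t\<^sup>2)"
proof -
  define Z where "Z = (\<lambda>v \<omega>. if pat d k \<omega> v = a then 1 else 0 :: real)"
  let ?E = "measure_pmf.expectation LP"
  have EZ: "?E (Z v) = measure_pmf.prob LP {\<omega>. pat d k \<omega> v = a}" for v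
  proof -
    have "?E (Z v) = ?E (indicator {\<omega>. pat d k \<omega> v = a})"
      by (rule Bochner_Integration.integral_cong) (auto simp: Z_def)
    then show ?thesis by simp
  qed
  let ?R = "\<lambda>v w. gball G k v \<inter> gball G k w \<noteq> {}"
  have indep: "?E (\<lambda>\<omega>. Z v \<omega> * Z w \<omega>) = ?E (Z v) * ?E (Z w)" if vw: "v \<in> {..<n}" "w \<in> {..<n}" "\<not> ?R v w" for v w
    unfolding label_pmf_def
  proof (rule expectation_Pi_pmf_indep[where B = "gball G k v" and C = "gball G k w"])
    show "gball G k v \<inter> gball G k w = {}" using vw by blast
    show "gball G k v \<subseteq> {..<n}" "gball G k w \<subseteq> {..<n}" using card_gball[OF G] vw by auto
    show "finite (set_pmf (pair_pmf (pmf_of_set (numb d G u)) (q u)))" if "u \<in> {..<n}" for u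
      using that by (simp add: set_pmf_of_set[OF numb_nonempty[OF G] finite_numb[OF G]] finite_numb[OF G])
    show "Z v \<omega> = Z v \<omega>'" if "\<omega> \<in> set_pmf (Pi_pmf {..<n} undefined (\<lambda>v. pair_pmf (pmf_of_set (numb d G v)) (q v)))"
      "\<omega>' \<in> set_pmf (Pi_pmf {..<n} undefined (\<lambda>v. pair_pmf (pmf_of_set (numb d G v)) (q v)))" "\<And>x. x \<in> gball G k v \<Longrightarrow> \<omega> x = \<omega>' x" for \<omega> \<omega>'
      unfolding Z_def using pat_local[of \<omega> \<omega>' v] that vw by (simp add: label_pmf_def)
    show "Z w \<omega> = Z w \<omega>'" if "\<omega> \<in> set_pmf (Pi_pmf {..<n} undefined (\<lambda>v. pair_pmf (pmf_of_set (numb d G v)) (q v)))"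
      "\<omega>' \<in> set_pmf (Pi_pmf {..<n} undefined (\<lambda>v. pair_pmf (pmf_of_set (numb d G v)) (q v)))" "\<And>x. x \<in> gball G k w \<Longrightarrow> \<omega> x = \<omega>' x" for \<omega> \<omega>'
      unfolding Z_def using pat_local[of \<omega> \<omega>' w] that vw by (simp add: label_pmf_def)
  qed simp
  have D: "card {w \<in> {..<n}. ?R v w} \<le> (d + 1) ^ (2 * k)" if "v \<in> {..<n}" for v
  proof -
    have "{w \<in> {..<n}. ?R v w} \<subseteq> gball G (2 * k) v"
    proof
      fix w assume "w \<in> {w \<in> {..<n}. ?R v w}"
      then obtain u where "u \<in> gball G k v" "u \<in> gball G k w" by blast
      then show "w \<in> gball G (2 * k) v" using gball_trans[of u k v w k] gball_sym[of u k w] by (simp add: mult_2)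
    qed
    then have "card {w \<in> {..<n}. ?R v w} \<le> card (gball G (2 * k) v)"
      using card_gball[OF G, of v "2 * k"] that by (intro card_mono) auto
    also have "\<dots> \<le> (d + 1) ^ (2 * k)" using card_gball[OF G, of v "2 * k"] that by auto
    finally show ?thesis .
  qed
  have M: "?E (\<lambda>\<omega>. (Z v \<omega>)\<^sup>2) \<le> 1" for v
  proof -
    have "?E (\<lambda>\<omega>. (Z v \<omega>)\<^sup>2) = ?E (Z v)" by (rule Bochner_Integration.integral_cong) (auto simp: Z_def)
    then show ?thesis by (simp add: EZ)
  qed
  have diff: "\<bar>(\<Sum>v<n. ?E (Z v)) - (\<Sum>v<n. mean_at v a)\<bar> \<le> t / 2 * n"
  proof -
    have "\<bar>(\<Sum>v<n. ?E (Z v)) - (\<Sum>v<n. mean_at v a)\<bar> \<le> (\<Sum>v<n. \<bar>?E (Z v) - mean_at v a\<bar>)"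
      unfolding sum_subtractf[symmetric] by (rule sum_abs)
    also have "\<dots> \<le> (\<Sum>v<n. if cyc_vert d n G k v then 1 else 0)"
    proof (rule sum_mono)
      fix v assume v: "v \<in> {..<n}"
      have "0 \<le> ?E (Z v)" "?E (Z v) \<le> 1" by (simp_all add: EZ)
      then have "\<bar>?E (Z v) - mean_at v a\<bar> \<le> 1" using mean_at_bounds[of v a] v unfolding abs_le_iff by simp
      then show "\<bar>?E (Z v) - mean_at v a\<bar> \<le> (if cyc_vert d n G k v then 1 else 0)"
        using mean_at_bounds[of v a] prob_pat[of v a] v a EZ[of v] by auto
    qed
    also have "\<dots> = card {v. v < n \<and> cyc_vert d n G k v}" by (simp add: sum.If_cases Int_def)
    finally show ?thesis using cyc by linarith
  qed
  have Zsum: "(\<Sum>v<n. Z v \<omega>) = card {v \<in> {..<n}. pat d k \<omega> v = a}" for \<omega>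
    unfolding Z_def by (simp add: sum.If_cases Int_def)
  have "measure_pmf.prob LP {\<omega>. t * n \<le> \<bar>card {v \<in> {..<n}. pat d k \<omega> v = a} - (\<Sum>v<n. mean_at v a)\<bar>}
    \<le> measure_pmf.prob LP {\<omega>. t / 2 * n \<le> \<bar>(\<Sum>v<n. Z v \<omega>) - (\<Sum>v<n. ?E (Z v))\<bar>}"
  proof (rule measure_pmf.finite_measure_mono, rule subsetI, rule CollectI)
    fix \<omega> assume "\<omega> \<in> {\<omega>. t * n \<le> \<bar>card {v \<in> {..<n}. pat d k \<omega> v = a} - (\<Sum>v<n. mean_at v a)\<bar>}"
    then show "t / 2 * n \<le> \<bar>(\<Sum>v<n. Z v \<omega>) - (\<Sum>v<n. ?E (Z v))\<bar>" 
      using diff unfolding Zsum mem_Collect_eq by linarith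
  qed simp
  also have "\<dots> \<le> card {..<n} * (((d + 1) ^ (2 * k)) * 1) / (t / 2 * n)\<^sup>2"
    using chebyshev_sum[OF finite_LP _ indep D M, where t = "t / 2 * n"] t n_pos by simp
  also have "\<dots> = 4 * (d + 1) ^ (2 * k) / (n * t\<^sup>2)"
    using n_pos t by (simp add: power2_eq_square field_simps)
  finally show ?thesis .
qed

lemma expectation_component:
  fixes h :: "'f \<Rightarrow> real"
  assumes "v < n"
  shows "measure_pmf.expectation LP (\<lambda>\<omega>. h (snd (\<omega> v))) = (\<Sum>f\<in>UNIV. h f * pmf (q v) f)"
proof -
  have "map_pmf (\<lambda>\<omega>. \<omega> v) LP = pair_pmf (pmf_of_set (numb d G v)) (q v)"
    unfolding label_pmf_def using assms by (subst Pi_pmf_component) auto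
  then have "map_pmf (\<lambda>\<omega>. snd (\<omega> v)) LP = q v"
    by (metis (no_types, lifting) map_pmf_comp map_pmf_cong map_snd_pair_pmf)
  then have "measure_pmf.expectation LP (\<lambda>\<omega>. h (snd (\<omega> v))) = measure_pmf.expectation (q v) h"
    by (metis integral_map_pmf)
  also have "\<dots> = (\<Sum>f\<in>UNIV. h f * pmf (q v) f)" by (rule integral_measure_pmf_real) auto
  finally show ?thesis .
qed

text \<open>Although the information content -ln x is unbounded, its square weighted by x is not.
  This gives a second moment for Chebyshev's inequality that is uniform over all laws on the
  letters.\<close>

lemma x_ln_sq_le: "0 \<le> x \<Longrightarrow> x \<le> 1 \<Longrightarrow> (ln x)\<^sup>2 * x \<le> (4 :: real)"
proof (cases "x = 0")
  case False
  assume "0 \<le> x" "x \<le> 1"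
  with False have x: "0 < x" "x \<le> 1" by auto
  have "ln (1 / sqrt x) \<le> 1 / sqrt x" using ln_le_minus_one[of "1 / sqrt x"] x by simp
  then have "- ln x \<le> 2 / sqrt x" using x by (simp add: ln_div ln_sqrt)
  then have "(- ln x)\<^sup>2 \<le> (2 / sqrt x)\<^sup>2" using x by (intro power_mono) auto
  also have "\<dots> = 4 / x" using x by (simp add: power_divide)
  finally show ?thesis using x by (simp add: field_simps)
qed simp

lemma prob_entropy_deviation:
  fixes \<epsilon> :: real
  assumes "0 < \<epsilon>"
  shows "measure_pmf.prob LP {\<omega>. \<epsilon> * n \<le> \<bar>(\<Sum>v<n. - ln (pmf (q v) (snd (\<omega> v)))) - (\<Sum>v<n. pmf_entropy (q v))\<bar>}
    \<le> 4 * CARD('f) / (n * \<epsilon>\<^sup>2)"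
proof -
  define Y where "Y = (\<lambda>v \<omega>. - ln (pmf (q v) (snd (\<omega> v :: (nat \<Rightarrow> nat) \<times> 'f))))"
  let ?E = "measure_pmf.expectation LP"
  have EY: "?E (Y v) = pmf_entropy (q v)" if "v < n" for v
    using expectation_component[OF that, of "\<lambda>f. - ln (pmf (q v) f)"]
    by (simp add: Y_def pmf_entropy_def sum_negf mult.commute)
  have indep: "?E (\<lambda>\<omega>. Y v \<omega> * Y w \<omega>) = ?E (Y v) * ?E (Y w)" if vw: "v \<in> {..<n}" "w \<in> {..<n}" "\<not> v = w" for v w
    unfolding label_pmf_def
    by (rule expectation_Pi_pmf_indep[where B = "{v}" and C = "{w}"])
       (use vw in \<open>auto simp: Y_def set_pmf_of_set[OF numb_nonempty[OF G] finite_numb[OF G]] finite_numb[OF G]\<close>)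
  have D: "card {w \<in> {..<n}. v = w} \<le> 1" for v
    by (rule order_trans[OF card_mono[of "{v}"]]) auto
  have M: "?E (\<lambda>\<omega>. (Y v \<omega>)\<^sup>2) \<le> 4 * CARD('f)" if "v \<in> {..<n}" for v
  proof -
    have "?E (\<lambda>\<omega>. (Y v \<omega>)\<^sup>2) = (\<Sum>f\<in>UNIV. (ln (pmf (q v) f))\<^sup>2 * pmf (q v) f)"
      using expectation_component[of v "\<lambda>f. (ln (pmf (q v) f))\<^sup>2"] that by (simp add: Y_def)
    also have "\<dots> \<le> (\<Sum>f\<in>(UNIV :: 'f set). 4)" by (intro sum_mono x_ln_sq_le) (auto simp: pmf_le_1)
    finally show ?thesis by simp
  qed
  have "measure_pmf.prob LP {\<omega>. \<epsilon> * n \<le> \<bar>(\<Sum>v<n. Y v \<omega>) - (\<Sum>v<n. ?E (Y v))\<bar>} \<le> card {..<n} * (1 * (4 * CARD('f))) / (\<epsilon> * n)\<^sup>2"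
    using chebyshev_sum[OF finite_LP _ indep D M, where t = "\<epsilon> * n"] assms n_pos by simp
  also have "\<dots> = 4 * CARD('f) / (n * \<epsilon>\<^sup>2)" using n_pos assms by (simp add: power2_eq_square field_simps)
  also have "(\<Sum>v<n. ?E (Y v)) = (\<Sum>v<n. pmf_entropy (q v))" using EY by simp
  finally show ?thesis by (simp only: Y_def)
qed

text \<open>Asymptotic equipartition as a count: with probability at least 1/2 the pattern
  frequencies are good and the information content is within \<epsilon> n of the total entropy H.
  Each such outcome has probability at most (d!)^(-n) exp(-(H - \<epsilon> n)), so there are many of
  them. The constants 16 bring each of the two failure probabilities down to 1/4.\<close>

lemma card_near_lower:
  fixes p :: "(nat list \<Rightarrow> 'f) \<Rightarrow> real" and t \<epsilon> :: real
  defines "A \<equiv> PiE (tb d k) (\<lambda>_. UNIV :: 'f set)"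
  assumes t: "0 < t" and \<epsilon>: "0 < \<epsilon>"
    and cyc: "real (card {v. v < n \<and> cyc_vert d n G k v}) \<le> t / 2 * n"
    and p: "\<And>a. a \<in> A \<Longrightarrow> \<bar>(\<Sum>v<n. mean_at v a) / n - p a\<bar> < t"
    and n1: "real (16 * card A * (d + 1) ^ (2 * k)) \<le> n * t\<^sup>2" and n2: "16 * CARD('f) \<le> n * \<epsilon>\<^sup>2"
  shows "fact d ^ n * exp ((\<Sum>v<n. pmf_entropy (q v)) - \<epsilon> * n) / 2
    \<le> card {\<omega> \<in> set_pmf LP. \<forall>a\<in>A. \<bar>card {v \<in> {..<n}. pat d k \<omega> v = a} / n - p a\<bar> < 2 * t}"
proof -
  let ?H = "\<Sum>v<n. pmf_entropy (q v)"
  let ?N = "\<lambda>\<omega> a. real (card {v \<in> {..<n}. pat d k \<omega> v = a})"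
  let ?Y = "\<lambda>\<omega> :: nat \<Rightarrow> (nat \<Rightarrow> nat) \<times> 'f. \<Sum>v<n. - ln (pmf (q v) (snd (\<omega> v)))"
  define X1 where "X1 = (\<lambda>a. {\<omega>. t * n \<le> \<bar>?N \<omega> a - (\<Sum>v<n. mean_at v a)\<bar>})"
  define X2 where "X2 = {\<omega>. \<epsilon> * n \<le> \<bar>?Y \<omega> - ?H\<bar>}"
  define S where "S = {\<omega> \<in> set_pmf LP. \<forall>a\<in>A. \<bar>?N \<omega> a / n - p a\<bar> < 2 * t}"
  have finA: "finite A" unfolding A_def by (rule finite_PiE) (auto simp: finite_tb)
  have finS: "finite (S - X2)" using finite_LP by (simp add: S_def)
  have P1: "measure_pmf.prob LP (\<Union>a\<in>A. X1 a) \<le> 1 / 4"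
  proof -
    have "measure_pmf.prob LP (\<Union>a\<in>A. X1 a) \<le> (\<Sum>a\<in>A. measure_pmf.prob LP (X1 a))"
      by (rule measure_pmf.finite_measure_subadditive_finite[OF finA]) auto
    also have "\<dots> \<le> (\<Sum>a\<in>A. 4 * (d + 1) ^ (2 * k) / (n * t\<^sup>2))"
      unfolding X1_def by (intro sum_mono prob_pat_deviation t cyc) (simp add: A_def)
    also have "\<dots> = (4 * card A * (d + 1) ^ (2 * k)) / (n * t\<^sup>2)" by simp
    also have "\<dots> \<le> 1 / 4"
    proof (rule divide_le_eq[THEN iffD2])
      show "if 0 < n * t\<^sup>2 then real (4 * card A * (d + 1) ^ (2 * k)) \<le> 1 / 4 * (n * t\<^sup>2)
        else if n * t\<^sup>2 < 0 then 1 / 4 * (n * t\<^sup>2) \<le> real (4 * card A * (d + 1) ^ (2 * k)) else 0 \<le> (1 / 4 :: real)"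
        using n1 n_pos t by simp
    qed
    finally show ?thesis .
  qed
  have P2: "measure_pmf.prob LP X2 \<le> 1 / 4"
  proof -
    have "measure_pmf.prob LP X2 \<le> 4 * CARD('f) / (n * \<epsilon>\<^sup>2)" unfolding X2_def by (rule prob_entropy_deviation[OF \<epsilon>])
    also have "\<dots> \<le> 1 / 4" using n2 n_pos \<epsilon> by (simp add: field_simps)
    finally show ?thesis .
  qed
  have sub: "set_pmf LP \<subseteq> (S - X2) \<union> ((\<Union>a\<in>A. X1 a) \<union> X2)"
  proof
    fix \<omega> assume \<omega>: "\<omega> \<in> set_pmf LP"
    show "\<omega> \<in> (S - X2) \<union> ((\<Union>a\<in>A. X1 a) \<union> X2)"
    proof (cases "\<omega> \<in> (\<Union>a\<in>A. X1 a)")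
      case False
      have "\<bar>?N \<omega> a / n - p a\<bar> < 2 * t" if a: "a \<in> A" for a
      proof -
        have "\<bar>?N \<omega> a - (\<Sum>v<n. mean_at v a)\<bar> < t * n" using False a by (auto simp: X1_def)
        then have "\<bar>(?N \<omega> a - (\<Sum>v<n. mean_at v a)) / n\<bar> < t" using n_pos by (simp add: abs_divide divide_less_eq)
        then have "\<bar>?N \<omega> a / n - (\<Sum>v<n. mean_at v a) / n\<bar> < t" by (simp only: diff_divide_distrib)
        then show ?thesis using p[OF a] by linarith
      qed
      then show ?thesis using \<omega> by (auto simp: S_def)
    qed simp
  qed
  have "1 = measure_pmf.prob LP (set_pmf LP)" by (simp add: measure_pmf.prob_eq_1 AE_measure_pmf)
  also have "\<dots> \<le> measure_pmf.prob LP ((S - X2) \<union> ((\<Union>a\<in>A. X1 a) \<union> X2))"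
    by (rule measure_pmf.finite_measure_mono[OF sub]) simp
  also have "\<dots> \<le> measure_pmf.prob LP (S - X2) + (measure_pmf.prob LP (\<Union>a\<in>A. X1 a) + measure_pmf.prob LP X2)"
    by (intro order_trans[OF measure_Un_le] add_mono order_refl) auto
  finally have half: "1 / 2 \<le> measure_pmf.prob LP (S - X2)" using P1 P2 by linarith
  also have "\<dots> = (\<Sum>\<omega>\<in>S - X2. pmf LP \<omega>)" by (rule measure_measure_pmf_finite[OF finS])
  also have "\<dots> \<le> (\<Sum>\<omega>\<in>S - X2. (1 / fact d) ^ n * exp (- (?H - \<epsilon> * n)))"
  proof (rule sum_mono)
    fix \<omega> assume w: "\<omega> \<in> S - X2"
    then have \<omega>: "\<omega> \<in> set_pmf LP" by (simp add: S_def)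
    have pos: "0 < pmf (q v) (snd (\<omega> v))" if "v < n" for v

    proof -
      have "snd (\<omega> v) \<in> set_pmf (q v)" using \<omega> that unfolding set_LP by blast
      then show ?thesis by (rule pmf_positive)
    qed
    have "(\<Prod>v<n. pmf (q v) (snd (\<omega> v))) = exp (- ?Y \<omega>)"
      using pos by (simp add: sum_negf exp_sum)
    also have "\<dots> \<le> exp (- (?H - \<epsilon> * n))" using w by (auto simp: X2_def)
    finally show "pmf LP \<omega> \<le> (1 / fact d) ^ n * exp (- (?H - \<epsilon> * n))"
      unfolding pmf_LP[OF \<omega>] by (intro mult_left_mono) auto
  qed
  also have "\<dots> = card (S - X2) * ((1 / fact d) ^ n * exp (- (?H - \<epsilon> * n)))" by simp
  also have "\<dots> \<le> card S * ((1 / fact d) ^ n * exp (- (?H - \<epsilon> * n)))"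
    using finite_LP by (intro mult_right_mono) (auto simp: S_def intro!: card_mono)
  finally have "1 / 2 * (fact d ^ n * exp (?H - \<epsilon> * n)) \<le> card S * ((1 / fact d) ^ n * exp (- (?H - \<epsilon> * n))) * (fact d ^ n * exp (?H - \<epsilon> * n))"
    by (rule mult_right_mono) simp
  also have "\<dots> = card S"
  proof -
    have "(1 / fact d) ^ n * fact d ^ n = (1 :: real)" by (simp add: power_mult_distrib[symmetric])
    moreover have "exp (- (?H - \<epsilon> * n)) * exp (?H - \<epsilon> * n) = 1" unfolding exp_add[symmetric] by simp
    ultimately have "card S * ((1 / fact d) ^ n * fact d ^ n) * (exp (- (?H - \<epsilon> * n)) * exp (?H - \<epsilon> * n)) = card S" by simp
    then show ?thesis by (simp only: mult_ac)
  qed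
  finally show ?thesis by (simp add: S_def)
qed

end

section \<open>The entropy inequality\<close>

lemma sets_random_cover:
  assumes "0 < d" "0 < n" "G \<in> reg_graphs d n"
  shows "sets (random_cover d n G) = sets (PiM (tverts d) (\<lambda>_. count_space (UNIV :: nat set)))"
  using is_random_cover_random_cover[OF assms] by (simp add: is_random_cover_def)

lemma integral_distr_star:
  fixes f :: "nat \<Rightarrow> 'x::topological_space"
  assumes "0 < d" "0 < n" "G \<in> reg_graphs d n"
    and h: "h \<in> borel_measurable (PiM (tverts d) (\<lambda>_. borel :: 'x measure))"
    and F: "\<And>\<psi>. h (restrict (f \<circ> \<psi>) (tverts d)) = F (restrict \<psi> (tb d k))"
  shows "(\<integral>\<alpha>. h \<alpha> \<partial>distr_star d n G f) = cov_weight d k / n * (\<Sum>\<tau>\<in>local_covs d n G k. F \<tau> :: real)"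
proof -
  have m: "(\<lambda>\<psi>. restrict (f \<circ> \<psi>) (tverts d)) \<in> measurable (random_cover d n G) (PiM (tverts d) (\<lambda>_. borel))"
    unfolding measurable_cong_sets[OF sets_random_cover[OF assms(1-3)] refl] comp_def
  proof (rule measurable_restrict)
    fix x assume "x \<in> tverts d"
    then have "(\<lambda>\<psi>. \<psi> x) \<in> measurable (PiM (tverts d) (\<lambda>_. count_space (UNIV :: nat set))) (count_space UNIV)"
      by (rule measurable_component_singleton)
    then show "(\<lambda>\<psi>. f (\<psi> x)) \<in> borel_measurable (PiM (tverts d) (\<lambda>_. count_space UNIV))"
      by (rule measurable_compose) simp
  qed
  have "(\<integral>\<alpha>. h \<alpha> \<partial>distr_star d n G f) = (\<integral>\<psi>. F (restrict \<psi> (tb d k)) \<partial>random_cover d n G)"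
    unfolding distr_star_def by (subst integral_distr[OF m h]) (simp only: F)
  also have "\<dots> = cov_weight d k / n * (\<Sum>\<tau>\<in>local_covs d n G k. F \<tau>)"
    by (rule integral_is_random_cover[OF assms(1-3) is_random_cover_random_cover[OF assms(1-3)]])
  finally show ?thesis .
qed

lemma local_covs_0: "local_covs d n G 0 = (\<lambda>v. \<lambda>x\<in>{[]}. v) ` {..<n}"
proof -
  have t0: "tb d 0 = {[]}" by (auto simp: tball_root)
  have "\<tau> = (\<lambda>x\<in>{[]}. \<tau> [])" if "\<tau> \<in> extensional {[]}" for \<tau> :: "nat list \<Rightarrow> nat"
    using that by (auto simp: fun_eq_iff extensional_def)
  then show ?thesis unfolding local_covs_eq t0 by (auto simp: PiE_iff image_iff)
qed

context
  fixes d :: nat and \<phi> :: "'x::metric_space \<Rightarrow> 'f::finite pmf"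
  assumes \<phi>: "cont_discretization \<phi>"
begin

lemma continuous_entropy: "continuous_on UNIV (\<lambda>x. pmf_entropy (\<phi> x))"
proof -
  have xlnx: "continuous_on {0..} (\<lambda>y::real. y * ln y)"
    unfolding continuous_on_iff
  proof (intro ballI allI impI)
    fix x e :: real assume "x \<in> {0..}" "0 < e"
    then obtain \<delta> where "\<delta> > 0" "\<forall>y\<ge>0. \<bar>y - x\<bar> < \<delta> \<longrightarrow> \<bar>y * ln y - x * ln x\<bar> < e"
      using xlnx_continuous[of x e] by auto
    then show "\<exists>d>0. \<forall>x'\<in>{0..}. dist x' x < d \<longrightarrow> dist (x' * ln x') (x * ln x) < e"
      by (intro exI[of _ \<delta>]) (auto simp: dist_real_def)
  qed
  have "continuous_on UNIV (\<lambda>x. pmf (\<phi> x) f * ln (pmf (\<phi> x) f))" for f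
    by (rule continuous_on_compose2[OF xlnx cont_discretization_pmf[OF \<phi>]]) auto
  then show ?thesis unfolding pmf_entropy_def by (intro continuous_on_minus continuous_on_sum)
qed

lemma continuous_map_component:
  fixes g :: "'x \<Rightarrow> real"
  assumes "continuous_on UNIV g" "x \<in> tverts d"
  shows "continuous_map (product_topology (\<lambda>_. euclidean) (tverts d)) euclideanreal (\<lambda>\<alpha>. g (\<alpha> x))"
proof -
  have "continuous_map (product_topology (\<lambda>_. euclidean) (tverts d)) euclidean (\<lambda>\<alpha>. \<alpha> x :: 'x)"
    by (rule continuous_map_product_projection) fact
  moreover have "continuous_map euclidean euclideanreal g" using assms(1) by simp
  ultimately show ?thesis using continuous_map_compose[of _ _ "\<lambda>\<alpha>. \<alpha> x" _ g] by (simp add: comp_def)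
qed

lemma measurable_component_fun:
  fixes g :: "'x \<Rightarrow> real"
  assumes "continuous_on UNIV g" "x \<in> tverts d"
  shows "(\<lambda>\<alpha>. g (\<alpha> x)) \<in> borel_measurable (PiM (tverts d) (\<lambda>_. borel))"
  by (rule measurable_compose[OF measurable_component_singleton[OF assms(2)] borel_measurable_continuous_onI[OF assms(1)]])

text \<open>Continuity of \<phi> makes the probability of a pattern a bounded continuous function of
  finitely many coordinates, hence a test function for weak convergence.\<close>

lemma pattern_limit:
  assumes conv: "weak_conv d P \<mu>"
  shows "(\<lambda>i. \<integral>\<alpha>. (\<Prod>x\<in>tb d k. pmf (\<phi> (\<alpha> x)) (a x)) \<partial>P i) \<longlonglongrightarrow> (\<integral>\<alpha>. (\<Prod>x\<in>tb d k. pmf (\<phi> (\<alpha> x)) (a x)) \<partial>\<mu>)"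
proof -
  let ?h = "\<lambda>\<alpha> :: nat list \<Rightarrow> 'x. \<Prod>x\<in>tb d k. pmf (\<phi> (\<alpha> x)) (a x)"
  have "continuous_map (product_topology (\<lambda>_. euclidean) (tverts d)) euclideanreal ?h"
    by (intro continuous_map_prod finite_tb continuous_map_component cont_discretization_pmf[OF \<phi>]) (use tb_subset in blast)
  moreover have "\<bar>?h \<alpha>\<bar> \<le> 1" for \<alpha>
    by (simp add: abs_prod) (rule prod_le_1, auto simp: pmf_le_1)
  ultimately show ?thesis using conv unfolding weak_conv_def by blast
qed

lemma pmf_entropy_bound: "\<bar>pmf_entropy (p :: 'f pmf)\<bar> \<le> 4 * CARD('f)"
proof -
  have "\<bar>pmf p f * ln (pmf p f)\<bar> \<le> 4" for f
  proof (cases "pmf p f = 0")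
    case False
    then have x: "0 < pmf p f" "pmf p f \<le> 1" by (auto simp: pmf_le_1 pmf_nonneg less_le)
    have "- ln (pmf p f) \<le> 1 / pmf p f - 1"
      using x ln_le_minus_one[of "1 / pmf p f"] by (simp add: ln_div)
    then have "pmf p f * (- ln (pmf p f)) \<le> pmf p f * (1 / pmf p f - 1)" using x by (intro mult_left_mono) auto
    also have "\<dots> = 1 - pmf p f" using x by (simp add: right_diff_distrib)
    finally show ?thesis using x by (simp add: abs_mult)
  qed simp
  then have "(\<Sum>f\<in>UNIV. \<bar>pmf p f * ln (pmf p f)\<bar>) \<le> (\<Sum>f\<in>(UNIV :: 'f set). 4)" by (intro sum_mono)
  then show ?thesis unfolding pmf_entropy_def abs_minus_cancel 
    by (intro order_trans[OF sum_abs]) (simp add: mult.commute)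
qed

lemma entropy_limit:
  assumes conv: "weak_conv d P \<mu>"
  shows "(\<lambda>i. \<integral>\<alpha>. pmf_entropy (\<phi> (\<alpha> [])) \<partial>P i) \<longlonglongrightarrow> (\<integral>\<alpha>. pmf_entropy (\<phi> (\<alpha> [])) \<partial>\<mu>)"
proof -
  let ?h = "\<lambda>\<alpha> :: nat list \<Rightarrow> 'x. pmf_entropy (\<phi> (\<alpha> []))"
  have "continuous_map (product_topology (\<lambda>_. euclidean) (tverts d)) euclideanreal ?h"
    by (rule continuous_map_component[OF continuous_entropy]) simp
  moreover have "\<bar>?h \<alpha>\<bar> \<le> 4 * CARD('f)" for \<alpha> by (rule pmf_entropy_bound)
  ultimately show ?thesis using conv unfolding weak_conv_def by blast
qed

text \<open>Both sides average the pattern probability over all local covers, on the right grouped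
  by the image of the root.\<close>

lemma integral_pattern:
  assumes "0 < d" "0 < n" "G \<in> reg_graphs d n"
  shows "(\<integral>\<alpha>. (\<Prod>x\<in>tb d k. pmf (\<phi> (\<alpha> x)) (a x)) \<partial>distr_star d n G f)
    = (\<Sum>v<n. labelled.mean_at d n G (\<lambda>v. \<phi> (f v)) k v a) / n"
proof -
  interpret labelled d n G "\<lambda>v. \<phi> (f v)" k using assms by unfold_locales
  let ?h = "\<lambda>\<alpha> :: nat list \<Rightarrow> 'x. \<Prod>x\<in>tb d k. pmf (\<phi> (\<alpha> x)) (a x)"
  have "(\<integral>\<alpha>. ?h \<alpha> \<partial>distr_star d n G f) = cov_weight d k / n * (\<Sum>\<tau>\<in>local_covs d n G k. \<Prod>x\<in>tb d k. pmf (\<phi> (f (\<tau> x))) (a x))"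
  proof (rule integral_distr_star[OF assms])
    show "?h \<in> borel_measurable (PiM (tverts d) (\<lambda>_. borel))"
      by (intro borel_measurable_prod measurable_component_fun cont_discretization_pmf[OF \<phi>]) (use tb_subset in blast)
    show "?h (restrict (f \<circ> \<psi>) (tverts d)) = (\<Prod>x\<in>tb d k. pmf (\<phi> (f (restrict \<psi> (tb d k) x))) (a x))" for \<psi>
      using tb_subset[of d k] by (intro prod.cong) auto
  qed
  then show ?thesis by (simp add: sum_mean_at)
qed

lemma integral_root_entropy:
  assumes "0 < d" "0 < n" "G \<in> reg_graphs d n"
  shows "(\<integral>\<alpha>. pmf_entropy (\<phi> (\<alpha> [])) \<partial>distr_star d n G f) = (\<Sum>v<n. pmf_entropy (\<phi> (f v))) / n"
proof -
  have "(\<integral>\<alpha>. pmf_entropy (\<phi> (\<alpha> [])) \<partial>distr_star d n G f) = cov_weight d 0 / n * (\<Sum>\<tau>\<in>local_covs d n G 0. pmf_entropy (\<phi> (f (\<tau> []))))"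
    by (rule integral_distr_star[OF assms measurable_component_fun[OF continuous_entropy]]) (auto simp: tball_root)
  also have "(\<Sum>\<tau>\<in>local_covs d n G 0. pmf_entropy (\<phi> (f (\<tau> [])))) = (\<Sum>v<n. pmf_entropy (\<phi> (f v)))"
  proof -
    have "inj_on (\<lambda>v. \<lambda>x\<in>{[] :: nat list}. v) {..<n}"
      by (rule inj_onI) (metis restrict_apply' singletonI)
    then show ?thesis unfolding local_covs_0 by (subst sum.reindex) simp_all
  qed
  also have "cov_weight d 0 = 1" by (simp add: cov_weight_def compat_prob_def)
  finally show ?thesis by simp
qed

end

text \<open>Each failure event concerns one coordinate of a product of discrete measures, so it is
  measurable however complicated Q is. Its indicators tend to 0 almost surely, and dominated
  convergence carries this over to the probabilities.\<close>

lemma AE_eventually_prob_tendsto_0: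
  fixes p :: "nat \<Rightarrow> 'g pmf"
  assumes "AE Gs in PiM UNIV (\<lambda>i. measure_pmf (p i)). eventually (\<lambda>i. Q i (Gs i)) sequentially"
  shows "(\<lambda>i. measure_pmf.prob (p i) {G. \<not> Q i G}) \<longlonglongrightarrow> 0"
proof -
  let ?M = "PiM UNIV (\<lambda>i. measure_pmf (p i))"
  interpret product_prob_space "\<lambda>i. measure_pmf (p i)" UNIV by standard
  define X where "X = (\<lambda>i. {Gs \<in> space ?M. Gs i \<in> {G. \<not> Q i G}})"
  have X: "X i \<in> sets ?M" for i
  proof -
    have "(\<lambda>Gs. Gs i) \<in> measurable ?M (measure_pmf (p i))" by (rule measurable_component_singleton) simp
    from measurable_sets[OF this, of "{G. \<not> Q i G}"] show ?thesis
      by (simp add: X_def vimage_def Int_def conj_commute)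
  qed
  have "(\<lambda>i. integral\<^sup>L ?M (indicator (X i) :: _ \<Rightarrow> real)) \<longlonglongrightarrow> integral\<^sup>L ?M (\<lambda>_. 0)"
  proof (rule integral_dominated_convergence[where w = "\<lambda>_. 1"])
    show "AE Gs in ?M. (\<lambda>i. indicator (X i) Gs :: real) \<longlonglongrightarrow> 0"
      using assms
    proof eventually_elim
      case (elim Gs)
      then have "eventually (\<lambda>i. indicator (X i) Gs = (0::real)) sequentially"
        by eventually_elim (auto simp: X_def)
      then show ?case by (rule tendsto_eventually)
    qed
  qed (use X in auto)
  moreover have "integral\<^sup>L ?M (indicator (X i)) = measure_pmf.prob (p i) {G. \<not> Q i G}" for i
  proof -
    have "emeasure ?M (X i) = emeasure (measure_pmf (p i)) {G. \<not> Q i G}"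
      unfolding X_def by (rule emeasure_PiM_Collect_single) auto
    then show ?thesis using X by (simp add: measure_def)
  qed
  ultimately show ?thesis by simp
qed

section \<open>Numbered lettered graphs as typed matchings\<close>

definition pair_match :: "nat \<Rightarrow> nat \<Rightarrow> (nat \<Rightarrow> (nat \<Rightarrow> nat) \<times> 'f) \<Rightarrow> nat \<times> nat \<Rightarrow> nat \<times> nat" where
  "pair_match d n \<omega> = (\<lambda>h\<in>halves n d. (fst (\<omega> (fst h)) (snd h),
     the_inv_into {..<d} (fst (\<omega> (fst (\<omega> (fst h)) (snd h)))) (fst h)))"

definition edge_type :: "nat \<Rightarrow> nat \<Rightarrow> (nat list \<Rightarrow> 'f) \<Rightarrow> nat \<Rightarrow> nat list \<Rightarrow> 'f" where
  "edge_type d k a i = (\<lambda>x\<in>tball d k tedge. a (rot d i x))"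

text \<open>Left unchanged off the ball, so that reversal is an involution of the whole function type.\<close>

definition edge_rev :: "nat \<Rightarrow> nat \<Rightarrow> (nat list \<Rightarrow> 'f) \<Rightarrow> nat list \<Rightarrow> 'f" where
  "edge_rev d k c = (\<lambda>x. if x \<in> tball d k tedge then c (flip x) else c x)"

lemma tball_tC_tb: "tball d k (tC d) = tb d (Suc k)"
  by (simp add: tball_tC tball_root)

lemma tedge_subset: "0 < d \<Longrightarrow> tball d k tedge \<subseteq> tb d (Suc k)"
  using tball_tedge_subset tball_tC_tb by metis

lemma edge_rev_edge_rev: "0 < d \<Longrightarrow> edge_rev d k (edge_rev d k c) = c"
proof
  fix x assume d: "0 < d"
  show "edge_rev d k (edge_rev d k c) x = c x"
  proof (cases "x \<in> tball d k tedge")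
    case True
    then have "x \<in> tverts d" using tedge_subset[OF d] tb_subset by blast
    then show ?thesis using True flip_ball_edge[OF d True] by (simp add: edge_rev_def flip_flip)
  qed (simp add: edge_rev_def)
qed

context labelled
begin

text \<open>The half-edge (v, i) leads to w, and j is the index under which w lists v; so the map
  pairs the two halves of each edge.\<close>

lemma pair_match:
  assumes \<omega>: "\<omega> \<in> set_pmf LP" and h: "v < n" "i < d"
  obtains w j where "pair_match d n \<omega> (v, i) = (w, j)" "w < n" "j < d" "fst (\<omega> v) i = w" "fst (\<omega> w) j = v" "w \<noteq> v"
    "pair_match d n \<omega> (w, j) = (v, i)"
proof -
  interpret numbering d n G "\<lambda>_ u. fst (\<omega> u)" by (rule numbering_LP[OF \<omega>])
  have T: "[] \<in> tverts d" by simp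
  note Nb = N_bij[OF T]
  define w where "w = fst (\<omega> v) i"
  have e: "(v, w) \<in> G" unfolding w_def by (rule N_in[OF T h])
  then have e': "(w, v) \<in> G" and wn: "w < n" and ne: "w \<noteq> v" using reg_graphsD(2,3,4)[OF G] by metis+
  have inj: "inj_on (fst (\<omega> u)) {..<d}" if "u < n" for u using Nb[OF that] by (simp add: bij_betw_def)
  define j where "j = the_inv_into {..<d} (fst (\<omega> w)) v"
  have "v \<in> fst (\<omega> w) ` {..<d}" using Nb[OF wn] e' by (simp add: bij_betw_def gnbr_def)
  then have j: "j < d" "fst (\<omega> w) j = v"
    using the_inv_into_into[OF inj[OF wn], of v "{..<d}"] f_the_inv_into_f[OF inj[OF wn], of v] by (auto simp: j_def)
  have 1: "pair_match d n \<omega> (v, i) = (w, j)" using h by (simp add: pair_match_def halves_def w_def j_def)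
  have "the_inv_into {..<d} (fst (\<omega> v)) w = i"
    unfolding w_def by (rule the_inv_into_f_f[OF inj[OF h(1)]]) (use h in simp)
  then have 2: "pair_match d n \<omega> (w, j) = (v, i)" using wn j by (simp add: pair_match_def halves_def)
  show thesis by (rule that[OF 1 wn j(1) w_def[symmetric] j(2) ne 2])
qed

lemma pair_match_matchings: "\<omega> \<in> set_pmf LP \<Longrightarrow> pair_match d n \<omega> \<in> matchings (halves n d)"
  unfolding matchings_def
proof (intro CollectI conjI ballI)
  show "pair_match d n \<omega> \<in> extensional (halves n d)" by (simp add: pair_match_def)
  fix h assume \<omega>: "\<omega> \<in> set_pmf LP" and "h \<in> halves n d"
  then obtain v i where h: "h = (v, i)" "v < n" "i < d" by (auto simp: halves_def)
  obtain w j where "pair_match d n \<omega> (v, i) = (w, j)" "w < n" "j < d" "w \<noteq> v" "pair_match d n \<omega> (w, j) = (v, i)"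
    using pair_match[OF \<omega> h(2,3)] by metis
  then show "pair_match d n \<omega> h \<in> halves n d" "pair_match d n \<omega> h \<noteq> h" "pair_match d n \<omega> (pair_match d n \<omega> h) = h"
    using h by (auto simp: halves_def)
qed

text \<open>By \<open>cov_rot\<close>, looking in direction i is the same as starting the cover with
  shift i. The radius k = l + 1 makes the star pattern contain the l-ball of each of the d edges at
  v.\<close>

lemma pat_rot:
  assumes \<omega>: "\<omega> \<in> set_pmf LP" and k: "k = Suc l" and v: "v < n" and i: "i < d" and x: "x \<in> tball d l tedge"
  shows "edge_type d l (pat d k \<omega> v) i x = snd (\<omega> (cov d (\<lambda>_ u. fst (\<omega> u)) v i x))"
proof -
  interpret numbering d n G "\<lambda>_ u. fst (\<omega> u)" by (rule numbering_LP[OF \<omega>])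
  have "x \<in> tb d k" using x tedge_subset[OF d_pos] k by blast
  then have "x \<in> tverts d" "rot d i x \<in> tb d k" using rot_in_tverts[OF d_pos] by (auto simp: tball_root)
  then show ?thesis using x cov_rot[OF v i] by (simp add: edge_type_def pat_def)
qed

text \<open>If (v, i) is matched with (w, j), then by \<open>pat_rot\<close> the two edge types are
  read off the covers starting in the states (v, i) and (w, j), and by \<open>cov_flip\<close> these
  differ by reversing the edge.\<close>

lemma pat_ematch:
  assumes \<omega>: "\<omega> \<in> set_pmf LP" and k: "k = Suc l"
  shows "(pair_match d n \<omega>, restrict (pat d k \<omega>) {..<n}) \<in> ematch n d (PiE (tb d k) (\<lambda>_. UNIV)) (edge_type d l) (edge_rev d l)"
proof -
  interpret numbering d n G "\<lambda>_ u. fst (\<omega> u)" by (rule numbering_LP[OF \<omega>])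
  have "edge_type d l (pat d k \<omega> (fst (pair_match d n \<omega> (v, i)))) (snd (pair_match d n \<omega> (v, i))) = edge_rev d l (edge_type d l (pat d k \<omega> v) i)
     \<and> fst (pair_match d n \<omega> (v, i)) < n"
    if vi: "v < n" "i < d" for v i
  proof -
    obtain w j where wj: "pair_match d n \<omega> (v, i) = (w, j)" "w < n" "j < d" "fst (\<omega> v) i = w" "fst (\<omega> w) j = v"
      using pair_match[OF \<omega> vi] by metis
    have "edge_type d l (pat d k \<omega> w) j x = edge_rev d l (edge_type d l (pat d k \<omega> v) i) x" for x
    proof (cases "x \<in> tball d l tedge")
      case True
      have xT: "x \<in> tverts d" using True tedge_subset[OF d_pos] tb_subset by blast
      have "edge_rev d l (edge_type d l (pat d k \<omega> v) i) x = snd (\<omega> (cov d (\<lambda>_ u. fst (\<omega> u)) v i (flip x)))"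
        using True pat_rot[OF \<omega> k vi flip_ball_edge[OF d_pos True]] by (simp add: edge_rev_def)
      also have "cov d (\<lambda>_ u. fst (\<omega> u)) v i (flip x) = cov d (\<lambda>_ u. fst (\<omega> u)) w j x"
        by (rule cov_flip[OF vi wj(3)]) (use wj xT in auto)
      finally show ?thesis using pat_rot[OF \<omega> k wj(2,3) True] by simp
    qed (simp add: edge_type_def edge_rev_def)
    then show ?thesis using wj by auto
  qed
  then show ?thesis
    using pair_match_matchings[OF \<omega>] unfolding ematch_def halves_def by (auto simp: pat_def)
qed

end

text \<open>The first components of the matching return the numberings and with them the graph; the
  pattern entries at the root return the letters.\<close>

lemma labelled_inj:
  fixes q q' :: "nat \<Rightarrow> 'f::finite pmf"
  assumes "labelled d n G" "labelled d n G'"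
    and \<omega>: "\<omega> \<in> set_pmf (label_pmf d n G q)" and \<omega>': "\<omega>' \<in> set_pmf (label_pmf d n G' q')"
    and eq: "pair_match d n \<omega> = pair_match d n \<omega>'" "restrict (pat d k \<omega>) {..<n} = restrict (pat d k \<omega>') {..<n}"
  shows "G = G' \<and> \<omega> = \<omega>'"
proof -
  interpret a: labelled d n G q k using assms(1) .
  interpret b: labelled d n G' q' k using assms(2) .
  interpret na: numbering d n G "\<lambda>_ u. fst (\<omega> u)" by (rule a.numbering_LP[OF \<omega>])
  interpret nb: numbering d n G' "\<lambda>_ u. fst (\<omega>' u)" by (rule b.numbering_LP[OF \<omega>'])
  have f: "fst (\<omega> v) i = fst (\<omega>' v) i" if "v < n" "i < d" for v i
  proof -
    have "fst (pair_match d n \<omega> (v, i)) = fst (pair_match d n \<omega>' (v, i))" using eq(1) by simp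
    then show ?thesis using that by (simp add: pair_match_def halves_def)
  qed
  have s: "snd (\<omega> v) = snd (\<omega>' v)" if "v < n" for v
  proof -
    have "restrict (pat d k \<omega>) {..<n} v [] = restrict (pat d k \<omega>') {..<n} v []" using eq(2) by simp
    then show ?thesis using that by (simp add: pat_def tball_root)
  qed
  have ff: "fst (\<omega> v) = fst (\<omega>' v)" if v: "v < n" for v
  proof (rule extensionalityI[of _ "{..<d}"])
    show "fst (\<omega> v) \<in> extensional {..<d}" "fst (\<omega>' v) \<in> extensional {..<d}"
      using \<omega> \<omega>' v by (auto simp: a.set_LP b.set_LP numb_def)
  qed (use f v in auto)
  have "\<omega> v = \<omega>' v" for v
  proof (cases "v < n")
    case True
    then show ?thesis using s ff by (simp add: prod_eq_iff)
  next
    case False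
    then show ?thesis using \<omega> \<omega>' by (auto simp: a.set_LP b.set_LP)
  qed
  then have "\<omega> = \<omega>'" by blast
  moreover have "G = G'"
  proof -
    have "gnbr G v = gnbr G' v" if "v < n" for v
    proof -
      have "gnbr G v = fst (\<omega> v) ` {..<d}" "gnbr G' v = fst (\<omega>' v) ` {..<d}"
        using na.N_bij[of "[]" v] nb.N_bij[of "[]" v] that by (simp_all add: bij_betw_def)
      then show ?thesis using ff[OF that] by simp
    qed
    moreover have "(v, w) \<in> G \<longleftrightarrow> v < n \<and> w \<in> gnbr G v" "(v, w) \<in> G' \<longleftrightarrow> v < n \<and> w \<in> gnbr G' v" for v w
      using reg_graphsD(1)[OF a.G] reg_graphsD(1)[OF b.G] by (auto simp: gnbr_def)
    ultimately show ?thesis by auto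
  qed
  ultimately show ?thesis by simp
qed

text \<open>The encoding is injective in the graph and its labels jointly, so the contributions of
  different graphs add up, even though the letter laws q vary with the graph.\<close>

lemma good_graphs_le_ematch:
  fixes d n l :: nat and q :: "(nat \<times> nat) set \<Rightarrow> nat \<Rightarrow> 'f::finite pmf" and p :: "(nat list \<Rightarrow> 'f) \<Rightarrow> real"
    and B \<delta> :: real
  defines "A \<equiv> PiE (tb d (Suc l)) (\<lambda>_. UNIV :: 'f set)"
  assumes d: "0 < d" and n: "0 < n" and R: "R \<subseteq> reg_graphs d n"
    and B: "\<And>G. G \<in> R \<Longrightarrow> B \<le> card {\<omega> \<in> set_pmf (label_pmf d n G (q G)). \<forall>a\<in>A. \<bar>card {v \<in> {..<n}. pat d (Suc l) \<omega> v = a} / n - p a\<bar> < \<delta>}"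
  shows "card R * B \<le> card {(\<sigma>, L) \<in> ematch n d A (edge_type d l) (edge_rev d l). \<forall>a\<in>A. \<bar>card {v \<in> {..<n}. L v = a} / n - p a\<bar> < \<delta>}"
proof -
  let ?M = "{(\<sigma>, L) \<in> ematch n d A (edge_type d l) (edge_rev d l). \<forall>a\<in>A. \<bar>card {v \<in> {..<n}. L v = a} / n - p a\<bar> < \<delta>}"
  define W where "W = (\<lambda>G. {\<omega> \<in> set_pmf (label_pmf d n G (q G)). \<forall>a\<in>A. \<bar>card {v \<in> {..<n}. pat d (Suc l) \<omega> v = a} / n - p a\<bar> < \<delta>})"
  have lab: "labelled d n G" if "G \<in> R" for G using that R d n by (auto intro: labelled.intro)
  have finR: "finite R" using R finite_reg_graphs finite_subset by blast
  have finW: "finite (W G)" if "G \<in> R" for G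
    using labelled.finite_LP[OF lab[OF that], of "q G"] by (simp add: W_def)
  have finA: "finite A" unfolding A_def by (rule finite_PiE[OF finite_tb]) simp
  have "card (SIGMA G:R. W G) \<le> card ?M"
  proof (rule card_inj_on_le[where f = "\<lambda>(G, \<omega>). (pair_match d n \<omega>, restrict (pat d (Suc l) \<omega>) {..<n})"])
    show "inj_on (\<lambda>(G, \<omega>). (pair_match d n \<omega>, restrict (pat d (Suc l) \<omega>) {..<n})) (SIGMA G:R. W G)"
    proof (rule inj_onI)
      fix x y assume x: "x \<in> (SIGMA G:R. W G)" and y: "y \<in> (SIGMA G:R. W G)"
        and eq: "(\<lambda>(G, \<omega>). (pair_match d n \<omega>, restrict (pat d (Suc l) \<omega>) {..<n})) x = (\<lambda>(G, \<omega>). (pair_match d n \<omega>, restrict (pat d (Suc l) \<omega>) {..<n})) y"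
      obtain G \<omega> G' \<omega>' where xy: "x = (G, \<omega>)" "y = (G', \<omega>')" by fastforce
      have "G = G' \<and> \<omega> = \<omega>'"
        by (rule labelled_inj[of d n G G' \<omega> "q G" \<omega>' "q G'" "Suc l"]) (use x y eq xy lab in \<open>auto simp: W_def\<close>)
      then show "x = y" using xy by simp
    qed
    show "(\<lambda>(G, \<omega>). (pair_match d n \<omega>, restrict (pat d (Suc l) \<omega>) {..<n})) ` (SIGMA G:R. W G) \<subseteq> ?M"
    proof (rule image_subsetI)
      fix x assume x: "x \<in> (SIGMA G:R. W G)"
      obtain G \<omega> where xy: "x = (G, \<omega>)" by fastforce
      have G: "G \<in> R" and \<omega>: "\<omega> \<in> set_pmf (label_pmf d n G (q G))" "\<forall>a\<in>A. \<bar>card {v \<in> {..<n}. pat d (Suc l) \<omega> v = a} / n - p a\<bar> < \<delta>"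
        using x xy by (auto simp: W_def)
      have c: "{v \<in> {..<n}. restrict (pat d (Suc l) \<omega>) {..<n} v = a} = {v \<in> {..<n}. pat d (Suc l) \<omega> v = a}" for a by auto
      show "(\<lambda>(G, \<omega>). (pair_match d n \<omega>, restrict (pat d (Suc l) \<omega>) {..<n})) x \<in> ?M"
        using labelled.pat_ematch[where l = l and k = "Suc l", OF lab[OF G] \<omega>(1) refl, folded A_def] \<omega>(2)
        unfolding xy by (simp only: mem_Collect_eq case_prod_conv c)
    qed
    show "finite ?M" by (rule finite_subset[OF _ finite_ematch[OF finA]]) auto
  qed
  moreover have "card (SIGMA G:R. W G) = (\<Sum>G\<in>R. card (W G))" by (rule card_SigmaI[OF finR]) (use finW in blast)
  moreover have "card R * B \<le> (\<Sum>G\<in>R. real (card (W G)))"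
    using sum_bounded_below[of R B "\<lambda>G. real (card (W G))"] B unfolding W_def by simp
  ultimately show ?thesis by (simp flip: of_nat_sum)
qed

text \<open>The left side is the law of what a star shows in direction i. Invariance under the
  rotation by i identifies this with direction 0, so all d directions give the marginal on
  B_k(e).\<close>

lemma edge_marginal:
  fixes \<phi> :: "'x::metric_space \<Rightarrow> 'f::finite pmf" and \<mu> :: "(nat list \<Rightarrow> 'x) measure" and d k i :: nat
  assumes \<phi>: "cont_discretization \<phi>" and inv: "invariant_process d borel \<mu>" and i: "i < d"
    and c: "c \<in> PiE (tball d k tedge) (\<lambda>_. UNIV :: 'f set)"
  defines "\<nu> \<equiv> discr_conv d \<phi> \<mu>" and "A \<equiv> PiE (tb d (Suc k)) (\<lambda>_. UNIV :: 'f set)"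
  shows "(\<Sum>a\<in>{a \<in> A. edge_type d k a i = c}. measure \<nu> {\<beta>\<in>space \<nu>. \<forall>v\<in>tb d (Suc k). \<beta> v = a v})
    = measure \<nu> {\<beta>\<in>space \<nu>. \<forall>v\<in>tball d k tedge. \<beta> v = c v}"
proof -
  let ?B = "tb d (Suc k)" and ?E = "tball d k tedge"
  have d: "0 < d" using i by simp
  interpret prob_space \<nu> unfolding \<nu>_def by (rule prob_space_discr[OF \<phi> inv])
  have sets: "sets \<nu> = sets (PiM (tverts d) (\<lambda>_. count_space (UNIV :: 'f set)))"
    unfolding \<nu>_def by (rule sets_discr[OF \<phi> inv])
  have EB: "?E \<subseteq> ?B" by (rule tedge_subset[OF d])
  have ET: "?E \<subseteq> tverts d" using EB tb_subset by blast
  have finE: "finite ?E" using EB finite_tb finite_subset by blast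
  have finA: "finite A" unfolding A_def by (rule finite_PiE[OF finite_tb]) simp
  have rotB: "rot d i x \<in> ?B" if "x \<in> ?B" for x using that rot_in_tverts[OF d] by (auto simp: tball_root)
  have space: "space \<nu> = PiE (tverts d) (\<lambda>_. UNIV)" using sets_eq_imp_space_eq[OF sets] by (simp add: space_PiM)
  have "distr \<nu> \<nu> (\<lambda>\<alpha>. restrict (\<alpha> \<circ> rot d i) (tverts d)) = \<nu>"
    using invariant_discr[OF \<phi> inv] tree_aut_rot[OF d i] by (simp add: invariant_process_def \<nu>_def)
  then have "measure \<nu> {\<beta>\<in>space \<nu>. \<forall>v\<in>?E. \<beta> v = c v}
    = measure (distr \<nu> \<nu> (\<lambda>\<alpha>. restrict (\<alpha> \<circ> rot d i) (tverts d))) {\<beta>\<in>space \<nu>. \<forall>v\<in>?E. \<beta> v = c v}" by simp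
  also have "\<dots> = measure \<nu> ((\<lambda>\<alpha>. restrict (\<alpha> \<circ> rot d i) (tverts d)) -` {\<beta>\<in>space \<nu>. \<forall>v\<in>?E. \<beta> v = c v} \<inter> space \<nu>)"
  proof (rule measure_distr)
    show "(\<lambda>\<alpha>. restrict (\<alpha> \<circ> rot d i) (tverts d)) \<in> measurable \<nu> \<nu>"
      unfolding measurable_cong_sets[OF sets sets] comp_def
      by (rule measurable_restrict) (rule measurable_component_singleton, rule rot_in_tverts[OF d])
    show "{\<beta>\<in>space \<nu>. \<forall>v\<in>?E. \<beta> v = c v} \<in> events" by (rule sets_cylinder[OF sets finE ET])
  qed
  also have "(\<lambda>\<alpha>. restrict (\<alpha> \<circ> rot d i) (tverts d)) -` {\<beta>\<in>space \<nu>. \<forall>v\<in>?E. \<beta> v = c v} \<inter> space \<nu>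
    = (\<Union>a\<in>{a \<in> A. edge_type d k a i = c}. {\<beta>\<in>space \<nu>. \<forall>v\<in>?B. \<beta> v = a v})" (is "?L = ?R")
  proof
    show "?L \<subseteq> ?R"
    proof
      fix \<beta> assume \<beta>: "\<beta> \<in> ?L"
      have *: "\<beta> (rot d i x) = c x" if x: "x \<in> ?E" for x
      proof -
        have "\<forall>v\<in>?E. restrict (\<beta> \<circ> rot d i) (tverts d) v = c v"
          using \<beta> unfolding Int_iff vimage_eq mem_Collect_eq by blast
        then have "restrict (\<beta> \<circ> rot d i) (tverts d) x = c x" using x by (rule bspec)
        then show ?thesis using x ET by auto
      qed
      have "edge_type d k (restrict \<beta> ?B) i = c"
      proof (rule PiE_ext[OF _ c])
        fix x assume x: "x \<in> ?E"
        then have "rot d i x \<in> ?B" using rotB EB by blast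
        then show "edge_type d k (restrict \<beta> ?B) i x = c x"
          using x *[OF x] by (simp add: edge_type_def del: tball.simps)
      qed (simp add: edge_type_def del: tball.simps)
      then show "\<beta> \<in> ?R" using \<beta> by (intro UN_I[of "restrict \<beta> ?B"]) (auto simp: A_def)
    qed
    show "?R \<subseteq> ?L"
    proof
      fix \<beta> assume "\<beta> \<in> ?R"
      then obtain a where a: "edge_type d k a i = c" "\<beta> \<in> space \<nu>" "\<And>v. v \<in> ?B \<Longrightarrow> \<beta> v = a v" by auto
      have "\<beta> (rot d i x) = c x" if x: "x \<in> ?E" for x
      proof -
        have "c x = a (rot d i x)" using x unfolding a(1)[symmetric] by (simp add: edge_type_def)
        moreover have "\<beta> (rot d i x) = a (rot d i x)" by (rule a(3)[OF rotB]) (use x EB in blast)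
        ultimately show ?thesis by simp
      qed
      then show "\<beta> \<in> ?L" using a(2) ET by (auto simp: space)
    qed
  qed
  also have "measure \<nu> ?R = (\<Sum>a\<in>{a \<in> A. edge_type d k a i = c}. measure \<nu> {\<beta>\<in>space \<nu>. \<forall>v\<in>?B. \<beta> v = a v})"
  proof (rule finite_measure_finite_Union)
    show "finite {a \<in> A. edge_type d k a i = c}" using finA by simp
    show "(\<lambda>a. {\<beta>\<in>space \<nu>. \<forall>v\<in>?B. \<beta> v = a v}) ` {a \<in> A. edge_type d k a i = c} \<subseteq> events"
      by (rule image_subsetI) (rule sets_cylinder[OF sets finite_tb tb_subset])
    show "disjoint_family_on (\<lambda>a. {\<beta>\<in>space \<nu>. \<forall>v\<in>?B. \<beta> v = a v}) {a \<in> A. edge_type d k a i = c}"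
      unfolding disjoint_family_on_def
    proof (intro ballI impI)
      fix a b assume ab: "a \<in> {a \<in> A. edge_type d k a i = c}" "b \<in> {a \<in> A. edge_type d k a i = c}" "a \<noteq> b"
      then obtain v where "v \<in> ?B" "a v \<noteq> b v" by (auto simp: A_def fun_eq_iff PiE_iff extensional_def) metis
      then show "{\<beta>\<in>space \<nu>. \<forall>v\<in>?B. \<beta> v = a v} \<inter> {\<beta>\<in>space \<nu>. \<forall>v\<in>?B. \<beta> v = b v} = {}"
        by (auto simp del: tball.simps dest!: bspec[of ?B _ v])
    qed
  qed
  finally show ?thesis by simp
qed

section \<open>Comparison of the two counts\<close>

lemma eventually_poly_less_exp:
  fixes \<epsilon> :: real
  assumes "0 < \<epsilon>"
  shows "eventually (\<lambda>n. 8 * (real (n * d) ^ 3 + 1) ^ a * (exp 1 * (real (n * d) + 1)) ^ b < exp (n * \<epsilon>)) sequentially"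
proof -
  define m where "m = 3 * a + b"
  \<comment> \<open>Chosen so that e (nd + 1) <= C n \<epsilon> for n >= 1, which bounds the whole
    polynomial by a multiple of (n \<epsilon>)^m.\<close>
  define C where "C = exp 1 * (real d + 1) / \<epsilon>"
  have C: "0 < C" using assms by (auto simp: C_def intro!: divide_pos_pos mult_pos_pos add_nonneg_pos)
  have "((\<lambda>x. x ^ m / exp x) \<longlongrightarrow> (0 :: real)) at_top" by (rule tendsto_power_div_exp_0)
  moreover have "filterlim (\<lambda>n. real n * \<epsilon>) at_top sequentially"
    using assms by (intro filterlim_at_top_mult_tendsto_pos[OF tendsto_const] filterlim_real_sequentially)
      (simp_all add: filterlim_real_sequentially filterlim_tendsto_pos_mult_at_top mult.commute)
  ultimately have "((\<lambda>n. (real n * \<epsilon>) ^ m / exp (real n * \<epsilon>)) \<longlongrightarrow> 0) sequentially"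
    by (rule filterlim_compose)
  then have "eventually (\<lambda>n. (real n * \<epsilon>) ^ m / exp (real n * \<epsilon>) < 1 / (8 * C ^ m)) sequentially"
    using C by (intro order_tendstoD) auto
  then show ?thesis using eventually_gt_at_top[of 0]
  proof eventually_elim
    case (elim n)
    define Y where "Y = exp 1 * (real (n * d) + 1)"
    have Y1: "real (n * d) + 1 \<le> Y" unfolding Y_def using mult_right_mono[of 1 "exp 1" "real (n * d) + 1"] by simp
    have Y0: "0 \<le> Y" using Y1 of_nat_0_le_iff[of "n * d"] by linarith
    have "real (n * d) ^ 3 + 1 \<le> (real (n * d) + 1) ^ 3" by (simp add: power3_eq_cube algebra_simps)
    also have "\<dots> \<le> Y ^ 3" using Y1 by (intro power_mono) auto
    finally have "(real (n * d) ^ 3 + 1) ^ a \<le> (Y ^ 3) ^ a" by (intro power_mono) auto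
    then have "8 * (real (n * d) ^ 3 + 1) ^ a * Y ^ b \<le> 8 * (Y ^ 3) ^ a * Y ^ b"
      using Y0 by (intro mult_right_mono mult_left_mono) auto
    also have "\<dots> = 8 * Y ^ m" by (simp add: m_def power_mult[symmetric] power_add)
    also have "Y ^ m \<le> (C * (real n * \<epsilon>)) ^ m"
    proof (rule power_mono[OF _ Y0])
      have "real (n * d) + 1 \<le> real n * (real d + 1)" using elim(2) by (simp add: algebra_simps)
      then have "Y \<le> exp 1 * (real n * (real d + 1))" unfolding Y_def by (intro mult_left_mono) auto
      also have "\<dots> = C * (real n * \<epsilon>)" using assms by (simp add: C_def)
      finally show "Y \<le> C * (real n * \<epsilon>)" .
    qed
    also have "8 * (C * (real n * \<epsilon>)) ^ m < exp (n * \<epsilon>)"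
      using elim(1) C by (simp add: power_mult_distrib field_simps)
    finally show ?case by (simp add: Y_def)
  qed
qed

text \<open>Markov's inequality: the assumption on s makes s n at least four times the mean bound
  from \<open>sum_cyc_vert\<close>.\<close>

lemma few_cyclic_graphs:
  fixes s :: real
  assumes d: "0 < d" and n: "4 * (d + 1) ^ (k + 1) \<le> n" and s: "real (8 * d * ((d + 1) ^ k)\<^sup>2) \<le> s * n"
  shows "4 * card {G \<in> reg_graphs d n. \<not> real (card {v. v < n \<and> cyc_vert d n G k v}) \<le> s * n} \<le> card (reg_graphs d n)"
proof -
  let ?R = "reg_graphs d n" and ?c = "\<lambda>G. card {v. v < n \<and> cyc_vert d n G k v}"
  let ?X = "{G \<in> ?R. \<not> real (?c G) \<le> s * n}"
  define C where "C = 2 * d * ((d + 1) ^ k)\<^sup>2"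
  have Cpos: "0 < C" using d by (simp add: C_def)
  have "card ?X * (s * n) = (\<Sum>G\<in>?X. s * n)" by simp
  also have "\<dots> \<le> (\<Sum>G\<in>?X. real (?c G))" by (rule sum_mono) auto
  also have "\<dots> \<le> (\<Sum>G\<in>?R. real (?c G))" by (rule sum_mono2) (auto simp: finite_reg_graphs)
  also have "\<dots> = real (\<Sum>G\<in>?R. ?c G)" by simp
  also have "\<dots> \<le> real (C * card ?R)" unfolding C_def of_nat_le_iff by (rule sum_cyc_vert[OF d n])
  finally have "card ?X * (s * n) \<le> C * card ?R" by simp
  moreover have "card ?X * real (4 * C) \<le> card ?X * (s * n)" using s by (intro mult_left_mono) (auto simp: C_def)
  ultimately have "real (card ?X * (4 * C)) \<le> real (C * card ?R)" by simp
  then have "card ?X * (4 * C) \<le> C * card ?R" by (simp only: of_nat_le_iff)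
  then show ?thesis using Cpos by (simp add: mult.commute mult.left_commute)
qed

text \<open>Along almost every sequence of graphs weak convergence brings both quantities close for
  all large i. Closeness at i concerns only the i-th graph, so its failure probability tends to 0
  and drops below 1/4.\<close>

lemma typical_good_graphs:
  fixes \<phi> :: "'x::metric_space \<Rightarrow> 'f::finite pmf" and \<mu> :: "(nat list \<Rightarrow> 'x) measure" and n :: "nat \<Rightarrow> nat"
    and d k :: nat and t \<epsilon> :: real
  assumes \<phi>: "cont_discretization \<phi>" and d: "0 < d" and n: "strict_mono n" "\<And>i. reg_graphs d (n i) \<noteq> {}"
    and AE: "AE Gs in PiM UNIV (\<lambda>i. measure_pmf (pmf_of_set (reg_graphs d (n i)))).
        \<exists>f :: nat \<Rightarrow> nat \<Rightarrow> 'x. weak_conv d (\<lambda>i. distr_star d (n i) (Gs i) (f i)) \<mu>"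
    and A: "finite A" and t: "0 < t" and \<epsilon>: "0 < \<epsilon>"
  defines "Q \<equiv> \<lambda>i G f. (\<forall>a\<in>A. \<bar>(\<Sum>v<n i. labelled.mean_at d (n i) G (\<lambda>v. \<phi> (f v)) k v a) / n i - (\<integral>\<alpha>. (\<Prod>x\<in>tb d k. pmf (\<phi> (\<alpha> x)) (a x)) \<partial>\<mu>)\<bar> < t)
      \<and> \<bar>(\<Sum>v<n i. pmf_entropy (\<phi> (f v))) / n i - (\<integral>\<alpha>. pmf_entropy (\<phi> (\<alpha> [])) \<partial>\<mu>)\<bar> < \<epsilon>"
  shows "eventually (\<lambda>i. 4 * card {G \<in> reg_graphs d (n i). \<not> (\<exists>f. Q i G f)} \<le> card (reg_graphs d (n i))) sequentially"
proof -
  let ?p = "\<lambda>i. pmf_of_set (reg_graphs d (n i))"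
  have ge: "i \<le> n i" for i using seq_suble[OF n(1)] .
  have set_p: "set_pmf (?p i) = reg_graphs d (n i)" for i by (rule set_pmf_of_set[OF n(2) finite_reg_graphs])
  have "AE Gs in PiM UNIV (\<lambda>i. measure_pmf (?p i)). \<forall>i. Gs i \<in> reg_graphs d (n i)"
  proof (subst AE_all_countable, rule allI)
    fix i
    have "AE G in measure_pmf (?p i). G \<in> reg_graphs d (n i)" unfolding AE_measure_pmf_iff set_p by simp
    then show "AE Gs in PiM UNIV (\<lambda>i. measure_pmf (?p i)). Gs i \<in> reg_graphs d (n i)"
      by (intro AE_PiM_component[where i = i] prob_space_measure_pmf) auto
  qed
  with AE have "AE Gs in PiM UNIV (\<lambda>i. measure_pmf (?p i)). eventually (\<lambda>i. \<exists>f. Q i (Gs i) f) sequentially"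
  proof eventually_elim
    case (elim Gs)
    then obtain f where f: "weak_conv d (\<lambda>i. distr_star d (n i) (Gs i) (f i)) \<mu>" by blast
    have G: "Gs i \<in> reg_graphs d (n i)" for i using elim(2) by blast
    have "eventually (\<lambda>i. \<forall>a\<in>A. \<bar>(\<integral>\<alpha>. (\<Prod>x\<in>tb d k. pmf (\<phi> (\<alpha> x)) (a x)) \<partial>distr_star d (n i) (Gs i) (f i))
       - (\<integral>\<alpha>. (\<Prod>x\<in>tb d k. pmf (\<phi> (\<alpha> x)) (a x)) \<partial>\<mu>)\<bar> < t) sequentially"
    proof (rule eventually_ball_finite[OF A], rule ballI)
      fix a
      from tendstoD[OF pattern_limit[OF \<phi> f, where k = k and a = a] t]
      show "eventually (\<lambda>i. \<bar>(\<integral>\<alpha>. (\<Prod>x\<in>tb d k. pmf (\<phi> (\<alpha> x)) (a x)) \<partial>distr_star d (n i) (Gs i) (f i))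
       - (\<integral>\<alpha>. (\<Prod>x\<in>tb d k. pmf (\<phi> (\<alpha> x)) (a x)) \<partial>\<mu>)\<bar> < t) sequentially" by (simp only: dist_real_def)
    qed
    moreover have "eventually (\<lambda>i. \<bar>(\<integral>\<alpha>. pmf_entropy (\<phi> (\<alpha> [])) \<partial>distr_star d (n i) (Gs i) (f i))
       - (\<integral>\<alpha>. pmf_entropy (\<phi> (\<alpha> [])) \<partial>\<mu>)\<bar> < \<epsilon>) sequentially"
      using tendstoD[OF entropy_limit[OF \<phi> f] \<epsilon>] by (simp only: dist_real_def)
    ultimately show ?case using eventually_gt_at_top[of 0]
    proof eventually_elim
      case (elim i)
      have ni: "0 < n i" using ge[of i] elim(3) by simp
      have "Q i (Gs i) (f i)" unfolding Q_def
        using elim(1,2) unfolding integral_pattern[OF \<phi> d ni G] integral_root_entropy[OF \<phi> d ni G] by blast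
      then show ?case by blast
    qed
  qed
  from AE_eventually_prob_tendsto_0[where Q = "\<lambda>i G. \<exists>f. Q i G f", OF this]
  have "eventually (\<lambda>i. measure_pmf.prob (?p i) {G. \<not> (\<exists>f. Q i G f)} < 1 / 4) sequentially"
    by (rule order_tendstoD) simp
  then show ?thesis
  proof eventually_elim
    case (elim i)
    have c: "0 < card (reg_graphs d (n i))" using n(2) finite_reg_graphs by (simp add: card_gt_0_iff)
    have "reg_graphs d (n i) \<inter> {G. \<not> (\<exists>f. Q i G f)} = {G \<in> reg_graphs d (n i). \<not> (\<exists>f. Q i G f)}" by blast
    then have "real (card {G \<in> reg_graphs d (n i). \<not> (\<exists>f. Q i G f)}) / card (reg_graphs d (n i)) < 1 / 4"
      using elim by (simp only: measure_pmf_of_set[OF n(2) finite_reg_graphs])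
    then have "4 * real (card {G \<in> reg_graphs d (n i). \<not> (\<exists>f. Q i G f)}) < card (reg_graphs d (n i))"
      using c by (simp add: field_simps)
    then show ?case by linarith
  qed
qed

text \<open>If the inequality failed by 4 \<epsilon>, at least half of the regular graphs would have
  (d!)^n exp(n (EH - 2 \<epsilon>)) / 2 labellings each, while at most (nd-1)!! exp(n (h +
  \<epsilon>)) times a polynomial are available in total. The remaining gap \<epsilon> n in the
  exponent beats all polynomial factors.\<close>

lemma typical_entropy_inequality:
  fixes \<phi> :: "'x::metric_space \<Rightarrow> 'f::finite pmf" and \<mu> :: "(nat list \<Rightarrow> 'x) measure" and d k :: nat
  assumes \<phi>: "cont_discretization \<phi>" and inv: "invariant_process d borel \<mu>" and tp: "typical d \<mu>" and d: "0 < d"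
  defines "\<nu> \<equiv> discr_conv d \<phi> \<mu>"
  shows "(\<integral>\<alpha>. pmf_entropy (\<phi> (\<alpha> [])) \<partial>\<mu>) \<le> marg_entropy \<nu> (tball d k (tC d)) - d / 2 * marg_entropy \<nu> (tball d k tedge)"
proof (rule ccontr)
  let ?B = "tb d (Suc k)" and ?E = "tball d k tedge"
  define A where "A = PiE ?B (\<lambda>_. UNIV :: 'f set)"
  define E where "E = PiE ?E (\<lambda>_. UNIV :: 'f set)"
  define p where "p = (\<lambda>a. measure \<nu> {\<beta>\<in>space \<nu>. \<forall>v\<in>?B. \<beta> v = a v})"
  define q where "q = (\<lambda>c. (\<Sum>a\<in>A. p a * card {i \<in> {..<d}. edge_type d k a i = c}) / d)"
  define EH where "EH = (\<integral>\<alpha>. pmf_entropy (\<phi> (\<alpha> [])) \<partial>\<mu>)"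
  define h where "h = ent A p - d / 2 * ent E q"
  have finA: "finite A" unfolding A_def by (rule finite_PiE[OF finite_tb]) simp
  have finE: "finite E" unfolding E_def
    by (rule finite_PiE[OF finite_subset[OF tedge_subset[OF d] finite_tb]]) simp
  have p_eq: "p a = (\<integral>\<alpha>. (\<Prod>x\<in>?B. pmf (\<phi> (\<alpha> x)) (a x)) \<partial>\<mu>)" for a
    unfolding p_def \<nu>_def by (rule measure_discr[OF \<phi> inv finite_tb tb_subset])
  have entA: "ent A p = marg_entropy \<nu> (tball d k (tC d))"
    unfolding ent_def marg_entropy_def p_def A_def tball_tC_tb ..
  \<comment> \<open>The frequency q averages over the d directions, which all give the same edge
    marginal.\<close>
  have q_eq: "q c = measure \<nu> {\<beta>\<in>space \<nu>. \<forall>v\<in>?E. \<beta> v = c v}" if c: "c \<in> E" for c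
  proof -
    have "(\<Sum>a\<in>A. p a * card {i \<in> {..<d}. edge_type d k a i = c}) = (\<Sum>a\<in>A. \<Sum>i<d. if edge_type d k a i = c then p a else 0)"
      by (simp add: sum.If_cases Int_def mult.commute)
    also have "\<dots> = (\<Sum>i<d. \<Sum>a\<in>A. if edge_type d k a i = c then p a else 0)" by (rule sum.swap)
    also have "\<dots> = (\<Sum>i<d. \<Sum>a\<in>{a \<in> A. edge_type d k a i = c}. p a)"
      by (rule sum.cong[OF refl]) (simp add: sum.inter_filter finA)
    also have "\<dots> = (\<Sum>i<d. measure \<nu> {\<beta>\<in>space \<nu>. \<forall>v\<in>?E. \<beta> v = c v})"
    proof (rule sum.cong)
      fix i assume "i \<in> {..<d}"
      then show "(\<Sum>a\<in>{a \<in> A. edge_type d k a i = c}. p a) = measure \<nu> {\<beta>\<in>space \<nu>. \<forall>v\<in>?E. \<beta> v = c v}"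
        using edge_marginal[OF \<phi> inv, of i c k] c unfolding p_def A_def \<nu>_def E_def by simp
    qed simp
    finally show ?thesis unfolding q_def using d by simp
  qed
  have entE: "ent E q = marg_entropy \<nu> ?E"
    unfolding ent_def marg_entropy_def using q_eq by (simp add: E_def)
  assume "\<not> (\<integral>\<alpha>. pmf_entropy (\<phi> (\<alpha> [])) \<partial>\<mu>) \<le> marg_entropy \<nu> (tball d k (tC d)) - d / 2 * marg_entropy \<nu> (tball d k tedge)"
  then have less: "h < EH" unfolding h_def EH_def entA entE by simp
  \<comment> \<open>Four units: two for the lower count (closeness of the mean entropy, and
    equipartition), one for the upper count, one for the polynomial factors.\<close>
  define \<epsilon> where "\<epsilon> = (EH - h) / 4"
  have \<epsilon>: "0 < \<epsilon>" using less by (simp add: \<epsilon>_def)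
  have e_in: "edge_type d k a i \<in> E" for a i by (simp add: edge_type_def E_def)
  have p0: "0 \<le> p a" for a by (simp add: p_def)
  define m where "m = card E + card A + 1"
  obtain \<delta> where \<delta>: "\<delta> > 0" "\<And>n. 0 < n \<Longrightarrow>
    real (card {(\<sigma>, L) \<in> ematch n d A (edge_type d k) (edge_rev d k). \<forall>a\<in>A. \<bar>card {v \<in> {..<n}. L v = a} / n - p a\<bar> < \<delta>})
     \<le> num_matchings (n * d) * (exp 1 * (real (n * d) + 1)) ^ m * exp (n * (h + \<epsilon>))"
    using card_ematch_near[of "edge_rev d k" A E d "edge_type d k" p \<epsilon>, OF edge_rev_edge_rev[OF d] finA finE e_in d p0 \<epsilon>]
    unfolding q_def[symmetric] h_def[symmetric] m_def[symmetric] by blast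
  \<comment> \<open>In \<open>card_near_lower\<close> the tolerance doubles: t for the mean
    frequencies and t for the deviation from them.\<close>
  define t where "t = \<delta> / 2"
  have t: "0 < t" using \<delta>(1) by (simp add: t_def)
  obtain n :: "nat \<Rightarrow> nat" where n: "strict_mono n" "\<And>i. reg_graphs d (n i) \<noteq> {}"
    "AE Gs in PiM UNIV (\<lambda>i. measure_pmf (pmf_of_set (reg_graphs d (n i)))).
        \<exists>f :: nat \<Rightarrow> nat \<Rightarrow> 'x. weak_conv d (\<lambda>i. distr_star d (n i) (Gs i) (f i)) \<mu>"
    using tp unfolding typical_def by blast
  define Q where "Q = (\<lambda>i G f. (\<forall>a\<in>A. \<bar>(\<Sum>v<n i. labelled.mean_at d (n i) G (\<lambda>v. \<phi> (f v)) (Suc k) v a) / n i - p a\<bar> < t)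
      \<and> \<bar>(\<Sum>v<n i. pmf_entropy (\<phi> (f v))) / n i - EH\<bar> < \<epsilon>)"
  have good: "eventually (\<lambda>i. 4 * card {G \<in> reg_graphs d (n i). \<not> (\<exists>f. Q i G f)} \<le> card (reg_graphs d (n i))) sequentially"
    using typical_good_graphs[OF \<phi> d n finA t \<epsilon>, of "Suc k"] unfolding Q_def p_eq EH_def .
  have nlim: "filterlim n at_top sequentially" by (rule filterlim_subseq[OF n(1)])
  have large: "eventually (\<lambda>N. X \<le> real N * c) sequentially" if "0 < c" for X c :: real
  proof -
    have "filterlim (\<lambda>N. real N * c) at_top sequentially"
      using that by (intro filterlim_at_top_mult_tendsto_pos[OF tendsto_const _ filterlim_real_sequentially])
    then show ?thesis unfolding filterlim_at_top by blast
  qed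
  let ?D = "12 * d\<^sup>2"
  define ok where "ok = (\<lambda>N::nat. 8 * (real (N * d) ^ 3 + 1) ^ ?D * (exp 1 * (real (N * d) + 1)) ^ m < exp (N * \<epsilon>)
    \<and> real (8 * d * ((d + 1) ^ Suc k)\<^sup>2) \<le> N * (t / 2) \<and> real (16 * card A * (d + 1) ^ (2 * Suc k)) \<le> N * t\<^sup>2
    \<and> real (16 * CARD('f)) \<le> N * \<epsilon>\<^sup>2 \<and> 4 * (d + 1) ^ (Suc k + 1) \<le> N \<and> 4 * d * (d + 1) + 12 * d\<^sup>2 + 5 < N \<and> 0 < N)"
  have "eventually ok sequentially"
    unfolding ok_def
    by (intro eventually_conj eventually_poly_less_exp large \<epsilon> eventually_ge_at_top eventually_gt_at_top) (use t \<epsilon> in auto)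
  then have "eventually (\<lambda>i. ok (n i)) sequentially" using nlim by (rule eventually_compose_filterlim)
  with good have "eventually (\<lambda>i. ok (n i) \<and> 4 * card {G \<in> reg_graphs d (n i). \<not> (\<exists>f. Q i G f)} \<le> card (reg_graphs d (n i))) sequentially"
    by eventually_elim simp
  then obtain i where i: "ok (n i)" "4 * card {G \<in> reg_graphs d (n i). \<not> (\<exists>f. Q i G f)} \<le> card (reg_graphs d (n i))"
    using eventually_happens'[OF sequentially_bot] by blast
  define N where "N = n i"
  let ?R = "reg_graphs d N"
  let ?c = "\<lambda>G. real (card {v. v < N \<and> cyc_vert d N G (Suc k) v}) \<le> t / 2 * N"
  have N: "8 * (real (N * d) ^ 3 + 1) ^ ?D * (exp 1 * (real (N * d) + 1)) ^ m < exp (N * \<epsilon>)"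
    "real (8 * d * ((d + 1) ^ Suc k)\<^sup>2) \<le> t / 2 * N" "real (16 * card A * (d + 1) ^ (2 * Suc k)) \<le> N * t\<^sup>2"
    "real (16 * CARD('f)) \<le> N * \<epsilon>\<^sup>2" "4 * (d + 1) ^ (Suc k + 1) \<le> N" "4 * d * (d + 1) + 12 * d\<^sup>2 + 5 < N" "0 < N"
    using i(1) unfolding ok_def N_def[symmetric] by (simp_all only: mult.commute[of _ "t / 2"])
  define R where "R = {G \<in> ?R. (\<exists>f. Q i G f) \<and> ?c G}"
  have finR: "finite ?R" by (rule finite_reg_graphs)
  have Rpos: "0 < card ?R" using n(2)[of i] finR by (simp add: N_def card_gt_0_iff)
  \<comment> \<open>At most a quarter of the graphs lack a suitable labelling, and at most a quarter
    have too many vertices near cycles.\<close>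
  have cR: "card ?R \<le> 2 * card R"
  proof -
    have "?R \<subseteq> R \<union> ({G \<in> ?R. \<not> (\<exists>f. Q i G f)} \<union> {G \<in> ?R. \<not> ?c G})" by (auto simp: R_def)
    then have "card ?R \<le> card (R \<union> ({G \<in> ?R. \<not> (\<exists>f. Q i G f)} \<union> {G \<in> ?R. \<not> ?c G}))"
      using finR by (intro card_mono) (auto simp: R_def)
    also have "\<dots> \<le> card R + (card {G \<in> ?R. \<not> (\<exists>f. Q i G f)} + card {G \<in> ?R. \<not> ?c G})"
      by (intro order_trans[OF card_Un_le] add_mono order_refl card_Un_le)
    finally show ?thesis
      using i(2) few_cyclic_graphs[OF d N(5,2)] unfolding N_def[symmetric] by linarith
  qed
  define F where "F = (\<lambda>G. SOME f. Q i G f)"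
  have F: "Q i G (F G)" if G: "G \<in> R" for G
  proof -
    have "\<exists>f. Q i G f" using G by (simp add: R_def)
    then show ?thesis unfolding F_def by (rule someI_ex)
  qed
  define Bd where "Bd = fact d ^ N * exp (N * (EH - 2 * \<epsilon>)) / (2 :: real)"
  have "card R * Bd \<le> card {(\<sigma>, L) \<in> ematch N d A (edge_type d k) (edge_rev d k). \<forall>a\<in>A. \<bar>card {v \<in> {..<N}. L v = a} / N - p a\<bar> < \<delta>}"
    unfolding A_def
  proof (rule good_graphs_le_ematch[OF d N(7), where q = "\<lambda>G v. \<phi> (F G v)"])
    show "R \<subseteq> ?R" by (auto simp: R_def)
    fix G assume GR: "G \<in> R"
    interpret labelled d N G "\<lambda>v. \<phi> (F G v)" "Suc k" using GR d N(7) by unfold_locales (auto simp: R_def)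
    have Q: "\<And>a. a \<in> A \<Longrightarrow> \<bar>(\<Sum>v<N. mean_at v a) / N - p a\<bar> < t" "\<bar>(\<Sum>v<N. pmf_entropy (\<phi> (F G v))) / N - EH\<bar> < \<epsilon>"
      using F[OF GR] unfolding Q_def N_def[symmetric] by blast+
    have "N * (EH - \<epsilon>) \<le> N * ((\<Sum>v<N. pmf_entropy (\<phi> (F G v))) / N)"
      using Q(2) by (intro mult_left_mono) auto
    then have "N * (EH - \<epsilon>) \<le> (\<Sum>v<N. pmf_entropy (\<phi> (F G v)))" using N(7) by simp
    then have "N * (EH - 2 * \<epsilon>) \<le> (\<Sum>v<N. pmf_entropy (\<phi> (F G v))) - \<epsilon> * N" by (simp add: algebra_simps)
    then have "Bd \<le> fact d ^ N * exp ((\<Sum>v<N. pmf_entropy (\<phi> (F G v))) - \<epsilon> * N) / 2"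
      unfolding Bd_def by (intro divide_right_mono mult_left_mono) auto
    also have "\<dots> \<le> card {\<omega> \<in> set_pmf LP. \<forall>a\<in>PiE ?B (\<lambda>_. UNIV). \<bar>card {v \<in> {..<N}. pat d (Suc k) \<omega> v = a} / N - p a\<bar> < 2 * t}"
      by (rule card_near_lower[OF t \<epsilon> _ _ N(3)[unfolded A_def] N(4)]) (use GR Q(1) in \<open>auto simp: R_def A_def\<close>)
    finally show "Bd \<le> card {\<omega> \<in> set_pmf LP. \<forall>a\<in>PiE ?B (\<lambda>_. UNIV). \<bar>card {v \<in> {..<N}. pat d (Suc k) \<omega> v = a} / N - p a\<bar> < \<delta>}"
      by (simp add: t_def)
  qed
  also have "\<dots> \<le> num_matchings (N * d) * (exp 1 * (real (N * d) + 1)) ^ m * exp (N * (h + \<epsilon>))" by (rule \<delta>(2)[OF N(7)])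
  finally have up: "card R * Bd \<le> num_matchings (N * d) * (exp 1 * (real (N * d) + 1)) ^ m * exp (N * (h + \<epsilon>))" .
  define Z where "Z = real (card ?R) * fact d ^ N"
  have Z: "0 < Z" using Rpos by (simp add: Z_def)
  have "N \<le> N * d" using d by simp
  then have "num_matchings (N * d) \<le> 2 * ((N * d) ^ 3 + 1) ^ ?D * (card ?R * fact d ^ N)"
    by (intro num_matchings_le_reg_graphs[OF d]) (use N(6) in linarith)
  then have "real (num_matchings (N * d)) \<le> real (2 * ((N * d) ^ 3 + 1) ^ ?D * (card ?R * fact d ^ N))" by (simp only: of_nat_le_iff)
  then have cntZ: "real (num_matchings (N * d)) \<le> 2 * (real (N * d) ^ 3 + 1) ^ ?D * Z" by (simp add: Z_def add.commute)
  \<comment> \<open>Z stands on both ends of the chain, so the number of regular graphs itself is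
    never estimated, only its ratio to the number of matchings.\<close>
  have "Z * exp (N * (EH - 2 * \<epsilon>)) = real (card ?R) * (2 * Bd)" by (simp add: Z_def Bd_def)
  also have "\<dots> \<le> real (2 * card R) * (2 * Bd)"
    using cR by (intro mult_right_mono) (auto simp: Bd_def simp flip: of_nat_le_iff)
  also have "\<dots> = 4 * (card R * Bd)" by simp
  also have "\<dots> \<le> 4 * (num_matchings (N * d) * (exp 1 * (real (N * d) + 1)) ^ m * exp (N * (h + \<epsilon>)))" using up by simp
  also have "\<dots> \<le> 4 * ((2 * (real (N * d) ^ 3 + 1) ^ ?D * Z) * (exp 1 * (real (N * d) + 1)) ^ m * exp (N * (h + \<epsilon>)))"
    using cntZ by (intro mult_left_mono mult_right_mono) auto
  also have "\<dots> = Z * ((8 * (real (N * d) ^ 3 + 1) ^ ?D * (exp 1 * (real (N * d) + 1)) ^ m) * exp (N * (h + \<epsilon>)))" by simp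
  also have "\<dots> < Z * (exp (N * \<epsilon>) * exp (N * (h + \<epsilon>)))"
    using N(1) Z by (intro mult_strict_left_mono mult_strict_right_mono) auto
  also have "exp (N * \<epsilon>) * exp (N * (h + \<epsilon>)) = exp (N * (EH - 2 * \<epsilon>))"
  proof -
    have "EH - 2 * \<epsilon> = \<epsilon> + (h + \<epsilon>)" by (simp add: \<epsilon>_def field_simps)
    then show ?thesis unfolding exp_add[symmetric] by (simp only: distrib_left)
  qed
  finally show False by simp
qed

theorem mainTheorem10:
  fixes d :: nat
    and \<mu> :: "(nat list \<Rightarrow> 'x::{metric_space, second_countable_topology}) measure"
    and \<phi> :: "'x \<Rightarrow> 'f::finite pmf"
  assumes "d \<ge> 3"
    and "cont_discretization \<phi>"
    and "invariant_process d borel \<mu>"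
    and "typical d \<mu>"
  shows "invariant_process d (count_space UNIV) (discr_conv d \<phi> \<mu>) \<and>
    (\<forall>k::nat. marg_entropy (discr_conv d \<phi> \<mu>) (tball d k (tC d))
        - real d / 2 * marg_entropy (discr_conv d \<phi> \<mu>) (tball d k tedge)
      \<ge> integral\<^sup>L (distr \<mu> borel (\<lambda>\<alpha>. \<alpha> troot)) (\<lambda>x. pmf_entropy (\<phi> x)))"
proof (intro conjI allI)
  show "invariant_process d (count_space UNIV) (discr_conv d \<phi> \<mu>)"
    by (rule invariant_discr[OF assms(2,3)])
  fix k
  have d: "0 < d" using assms(1) by simp
  have "(\<lambda>\<alpha>. \<alpha> troot) \<in> measurable \<mu> borel"
    unfolding measurable_cong_sets[OF sets_\<mu>[OF assms(2,3)] refl] troot_def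
    by (rule measurable_component_singleton) simp
  then have "integral\<^sup>L (distr \<mu> borel (\<lambda>\<alpha>. \<alpha> troot)) (\<lambda>x. pmf_entropy (\<phi> x)) = (\<integral>\<alpha>. pmf_entropy (\<phi> (\<alpha> [])) \<partial>\<mu>)"
    by (subst integral_distr) (simp_all add: troot_def borel_measurable_continuous_onI[OF continuous_entropy[OF assms(2)]])
  then show "marg_entropy (discr_conv d \<phi> \<mu>) (tball d k (tC d))
        - real d / 2 * marg_entropy (discr_conv d \<phi> \<mu>) (tball d k tedge)
      \<ge> integral\<^sup>L (distr \<mu> borel (\<lambda>\<alpha>. \<alpha> troot)) (\<lambda>x. pmf_entropy (\<phi> x))"
    using typical_entropy_inequality[OF assms(2-4) d, of k] by simp
qed

end
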